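(* Suppose either (i) $1<p<\gamma<2$ or (ii) $2\le p<\gamma<3$, and let $\beta=\gamma-1$. Consider the condition on $f=(f^i_j)$, $f^i_j:\mathbb{R}^n\to\mathbb{R}$ ($1\le i\le n$, $1\le j\le d$), relative to two positive increasing functions $D(R)$, $A(R)$ on $1\le R<\infty$: (G) for all $R\ge1$ and all $y,y'\in\mathbb{R}^n$ with $|y|,|y'|\le R$: $|f(y)|\le D(R)$, and in case (i) $|f(y')-f(y)|\le A(R)|y'-y|^\beta$, while in case (ii) $f$ is differentiable and $|Df(y')-Df(y)|\le A(R)|y'-y|^{\beta-1}$. (a) Let $D(R)$ and $A(R)$ be positive increasing functions on $1\le R<\infty$ with $D(R)\le R^\beta A(R)$, and let $f$ satisfy (G). Suppose $x:[0,\infty)\to\mathbb{R}^d$ is continuous with finite $p$-variation on each bounded interval, and in case (ii) let $A^{rj}(s,t)$ be given satisfying the conditions in the context on each bounded interval. Then, provided $$\int_1^\infty\left\{A(R)^{1-p}D(R)^{p-1-\beta p}\right\}^{1/\beta}dR=\infty,$$ no solution of $$dy^i=\sum_j f^i_j(y)\,dx^j,\qquad y(0)=y_0,$$ can explode in finite time. (b) Conversely, suppose $D(R)$ and $A(R)$ are positive increasing functions on $1\le R<\infty$ with $D(R)\le R^\beta A(R)$, and suppose $$\int_1^\infty\left\{A(R)^{1-p}D(R)^{p-1-\beta p}\right\}^{1/\beta}dR<\infty.$$ Then there exist (for some $n,d$) $f$, $x(t)$, and in case (ii) $A^{rj}(s,t)$, satisfying the same conditions as in (a) (that is, (G), finite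 $p$-variation of $x$ on each bounded interval, and in case (ii) the conditions on $A^{rj}(s,t)$ in the context on each bounded interval), such that the equation has, for some initial value, a solution which explodes in finite time.
   Context: Finite $p$-variation of $x$ on $[0,T]$: there is a continuous increasing function $\omega$ on $[0,T]$ with $|x(t)-x(s)|^p\le\omega(t)-\omega(s)$ for $0\le s\le t\le T$. Conditions on $A^{rj}(s,t)$ (case (ii)), on $[0,T]$: real numbers $A^{rj}(s,t)$, $1\le r,j\le d$, $0\le s\le t\le T$, with $A^{rj}(s,u)=A^{rj}(s,t)+A^{rj}(t,u)+(x^r(t)-x^r(s))(x^j(u)-x^j(t))$ whenever $s\le t\le u$, and $|A^{rj}(s,t)|^{p/2}\le\omega(t)-\omega(s)$ (with $\omega$ redefined if necessary). (These are unrelated to the function $A(R)$.) Solution: $y:[0,t_1]\to\mathbb{R}^n$ is a solution on $[0,t_1]$ if $y(0)=y_0$ and there exist a continuous increasing function $\tilde\omega$ on $[0,t_1]$ and a non-negative function $\theta$ on $[0,\infty)$ with $\theta(\delta)=o(\delta)$ as $\delta\to0$ such that for all $i$ and all $0\le s<t\le t_1$: in case (i) $$\Big|y^i(t)-y^i(s)-\sum_j f^i_j(y(s))(x^j(t)-x^j(s))\Big|\le\theta(\tilde\omega(t)-\tilde\omega(s)),$$ and in case (ii) $$\Big|y^i(t)-y^i(s)-\sum_j f^i_j(y(s))(x^j(t)-x^j(s))-\sum_{h,r,j}f^h_r(y(s))\,\partial_hf^i_j(y(s))\,A^{rj}(s,t)\Big|\le\theta(\tilde\omega(t)-\tilde\omega(s)).$$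 A solution explodes in finite time if for some $0<\tau<\infty$ it is defined on $[0,\tau)$, is a solution on $[0,t_1]$ for every $t_1<\tau$, and $|y(t)|\to\infty$ as $t\to\tau$. *)

theory Defs
  imports "HOL-Analysis.Analysis" "HOL-Library.Landau_Symbols"
begin

text \<open>
  The dimensions \<open>n\<close> and \<open>d\<close> are quantified inside the theorem (existentially in the converse), so
  vectors in real \<open>n\<close>-space are the points of the library's \<^const>\<open>Euclidean_space\<close>, that is, functions
  \<open>v :: nat \<Rightarrow> real\<close> with \<open>v i = 0\<close> for \<open>i \<ge> n\<close>. Coordinates are numbered from \<open>0\<close>.
  Norms, also those of coefficient arrays, are Euclidean (\<^const>\<open>L2_set\<close>).
  The coefficient written $f^i_j(y)$ is \<open>f y i j\<close>, and $A^{rj}(s,t)$ is \<open>area r j s t\<close>.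
\<close>

abbreviation Rn :: "nat \<Rightarrow> (nat \<Rightarrow> real) set"
  where "Rn n \<equiv> topspace (Euclidean_space n)"

definition enorm :: "nat \<Rightarrow> (nat \<Rightarrow> real) \<Rightarrow> real"
  where "enorm n v = L2_set v {..<n}"

definition edist :: "nat \<Rightarrow> (nat \<Rightarrow> real) \<Rightarrow> (nat \<Rightarrow> real) \<Rightarrow> real"
  where "edist n v w = enorm n (\<lambda>i. v i - w i)"

text \<open>Frechet differentiability at \<open>y\<close> of a real function on \<open>Rn n\<close>; every linear functional on
  \<open>Rn n\<close> has the form \<open>v \<mapsto> \<Sum>h<n. g h * v h\<close>.\<close>

definition differentiable_Rn :: "nat \<Rightarrow> ((nat \<Rightarrow> real) \<Rightarrow> real) \<Rightarrow> (nat \<Rightarrow> real) \<Rightarrow> bool"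
  where "differentiable_Rn n \<phi> y \<longleftrightarrow>
    (\<exists>g :: nat \<Rightarrow> real. \<forall>\<epsilon>>0. \<exists>\<delta>>0. \<forall>z\<in>Rn n. edist n z y < \<delta> \<longrightarrow>
       \<bar>\<phi> z - \<phi> y - (\<Sum>h<n. g h * (z h - y h))\<bar> \<le> \<epsilon> * edist n z y)"

definition partial_deriv :: "nat \<Rightarrow> ((nat \<Rightarrow> real) \<Rightarrow> real) \<Rightarrow> (nat \<Rightarrow> real) \<Rightarrow> real"
  where "partial_deriv h \<phi> y = deriv (\<lambda>u. \<phi> (y(h := u))) (y h)"

definition growth_pair :: "real \<Rightarrow> (real \<Rightarrow> real) \<Rightarrow> (real \<Rightarrow> real) \<Rightarrow> bool"
  where "growth_pair \<beta> D A \<longleftrightarrow>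
    mono_on {1..} D \<and> mono_on {1..} A \<and>
    (\<forall>R\<ge>1. D R > 0 \<and> A R > 0 \<and> D R \<le> R powr \<beta> * A R)"

definition growth_integral :: "real \<Rightarrow> real \<Rightarrow> (real \<Rightarrow> real) \<Rightarrow> (real \<Rightarrow> real) \<Rightarrow> ennreal"
  where "growth_integral p \<beta> D A =
    (\<integral>\<^sup>+ R\<in>{1..}. ennreal ((A R powr (1 - p) * D R powr (p - 1 - \<beta> * p)) powr (1 / \<beta>)) \<partial>lborel)"

text \<open>In all definitions below, \<open>p < 2\<close> selects case (i), \<open>1 < p < \<gamma> < 2\<close>, and \<open>p \<ge> 2\<close> selects case (ii),
  \<open>2 \<le> p < \<gamma> < 3\<close>.\<close>

definition cond_G ::
  "real \<Rightarrow> real \<Rightarrow> nat \<Rightarrow> nat \<Rightarrow> (real \<Rightarrow> real) \<Rightarrow> (real \<Rightarrow> real) \<Rightarrow>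
   ((nat \<Rightarrow> real) \<Rightarrow> nat \<Rightarrow> nat \<Rightarrow> real) \<Rightarrow> bool"
  where "cond_G p \<beta> n d D A f \<longleftrightarrow>
    (\<forall>R\<ge>1. \<forall>y\<in>Rn n. \<forall>y'\<in>Rn n. enorm n y \<le> R \<and> enorm n y' \<le> R \<longrightarrow>
       L2_set (\<lambda>(i, j). f y i j) ({..<n} \<times> {..<d}) \<le> D R \<and>
       (if p < 2
        then L2_set (\<lambda>(i, j). f y' i j - f y i j) ({..<n} \<times> {..<d}) \<le> A R * edist n y' y powr \<beta>
        else (\<forall>i<n. \<forall>j<d. differentiable_Rn n (\<lambda>z. f z i j) y) \<and>
             L2_set (\<lambda>(h, i, j). partial_deriv h (\<lambda>z. f z i j) y' - partial_deriv h (\<lambda>z. f z i j) y)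
               ({..<n} \<times> {..<n} \<times> {..<d}) \<le> A R * edist n y' y powr (\<beta> - 1)))"

definition control :: "real \<Rightarrow> (real \<Rightarrow> real) \<Rightarrow> bool"
  where "control T \<omega> \<longleftrightarrow> continuous_on {0..T} \<omega> \<and> mono_on {0..T} \<omega>"

definition pvar_bound :: "real \<Rightarrow> nat \<Rightarrow> (real \<Rightarrow> nat \<Rightarrow> real) \<Rightarrow> real \<Rightarrow> (real \<Rightarrow> real) \<Rightarrow> bool"
  where "pvar_bound p d x T \<omega> \<longleftrightarrow>
    (\<forall>s t. 0 \<le> s \<and> s \<le> t \<and> t \<le> T \<longrightarrow> edist d (x t) (x s) powr p \<le> \<omega> t - \<omega> s)"

definition finite_pvar :: "real \<Rightarrow> nat \<Rightarrow> (real \<Rightarrow> nat \<Rightarrow> real) \<Rightarrow> real \<Rightarrow> bool"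
  where "finite_pvar p d x T \<longleftrightarrow> (\<exists>\<omega>. control T \<omega> \<and> pvar_bound p d x T \<omega>)"

definition area_cond ::
  "real \<Rightarrow> nat \<Rightarrow> (real \<Rightarrow> nat \<Rightarrow> real) \<Rightarrow> (nat \<Rightarrow> nat \<Rightarrow> real \<Rightarrow> real \<Rightarrow> real) \<Rightarrow> real \<Rightarrow> bool"
  where "area_cond p d x area T \<longleftrightarrow>
    (\<forall>r<d. \<forall>j<d. \<forall>s t u. 0 \<le> s \<and> s \<le> t \<and> t \<le> u \<and> u \<le> T \<longrightarrow>
       area r j s u = area r j s t + area r j t u + (x t r - x s r) * (x u j - x t j)) \<and>
    (\<exists>\<omega>. control T \<omega> \<and> pvar_bound p d x T \<omega> \<and>
       (\<forall>r<d. \<forall>j<d. \<forall>s t. 0 \<le> s \<and> s \<le> t \<and> t \<le> T \<longrightarrow>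
          \<bar>area r j s t\<bar> powr (p / 2) \<le> \<omega> t - \<omega> s))"

text \<open>The hypotheses on the driving signal \<open>x : [0,\<infinity>) \<rightarrow> Rn d\<close>; in case (i) \<open>area\<close> is irrelevant.\<close>

definition driver ::
  "real \<Rightarrow> nat \<Rightarrow> (real \<Rightarrow> nat \<Rightarrow> real) \<Rightarrow> (nat \<Rightarrow> nat \<Rightarrow> real \<Rightarrow> real \<Rightarrow> real) \<Rightarrow> bool"
  where "driver p d x area \<longleftrightarrow>
    continuous_map (top_of_set {0..}) (Euclidean_space d) x \<and>
    (\<forall>T>0. finite_pvar p d x T) \<and>
    (p \<ge> 2 \<longrightarrow> (\<forall>T>0. area_cond p d x area T))"

definition increment_error ::
  "real \<Rightarrow> nat \<Rightarrow> nat \<Rightarrow> ((nat \<Rightarrow> real) \<Rightarrow> nat \<Rightarrow> nat \<Rightarrow> real) \<Rightarrow> (real \<Rightarrow> nat \<Rightarrow> real) \<Rightarrow>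
   (nat \<Rightarrow> nat \<Rightarrow> real \<Rightarrow> real \<Rightarrow> real) \<Rightarrow> (real \<Rightarrow> nat \<Rightarrow> real) \<Rightarrow> nat \<Rightarrow> real \<Rightarrow> real \<Rightarrow> real"
  where "increment_error p n d f x area y i s t =
    y t i - y s i - (\<Sum>j<d. f (y s) i j * (x t j - x s j)) -
    (if p < 2 then 0
     else \<Sum>h<n. \<Sum>r<d. \<Sum>j<d.
            f (y s) h r * partial_deriv h (\<lambda>z. f z i j) (y s) * area r j s t)"

text \<open>
  \<open>\<theta>(\<delta>) = o(\<delta>)\<close> is an estimate for all small \<open>\<delta> \<ge> 0\<close>, so it includes \<open>\<theta> 0 = 0\<close>. The filter
  \<^term>\<open>at_right (0::real)\<close> does not see the point \<open>0\<close>. That value matters because a control may be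
  constant on an interval.
\<close>

definition solution_on ::
  "real \<Rightarrow> nat \<Rightarrow> nat \<Rightarrow> ((nat \<Rightarrow> real) \<Rightarrow> nat \<Rightarrow> nat \<Rightarrow> real) \<Rightarrow> (real \<Rightarrow> nat \<Rightarrow> real) \<Rightarrow>
   (nat \<Rightarrow> nat \<Rightarrow> real \<Rightarrow> real \<Rightarrow> real) \<Rightarrow> (nat \<Rightarrow> real) \<Rightarrow> (real \<Rightarrow> nat \<Rightarrow> real) \<Rightarrow> real \<Rightarrow> bool"
  where "solution_on p n d f x area y0 y t1 \<longleftrightarrow>
    y \<in> {0..t1} \<rightarrow> Rn n \<and> y 0 = y0 \<and>
    (\<exists>\<omega> \<theta>. control t1 \<omega> \<and>
       (\<forall>\<delta>\<ge>0. \<theta> \<delta> \<ge> 0) \<and> \<theta> 0 = 0 \<and> \<theta> \<in> o[at_right 0](\<lambda>\<delta>. \<delta>) \<and>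
       (\<forall>i<n. \<forall>s t. 0 \<le> s \<and> s < t \<and> t \<le> t1 \<longrightarrow>
          \<bar>increment_error p n d f x area y i s t\<bar> \<le> \<theta> (\<omega> t - \<omega> s)))"

definition explodes ::
  "real \<Rightarrow> nat \<Rightarrow> nat \<Rightarrow> ((nat \<Rightarrow> real) \<Rightarrow> nat \<Rightarrow> nat \<Rightarrow> real) \<Rightarrow> (real \<Rightarrow> nat \<Rightarrow> real) \<Rightarrow>
   (nat \<Rightarrow> nat \<Rightarrow> real \<Rightarrow> real \<Rightarrow> real) \<Rightarrow> (nat \<Rightarrow> real) \<Rightarrow> (real \<Rightarrow> nat \<Rightarrow> real) \<Rightarrow> bool"
  where "explodes p n d f x area y0 y \<longleftrightarrow>
    (\<exists>\<tau>>0. (\<forall>t1. 0 < t1 \<and> t1 < \<tau> \<longrightarrow> solution_on p n d f x area y0 y t1) \<and>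
       filterlim (\<lambda>t. enorm n (y t)) at_top (at_left \<tau>))"

end

theory Submission
  imports Defs
begin

text \<open>
  Part (a). While \<open>\<bar>y\<bar> \<le> R\<close>, rescale \<open>y\<close> by the length \<open>l\<close>, proportional to
  \<open>(D / A) powr (1 / \<beta>)\<close> and at most \<open>R\<close>. The constants in (G) then become absolute. A sewing argument by
  bisection shows that moving \<open>y\<close> by \<open>l\<close> costs the control of \<open>x\<close> at least a constant times
  \<open>(l / D) powr p\<close>. Crossing from \<open>\<bar>y\<bar> = R\<close> to \<open>\<bar>y\<bar> = 2 R\<close> takes at least about \<open>R / l\<close>
  such steps, and their total cost is comparable to the part of the integral over a dyadic interval.
  An explosion would make the control infinite.

  Part (b), with \<open>n = d = 1\<close>. In case (i) the equation is \<open>dy = f(y) dx\<close>. In case (ii) take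
  \<open>x = 0\<close> and \<open>A(s,t) = g(t) - g(s)\<close>, which satisfies Chen's relation, so that the equation becomes
  \<open>dy = f(y) f'(y) dg\<close>. In both cases the coefficient is only Hoelder continuous, with exponent less
  than \<open>1\<close>. Let it oscillate in sign on the length scale \<open>l\<close>. It has zeros, but a solution can
  leave them since uniqueness fails there. Let \<open>x\<close> (or \<open>g\<close>) go up while the coefficient is positive and
  down while it is negative. Then \<open>y\<close> always increases, and the cost of each cell is again
  \<open>(l / D) powr p\<close>, so the total cost is bounded by the integral.
\<close>

section \<open>Sewing by bisection\<close>

text \<open>At a length \<open>l\<close> with \<open>A * l powr \<beta>\<close> of the order of
  \<open>D\<close>, the bounds on the size and on the oscillation of \<open>f\<close> balance. The
  cost per unit length, \<open>(l / D) powr p / l\<close>, is then a constant times the integrand.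
  Two obstacles shape part (a). The control in the definition of a solution is unrelated to that of
  the driver, and only the latter is finite up to the explosion time; so the former enters with a
  small weight and must not occur in any bound. In case (ii), (G) does not bound \<open>Df\<close>;
  such a bound is interpolated on a ball of twice the radius. In case (ii) of part (b) the
  coefficient has to satisfy \<open>f * f' = field\<close> for an oscillating field. This gives
  \<open>f = sqrt (2 * H)\<close> with \<open>H' = field\<close>, and \<open>H\<close> must stay
  positive. Hence the cells come in pairs, of unequal lengths, on which rise and fall of
  \<open>H\<close> nearly cancel. As \<open>f\<close> is continuous while \<open>D\<close> may jump,
  \<open>f\<close> follows \<open>D\<close> only by a bounded factor per pair, and the cost of
  catching up needs its own summation.\<close>

lemma interval_bisection_induct:
  fixes \<Omega> :: "real \<Rightarrow> real" and P :: "real \<Rightarrow> real \<Rightarrow> bool"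
  assumes cont: "continuous_on {a..b} \<Omega>"
    and "0 < \<delta>"
    and base: "\<And>s u. a \<le> s \<Longrightarrow> s \<le> u \<Longrightarrow> u \<le> b \<Longrightarrow> \<Omega> u - \<Omega> s \<le> \<delta> \<Longrightarrow> P s u"
    and step: "\<And>s t u. a \<le> s \<Longrightarrow> s \<le> t \<Longrightarrow> t \<le> u \<Longrightarrow> u \<le> b \<Longrightarrow>
      \<Omega> t - \<Omega> s = (\<Omega> u - \<Omega> s) / 2 \<Longrightarrow> \<Omega> u - \<Omega> t = (\<Omega> u - \<Omega> s) / 2 \<Longrightarrow>
      \<Omega> u - \<Omega> s \<le> h \<Longrightarrow> P s t \<Longrightarrow> P t u \<Longrightarrow> P s u"
    and "a \<le> s" "s \<le> u" "u \<le> b" "\<Omega> u - \<Omega> s \<le> h"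
  shows "P s u"
proof -
  \<comment> \<open>The depth of the recursion comes from \<open>\<delta>\<close>, the scale on
    which \<open>base\<close> applies. It leaves no trace in \<open>P\<close>, so the bounds
    obtained later do not depend on that scale.\<close>
  obtain N where "h / \<delta> < 2 ^ N"
    using real_arch_pow[of 2 "h / \<delta>"] by auto
  hence "h \<le> 2 ^ N * \<delta>"
    using \<open>0 < \<delta>\<close> by (simp add: field_simps)
  hence "\<Omega> u - \<Omega> s \<le> 2 ^ N * \<delta>" using assms(8) by simp
  thus ?thesis using assms(5-8)
  proof (induction N arbitrary: s u)
    case 0
    thus ?case using base by simp
  next
    case (Suc N)
    show ?case
    proof (cases "\<Omega> u - \<Omega> s \<le> \<delta>")
      case True
      thus ?thesis using base Suc.prems by simp
    next
      case False
      have c: "continuous_on {s..u} \<Omega>"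
        using continuous_on_subset[OF cont] Suc.prems by auto
      \<comment> \<open>The interval is cut at the middle value of the control, not at its midpoint
        in time, so both parts carry exactly half of the control.\<close>
      have "\<Omega> s \<le> (\<Omega> s + \<Omega> u) / 2" "(\<Omega> s + \<Omega> u) / 2 \<le> \<Omega> u"
        using False \<open>0 < \<delta>\<close> by auto
      then obtain t where t: "s \<le> t" "t \<le> u" "\<Omega> t = (\<Omega> s + \<Omega> u) / 2"
        using IVT'[OF _ _ \<open>s \<le> u\<close> c] by blast
      have e: "\<Omega> t - \<Omega> s = (\<Omega> u - \<Omega> s) / 2" "\<Omega> u - \<Omega> t = (\<Omega> u - \<Omega> s) / 2"
        using t(3) by (simp_all add: field_simps)
      have l: "\<Omega> t - \<Omega> s \<le> 2 ^ N * \<delta>" "\<Omega> u - \<Omega> t \<le> 2 ^ N * \<delta>" "\<Omega> t - \<Omega> s \<le> h" "\<Omega> u - \<Omega> t \<le> h"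
        using e Suc.prems False \<open>0 < \<delta>\<close> by (auto simp: field_simps)
      have "P s t" "P t u"
        using Suc.IH[OF l(1)] Suc.IH[OF l(2)] l Suc.prems t by auto
      thus ?thesis using step[OF _ t(1,2) _ e] Suc.prems by auto
    qed
  qed
qed

text \<open>With \<open>K = M / (1 - 2 powr (1 - \<gamma> / p))\<close>, the fixed point of
  \<open>K = M + K * 2 powr (1 - \<gamma> / p)\<close>, the radius makes
  \<open>K * w powr (\<gamma> / p)\<close> at most half of \<open>w powr (\<kappa> / p)\<close>. The
  \<open>+ 1\<close> covers \<open>K = 0\<close>.\<close>

definition sewing_radius :: "real \<Rightarrow> real \<Rightarrow> real \<Rightarrow> real \<Rightarrow> real"
  where "sewing_radius \<kappa> p \<gamma> M =
    min 1 ((1 / (2 * (M / (1 - 2 powr (1 - \<gamma> / p)) + 1))) powr (1 / (\<gamma> / p - \<kappa> / p)))"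

lemma two_powr_one_minus_less_one: "1 < \<alpha> \<Longrightarrow> (2::real) powr (1 - \<alpha>) < 1"
  using powr_less_mono[of "1 - \<alpha>" 0 "2::real"] by simp

lemma sewing_radius_pos:
  assumes "0 < p" "p < \<gamma>" "0 \<le> M"
  shows "0 < sewing_radius \<kappa> p \<gamma> M"
proof -
  have "0 \<le> M / (1 - 2 powr (1 - \<gamma> / p))"
    using assms two_powr_one_minus_less_one[of "\<gamma> / p"] by simp
  thus ?thesis by (simp add: sewing_radius_def)
qed

text \<open>A term linear in the control passes through a bisection unchanged, while a term with the
  power \<open>\<gamma> / p > 1\<close> shrinks by the factor
  \<open>2 powr (1 - \<gamma> / p)\<close>, which leaves room for the defect \<open>M\<close>. The
  defect estimate itself presupposes an a priori bound on the left part; the induction supplies it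
  for intervals below the radius.\<close>

lemma sewing:
  fixes p \<gamma> \<kappa> M :: real and \<Omega> :: "real \<Rightarrow> real" and J :: "nat \<Rightarrow> real \<Rightarrow> real \<Rightarrow> real"
  assumes \<kappa>: "0 < \<kappa>" "\<kappa> \<le> p" and \<gamma>: "p < \<gamma>" and M: "0 \<le> M"
    and ab: "a \<le> b" and cont: "continuous_on {a..b} \<Omega>" and mono: "mono_on {a..b} \<Omega>"
    and \<delta>: "0 < \<delta>"
    and base: "\<And>s u i. \<lbrakk>a \<le> s; s \<le> u; u \<le> b; \<Omega> u - \<Omega> s \<le> \<delta>; i < n\<rbrakk> \<Longrightarrow> \<bar>J i s u\<bar> \<le> (\<Omega> u - \<Omega> s) / 2"
    and step: "\<And>s t u i. \<lbrakk>a \<le> s; s \<le> t; t \<le> u; u \<le> b; \<Omega> u - \<Omega> s \<le> 1; i < n;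
       \<And>k. k < n \<Longrightarrow> \<bar>J k s t\<bar> \<le> (\<Omega> t - \<Omega> s) powr (\<kappa> / p)\<rbrakk> \<Longrightarrow>
       \<bar>J i s u\<bar> \<le> \<bar>J i s t\<bar> + \<bar>J i t u\<bar> + M * (\<Omega> u - \<Omega> s) powr (\<gamma> / p)"
    and le: "\<Omega> b - \<Omega> a \<le> sewing_radius \<kappa> p \<gamma> M"
    and i: "i < n"
  shows "\<bar>J i a b\<bar> \<le> (\<Omega> b - \<Omega> a) powr (\<kappa> / p)"
proof -
  define \<alpha> where "\<alpha> = \<gamma> / p"
  define e where "e = \<alpha> - \<kappa> / p"
  have p: "0 < p" using \<kappa> by simp
  have \<alpha>: "1 < \<alpha>" using \<gamma> p by (simp add: \<alpha>_def)
  have e: "0 < e" using \<kappa> \<gamma> p by (simp add: e_def \<alpha>_def diff_divide_distrib[symmetric])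
  have kp: "\<kappa> / p \<le> 1" "0 < \<kappa> / p" using \<kappa> p by auto
  have two: "2 powr (1 - \<alpha>) < 1"
    using two_powr_one_minus_less_one[OF \<alpha>] .
  define K where "K = M / (1 - 2 powr (1 - \<alpha>))"
  have K: "0 \<le> K" "M + K * 2 powr (1 - \<alpha>) = K"
  proof -
    define q where "q = 1 - 2 powr (1 - \<alpha>)"
    have "0 < q" "2 powr (1 - \<alpha>) = 1 - q" "K = M / q" using two by (auto simp: q_def K_def)
    thus "0 \<le> K" "M + K * 2 powr (1 - \<alpha>) = K"
      using M by (simp, simp add: right_diff_distrib)
  qed
  define h where "h = min 1 ((1 / (2 * (K + 1))) powr (1 / e))"
  have h: "h \<le> 1" "sewing_radius \<kappa> p \<gamma> M = h" by (auto simp: h_def sewing_radius_def K_def e_def \<alpha>_def)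
  \<comment> \<open>This closes the bootstrap: below the radius, the inductive bound implies the a
    priori bound that \<open>step\<close> asks for. Each of the two summands takes half of
    \<open>w powr (\<kappa> / p)\<close>.\<close>
  have small: "K * w powr \<alpha> + w / 2 \<le> w powr (\<kappa> / p)" if "0 \<le> w" "w \<le> h" for w
  proof (cases "w = 0")
    case False
    with that have w: "0 < w" "w \<le> 1" "w \<le> (1 / (2 * (K + 1))) powr (1 / e)" by (auto simp: h_def)
    have "w powr e \<le> ((1 / (2 * (K + 1))) powr (1 / e)) powr e"
      using w e by (intro powr_mono2) auto
    also have "\<dots> = 1 / (2 * (K + 1))" using e K by (simp add: powr_powr)
    finally have "K * w powr e \<le> K * (1 / (2 * (K + 1)))" using K by (intro mult_left_mono) auto
    also have "\<dots> \<le> 1 / 2" using K by (simp add: field_simps)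
    finally have "K * w powr e * w powr (\<kappa> / p) \<le> 1 / 2 * w powr (\<kappa> / p)"
      by (intro mult_right_mono) auto
    moreover have "w powr \<alpha> = w powr e * w powr (\<kappa> / p)"
      by (simp add: e_def flip: powr_add)
    moreover have "w \<le> w powr (\<kappa> / p)"
      using w kp powr_mono'[of "\<kappa> / p" 1 w] by simp
    ultimately show ?thesis by (simp only: mult.assoc)
  qed simp
  have pos: "0 \<le> \<Omega> u - \<Omega> s" if "a \<le> s" "s \<le> u" "u \<le> b" for s u
    using mono_onD[OF mono, of s u] that by simp
  let ?P = "\<lambda>s u. \<forall>i<n. \<bar>J i s u\<bar> \<le> K * (\<Omega> u - \<Omega> s) powr \<alpha> + (\<Omega> u - \<Omega> s) / 2"
  have "?P a b"
  proof (rule interval_bisection_induct[of a b \<Omega> \<delta> ?P h])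
    fix s u assume *: "a \<le> s" "s \<le> u" "u \<le> b" "\<Omega> u - \<Omega> s \<le> \<delta>"
    show "?P s u"
      using base[OF *] K by (smt (verit) mult_nonneg_nonneg powr_ge_zero)
  next
    fix s t u assume *: "a \<le> s" "s \<le> t" "t \<le> u" "u \<le> b" "\<Omega> t - \<Omega> s = (\<Omega> u - \<Omega> s) / 2"
      "\<Omega> u - \<Omega> t = (\<Omega> u - \<Omega> s) / 2" "\<Omega> u - \<Omega> s \<le> h" and P: "?P s t" "?P t u"
    let ?w = "\<Omega> u - \<Omega> s"
    have w: "0 \<le> ?w" using pos[of s u] * by simp
    have st: "\<bar>J k s t\<bar> \<le> (\<Omega> t - \<Omega> s) powr (\<kappa> / p)" if "k < n" for k
      using P(1) that small[of "\<Omega> t - \<Omega> s"] * w by fastforce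
    have half: "(?w / 2) powr \<alpha> = ?w powr \<alpha> * 2 powr (1 - \<alpha>) / 2"
      using w by (simp add: powr_divide powr_diff)
    show "?P s u"
    proof (intro allI impI)
      fix i assume i: "i < n"
      have "\<bar>J i s u\<bar> \<le> \<bar>J i s t\<bar> + \<bar>J i t u\<bar> + M * ?w powr \<alpha>"
        unfolding \<alpha>_def using *(7) h by (intro step[OF *(1-4) _ i st]) auto
      also have "\<dots> \<le> 2 * (K * (?w / 2) powr \<alpha> + (?w / 2) / 2) + M * ?w powr \<alpha>"
        using add_mono[OF P(1)[rule_format, OF i] P(2)[rule_format, OF i]] unfolding *(5,6)
        by (simp only: mult_2 add_le_cancel_right)
      also have "\<dots> = (M + K * 2 powr (1 - \<alpha>)) * ?w powr \<alpha> + ?w / 2"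
        unfolding half by (simp add: field_simps)
      finally show "\<bar>J i s u\<bar> \<le> K * ?w powr \<alpha> + ?w / 2" unfolding K(2) .
    qed
  qed (use cont \<delta> ab le h in auto)
  thus ?thesis
    using small[of "\<Omega> b - \<Omega> a"] pos[of a b] ab le i h by fastforce
qed

section \<open>Defect of additivity of a second-order expansion\<close>

lemma abs_sum_le:
  fixes f :: "nat \<Rightarrow> real"
  assumes "\<And>i. i < n \<Longrightarrow> \<bar>f i\<bar> \<le> K"
  shows "\<bar>\<Sum>i<n. f i\<bar> \<le> real n * K"
proof -
  have "\<bar>\<Sum>i<n. f i\<bar> \<le> (\<Sum>i<n. \<bar>f i\<bar>)" by (rule sum_abs)
  also have "\<dots> \<le> (\<Sum>i<n. K)" using assms by (intro sum_mono) auto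
  finally show ?thesis by simp
qed

lemma abs_mult_le:
  fixes x y :: real
  assumes "\<bar>x\<bar> \<le> a" "\<bar>y\<bar> \<le> b"
  shows "\<bar>x * y\<bar> \<le> a * b"
  using assms by (auto simp: abs_mult intro!: mult_mono)

text \<open>The indices 0, 1, 2 stand for times s, t, u; \<open>fa\<close> is the coefficient,
  \<open>fb\<close> its derivative and \<open>v\<close> the increment of the solution from s to t.
  The product \<open>xs r * xt j\<close> in Chen's relation supplies the correction by which the
  linear Taylor term \<open>fb0 * v\<close> turns into \<open>fb0 * (v - fa0 * xs)\<close>, which is
  of second order.\<close>

lemma second_order_defect_eq:
  fixes n d :: nat and fa0 fa1 :: "nat \<Rightarrow> nat \<Rightarrow> real" and fb0 fb1 :: "nat \<Rightarrow> nat \<Rightarrow> nat \<Rightarrow> real"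
  defines "S \<equiv> \<lambda>a b A i. \<Sum>h<n. \<Sum>r<d. \<Sum>j<d. a h r * b h i j * A r j"
  assumes A: "\<And>r j. r < d \<Longrightarrow> j < d \<Longrightarrow> Au r j = As r j + At r j + xs r * xt j"
  shows "(y2 - y0 - (\<Sum>j<d. fa0 i j * (xs j + xt j)) - S fa0 fb0 Au i)
      - (y1 - y0 - (\<Sum>j<d. fa0 i j * xs j) - S fa0 fb0 As i)
      - (y2 - y1 - (\<Sum>j<d. fa1 i j * xt j) - S fa1 fb1 At i)
    = (\<Sum>j<d. (fa1 i j - fa0 i j - (\<Sum>h<n. fb0 h i j * v h)) * xt j)
      + (\<Sum>j<d. (\<Sum>h<n. fb0 h i j * (v h - (\<Sum>r<d. fa0 h r * xs r))) * xt j)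
      + (\<Sum>h<n. \<Sum>r<d. \<Sum>j<d. (fa1 h r * fb1 h i j - fa0 h r * fb0 h i j) * At r j)"
proof -
  have 1: "S fa0 fb0 Au i = S fa0 fb0 As i + S fa0 fb0 At i + S fa0 fb0 (\<lambda>r j. xs r * xt j) i"
    unfolding S_def by (simp add: A ring_distribs sum.distrib cong: sum.cong_simp)
  have "S fa0 fb0 (\<lambda>r j. xs r * xt j) i
      = (\<Sum>h<n. \<Sum>j<d. \<Sum>r<d. fa0 h r * fb0 h i j * (xs r * xt j))"
    unfolding S_def by (intro sum.cong refl sum.swap)
  also have "\<dots> = (\<Sum>j<d. \<Sum>h<n. \<Sum>r<d. fa0 h r * fb0 h i j * (xs r * xt j))"
    by (rule sum.swap)
  also have "\<dots> = (\<Sum>j<d. (\<Sum>h<n. fb0 h i j * (\<Sum>r<d. fa0 h r * xs r)) * xt j)"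
    by (simp add: sum_distrib_left sum_distrib_right mult_ac)
  finally have 2: "S fa0 fb0 (\<lambda>r j. xs r * xt j) i
      = (\<Sum>j<d. (\<Sum>h<n. fb0 h i j * (\<Sum>r<d. fa0 h r * xs r)) * xt j)" .
  have 3: "(\<Sum>h<n. \<Sum>r<d. \<Sum>j<d. (fa1 h r * fb1 h i j - fa0 h r * fb0 h i j) * At r j)
      = S fa1 fb1 At i - S fa0 fb0 At i"
    unfolding S_def by (simp add: left_diff_distrib sum_subtractf)
  have 4: "(\<Sum>j<d. (fa1 i j - fa0 i j - (\<Sum>h<n. fb0 h i j * v h)) * xt j)
      + (\<Sum>j<d. (\<Sum>h<n. fb0 h i j * (v h - (\<Sum>r<d. fa0 h r * xs r))) * xt j)
      = (\<Sum>j<d. fa1 i j * xt j) - (\<Sum>j<d. fa0 i j * xt j)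
        - (\<Sum>j<d. (\<Sum>h<n. fb0 h i j * (\<Sum>r<d. fa0 h r * xs r)) * xt j)"
    by (simp add: left_diff_distrib right_diff_distrib sum_subtractf)
  show ?thesis
    unfolding 1 2 3 4 by (simp add: distrib_left sum.distrib)
qed

lemma powr_le_powr_of_le_one:
  fixes \<rho> :: real
  assumes "0 \<le> \<rho>" "\<rho> \<le> 1" "a \<le> b"
  shows "\<rho> powr b \<le> \<rho> powr a"
  using assms by (intro powr_mono') auto

text \<open>The signal counts as \<open>\<rho>\<close> and the area as \<open>\<rho>^2\<close>. The
  three sums are then of order \<open>\<rho>^\<beta> * \<rho>\<close>,
  \<open>\<rho>^2 * \<rho>\<close> and \<open>\<rho>^(\<beta> - 1) * \<rho>^2\<close>, and
  \<open>\<rho> \<le> 1\<close>, \<open>\<beta> < 2\<close> reduce all of them to the power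
  \<open>1 + \<beta>\<close>.\<close>

lemma second_order_defect_le:
  fixes \<rho> \<beta> B C C2 :: real and fa0 fa1 :: "nat \<Rightarrow> nat \<Rightarrow> real"
    and fb0 fb1 :: "nat \<Rightarrow> nat \<Rightarrow> nat \<Rightarrow> real" and v xs xt :: "nat \<Rightarrow> real"
  assumes \<beta>: "1 < \<beta>" "\<beta> < 2" and \<rho>: "0 \<le> \<rho>" "\<rho> \<le> 1" and nn: "0 \<le> B" "0 \<le> C" "0 \<le> C2"
    and fa: "\<And>h r. h < n \<Longrightarrow> r < d \<Longrightarrow> \<bar>fa1 h r\<bar> \<le> 1"
    and fb: "\<And>h i j. h < n \<Longrightarrow> i < n \<Longrightarrow> j < d \<Longrightarrow> \<bar>fb0 h i j\<bar> \<le> B"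
    and xt: "\<And>j. j < d \<Longrightarrow> \<bar>xt j\<bar> \<le> \<rho>"
    and At: "\<And>r j. r < d \<Longrightarrow> j < d \<Longrightarrow> \<bar>At r j\<bar> \<le> \<rho>\<^sup>2"
    and V: "0 \<le> V" "V \<le> C * \<rho>" "\<And>h. h < n \<Longrightarrow> \<bar>v h\<bar> \<le> V"
    and Z: "\<And>h. h < n \<Longrightarrow> \<bar>v h - (\<Sum>r<d. fa0 h r * xs r)\<bar> \<le> C2 * \<rho>\<^sup>2"
    and Ta: "\<And>i j. i < n \<Longrightarrow> j < d \<Longrightarrow> \<bar>fa1 i j - fa0 i j - (\<Sum>h<n. fb0 h i j * v h)\<bar> \<le> V powr \<beta>"
    and Tb: "\<And>h i j. h < n \<Longrightarrow> i < n \<Longrightarrow> j < d \<Longrightarrow> \<bar>fb1 h i j - fb0 h i j\<bar> \<le> V powr (\<beta> - 1)"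
    and i: "i < n"
  defines "M \<equiv> real d * C powr \<beta> + real d * (real n * (B * C2))
      + real n * (real d * (real d * (C powr (\<beta> - 1) + B * (real n * (B * C) + C powr \<beta>))))"
  shows "\<bar>(\<Sum>j<d. (fa1 i j - fa0 i j - (\<Sum>h<n. fb0 h i j * v h)) * xt j)
      + (\<Sum>j<d. (\<Sum>h<n. fb0 h i j * (v h - (\<Sum>r<d. fa0 h r * xs r))) * xt j)
      + (\<Sum>h<n. \<Sum>r<d. \<Sum>j<d. (fa1 h r * fb1 h i j - fa0 h r * fb0 h i j) * At r j)\<bar>
    \<le> M * \<rho> powr (1 + \<beta>)"
proof -
  let ?R = "\<rho> powr (1 + \<beta>)"
  have r2: "\<rho>\<^sup>2 = \<rho> powr 2" and r3: "\<rho>\<^sup>2 * \<rho> = \<rho> powr 3" and r1: "\<rho> = \<rho> powr 1"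
    using \<rho> by (simp_all add: powr_numeral) (simp add: power2_eq_square power3_eq_cube)
  have r3R: "\<rho>\<^sup>2 * \<rho> \<le> ?R" unfolding r3 using \<rho> \<beta> by (intro powr_le_powr_of_le_one) auto
  have Vb: "V powr \<beta> \<le> C powr \<beta> * \<rho> powr \<beta>"
    using powr_mono2[of \<beta> V "C * \<rho>"] V \<beta> nn \<rho> by (simp add: powr_mult)
  have Vb1: "V powr (\<beta> - 1) \<le> C powr (\<beta> - 1) * \<rho> powr (\<beta> - 1)"
    using powr_mono2[of "\<beta> - 1" V "C * \<rho>"] V \<beta> nn \<rho> by (simp add: powr_mult)
  have Rb: "\<rho> powr \<beta> * \<rho> = ?R" using \<rho> by (subst (2) r1) (simp add: powr_add)
  have Rb1: "\<rho> powr (\<beta> - 1) * \<rho>\<^sup>2 = ?R"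
    unfolding r2 by (simp add: add.commute flip: powr_add)
  have Rb2: "\<rho> powr \<beta> * \<rho>\<^sup>2 \<le> ?R"
    using powr_le_powr_of_le_one[OF \<rho>, of "1 + \<beta>" "\<beta> + 2"] unfolding r2 by (simp flip: powr_add)
  have 1: "\<bar>\<Sum>j<d. (fa1 i j - fa0 i j - (\<Sum>h<n. fb0 h i j * v h)) * xt j\<bar> \<le> real d * (C powr \<beta> * ?R)"
  proof (rule abs_sum_le)
    fix j assume j: "j < d"
    have "\<bar>(fa1 i j - fa0 i j - (\<Sum>h<n. fb0 h i j * v h)) * xt j\<bar> \<le> (C powr \<beta> * \<rho> powr \<beta>) * \<rho>"
      using Ta[OF i j] Vb xt[OF j] by (intro abs_mult_le) auto
    thus "\<bar>(fa1 i j - fa0 i j - (\<Sum>h<n. fb0 h i j * v h)) * xt j\<bar> \<le> C powr \<beta> * ?R"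
      by (simp only: mult.assoc Rb)
  qed
  have 2: "\<bar>\<Sum>j<d. (\<Sum>h<n. fb0 h i j * (v h - (\<Sum>r<d. fa0 h r * xs r))) * xt j\<bar>
      \<le> real d * (real n * (B * C2) * ?R)"
  proof (rule abs_sum_le)
    fix j assume j: "j < d"
    have "\<bar>\<Sum>h<n. fb0 h i j * (v h - (\<Sum>r<d. fa0 h r * xs r))\<bar> \<le> real n * (B * (C2 * \<rho>\<^sup>2))"
      using fb Z i j by (intro abs_sum_le abs_mult_le) auto
    hence "\<bar>(\<Sum>h<n. fb0 h i j * (v h - (\<Sum>r<d. fa0 h r * xs r))) * xt j\<bar>
        \<le> real n * (B * (C2 * \<rho>\<^sup>2)) * \<rho>"
      using xt[OF j] by (intro abs_mult_le) auto
    also have "\<dots> = real n * (B * C2) * (\<rho>\<^sup>2 * \<rho>)" by simp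
    also have "\<dots> \<le> real n * (B * C2) * ?R" using r3R nn by (intro mult_left_mono) auto
    finally show "\<bar>(\<Sum>h<n. fb0 h i j * (v h - (\<Sum>r<d. fa0 h r * xs r))) * xt j\<bar>
        \<le> real n * (B * C2) * ?R" .
  qed
  have 3: "\<bar>\<Sum>h<n. \<Sum>r<d. \<Sum>j<d. (fa1 h r * fb1 h i j - fa0 h r * fb0 h i j) * At r j\<bar>
      \<le> real n * (real d * (real d * ((C powr (\<beta> - 1) + B * (real n * (B * C) + C powr \<beta>)) * ?R)))"
  proof (intro abs_sum_le)
    fix h r j assume h: "h < n" "r < d" "j < d"
    have "\<bar>fa1 h r - fa0 h r\<bar> \<le> \<bar>\<Sum>k<n. fb0 k h r * v k\<bar> + V powr \<beta>"
      using Ta[OF h(1,2)] by linarith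
    also have "\<bar>\<Sum>k<n. fb0 k h r * v k\<bar> \<le> real n * (B * (C * \<rho>))"
      using fb h V by (intro abs_sum_le abs_mult_le) force+
    finally have d: "\<bar>fa1 h r - fa0 h r\<bar> \<le> real n * (B * (C * \<rho>)) + C powr \<beta> * \<rho> powr \<beta>"
      using Vb by linarith
    have "fa1 h r * fb1 h i j - fa0 h r * fb0 h i j
        = fa1 h r * (fb1 h i j - fb0 h i j) + fb0 h i j * (fa1 h r - fa0 h r)"
      by (simp add: algebra_simps)
    also have "\<bar>\<dots>\<bar> \<le> 1 * (C powr (\<beta> - 1) * \<rho> powr (\<beta> - 1))
        + B * (real n * (B * (C * \<rho>)) + C powr \<beta> * \<rho> powr \<beta>)"
      using fa[OF h(1,2)] Tb[OF h(1) i h(3)] Vb1 fb[OF h(1) i h(3)] d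
      by (intro order_trans[OF abs_triangle_ineq] add_mono abs_mult_le) auto
    finally have "\<bar>(fa1 h r * fb1 h i j - fa0 h r * fb0 h i j) * At r j\<bar>
        \<le> (1 * (C powr (\<beta> - 1) * \<rho> powr (\<beta> - 1))
        + B * (real n * (B * (C * \<rho>)) + C powr \<beta> * \<rho> powr \<beta>)) * \<rho>\<^sup>2"
      using At[OF h(2,3)] by (rule abs_mult_le)
    also have "\<dots> = C powr (\<beta> - 1) * (\<rho> powr (\<beta> - 1) * \<rho>\<^sup>2)
        + B * (real n * (B * C) * (\<rho>\<^sup>2 * \<rho>) + C powr \<beta> * (\<rho> powr \<beta> * \<rho>\<^sup>2))"
      by (simp add: algebra_simps)
    also have "\<dots> \<le> C powr (\<beta> - 1) * ?R + B * (real n * (B * C) * ?R + C powr \<beta> * ?R)"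
      unfolding Rb1 using r3R Rb2 nn by (intro add_left_mono mult_left_mono add_mono) auto
    also have "\<dots> = (C powr (\<beta> - 1) + B * (real n * (B * C) + C powr \<beta>)) * ?R"
      by (simp add: algebra_simps)
    finally show "\<bar>(fa1 h r * fb1 h i j - fa0 h r * fb0 h i j) * At r j\<bar>
      \<le> (C powr (\<beta> - 1) + B * (real n * (B * C) + C powr \<beta>)) * ?R" .
  qed
  have "\<bar>(\<Sum>j<d. (fa1 i j - fa0 i j - (\<Sum>h<n. fb0 h i j * v h)) * xt j)
      + (\<Sum>j<d. (\<Sum>h<n. fb0 h i j * (v h - (\<Sum>r<d. fa0 h r * xs r))) * xt j)
      + (\<Sum>h<n. \<Sum>r<d. \<Sum>j<d. (fa1 h r * fb1 h i j - fa0 h r * fb0 h i j) * At r j)\<bar>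
    \<le> real d * (C powr \<beta> * ?R) + real d * (real n * (B * C2) * ?R)
      + real n * (real d * (real d * ((C powr (\<beta> - 1) + B * (real n * (B * C) + C powr \<beta>)) * ?R)))"
    using 1 2 3 by linarith
  also have "\<dots> = M * ?R" unfolding M_def by (simp add: algebra_simps)
  finally show ?thesis .
qed

section \<open>Displacement over a short interval\<close>

text \<open>Half of the radius is kept free for a small multiple of the solution's own control. The
  second entry of the minimum turns \<open>Y \<le> C * \<rho>\<close> into
  \<open>Y \<le> 1 / 4\<close>.\<close>

definition local_radius :: "real \<Rightarrow> real \<Rightarrow> real \<Rightarrow> real \<Rightarrow> real \<Rightarrow> real"
  where "local_radius \<kappa> p \<gamma> M C = min (sewing_radius \<kappa> p \<gamma> M) ((1 / (4 * (C + 1))) powr p) / 2"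

lemma local_radius_pos:
  assumes "0 < p" "p < \<gamma>" "0 \<le> M" "0 \<le> C"
  shows "0 < local_radius \<kappa> p \<gamma> M C"
  using sewing_radius_pos[OF assms(1-3)] assms(4) by (simp add: local_radius_def)

text \<open>Sewing runs along \<open>\<omega> + \<epsilon> * \<omega>'\<close>, where
  \<open>\<epsilon>\<close> is fixed after \<open>\<omega>'\<close> and so small that
  \<open>\<epsilon> * \<omega>'\<close> fits into the free half of the radius. The smallness
  condition therefore involves \<open>\<omega>\<close> alone, although \<open>J\<close> is small
  only relative to \<open>\<omega>'\<close>. The exponent \<open>\<kappa>\<close> is 1 for
  first-order and 2 for second-order expansions.\<close>

lemma local_displacement:
  fixes p \<gamma> \<kappa> M C :: real and \<omega> \<omega>' :: "real \<Rightarrow> real" and J :: "nat \<Rightarrow> real \<Rightarrow> real \<Rightarrow> real"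
  assumes \<kappa>: "1 \<le> \<kappa>" "\<kappa> \<le> p" and \<gamma>: "p < \<gamma>" and nn: "0 \<le> M" "0 \<le> C"
    and ab: "a \<le> b" and cont: "continuous_on {a..b} \<omega>" "continuous_on {a..b} \<omega>'"
    and mono: "mono_on {a..b} \<omega>" "mono_on {a..b} \<omega>'"
    and J: "\<And>\<eta>. 0 < \<eta> \<Longrightarrow> \<exists>\<delta>>0. \<forall>s u i. a \<le> s \<and> s \<le> u \<and> u \<le> b \<and> i < n \<and> \<omega>' u - \<omega>' s \<le> \<delta> \<longrightarrow>
        \<bar>J i s u\<bar> \<le> \<eta> * (\<omega>' u - \<omega>' s)"
    and step: "\<And>s t u i \<rho>. \<lbrakk>a \<le> s; s \<le> t; t \<le> u; u \<le> b; 0 \<le> \<rho>; \<rho> \<le> 1; \<omega> t - \<omega> s \<le> \<rho> powr p;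
       \<omega> u - \<omega> t \<le> \<rho> powr p; i < n; \<And>k. k < n \<Longrightarrow> \<bar>J k s t\<bar> \<le> \<rho> powr \<kappa>\<rbrakk> \<Longrightarrow>
       \<bar>J i s u\<bar> \<le> \<bar>J i s t\<bar> + \<bar>J i t u\<bar> + M * \<rho> powr \<gamma>"
    and Y: "\<And>\<rho>. \<lbrakk>0 \<le> \<rho>; \<rho> \<le> 1; \<omega> b - \<omega> a \<le> \<rho> powr p; \<And>k. k < n \<Longrightarrow> \<bar>J k a b\<bar> \<le> \<rho> powr \<kappa>\<rbrakk> \<Longrightarrow> Y \<le> C * \<rho>"
    and le: "\<omega> b - \<omega> a \<le> local_radius \<kappa> p \<gamma> M C"
  shows "Y \<le> 1 / 4"
proof -
  have k0: "0 < \<kappa>" and p0: "0 < p" using \<kappa> by auto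
  define h where "h = sewing_radius \<kappa> p \<gamma> M"
  have h: "0 < h" "h \<le> 1" unfolding h_def
    using sewing_radius_pos[OF p0 \<gamma> nn(1)] by (auto simp: sewing_radius_def)
  define r where "r = 1 / (4 * (C + 1))"
  have r: "0 < r" "C * r \<le> 1 / 4" using nn by (auto simp: r_def field_simps)
  define h' where "h' = min h (r powr p)"
  have h': "0 < h'" "h' \<le> h" "h' \<le> r powr p" using h r by (auto simp: h'_def)
  have le: "\<omega> b - \<omega> a \<le> h' / 2"
    using le by (simp add: local_radius_def h'_def h_def r_def)
  have pos: "0 \<le> \<omega> u - \<omega> s" "0 \<le> \<omega>' u - \<omega>' s" if "a \<le> s" "s \<le> u" "u \<le> b" for s u
    using mono_onD[OF mono(1), of s u] mono_onD[OF mono(2), of s u] that by auto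
  define \<epsilon> where "\<epsilon> = h' / (2 * (\<omega>' b - \<omega>' a + 1))"
  have \<epsilon>: "0 < \<epsilon>" "\<epsilon> * (\<omega>' b - \<omega>' a) \<le> h' / 2"
    using pos[of a b] ab h' by (auto simp: \<epsilon>_def field_simps)
  define \<Omega> where "\<Omega> = (\<lambda>t. \<omega> t + \<epsilon> * \<omega>' t)"
  have \<Omega>: "\<Omega> u - \<Omega> s = (\<omega> u - \<omega> s) + \<epsilon> * (\<omega>' u - \<omega>' s)" for s u
    by (simp add: \<Omega>_def algebra_simps)
  have \<Omega>ge: "\<omega> u - \<omega> s \<le> \<Omega> u - \<Omega> s" "\<epsilon> * (\<omega>' u - \<omega>' s) \<le> \<Omega> u - \<Omega> s" "0 \<le> \<Omega> u - \<Omega> s"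
    if "a \<le> s" "s \<le> u" "u \<le> b" for s u
    using pos[OF that] \<epsilon> by (auto simp: \<Omega>)
  have \<Omega>m: "mono_on {a..b} \<Omega>"
    by (intro mono_onI) (use \<Omega>ge(3) in fastforce)
  have \<Omega>b: "\<Omega> b - \<Omega> a \<le> h'" using \<epsilon>(2) le by (simp add: \<Omega>)
  have rp: "((\<Omega> u - \<Omega> s) powr (1 / p)) powr p = \<Omega> u - \<Omega> s"
    "((\<Omega> u - \<Omega> s) powr (1 / p)) powr q = (\<Omega> u - \<Omega> s) powr (q / p)"
    if "a \<le> s" "s \<le> u" "u \<le> b" for s u q
    using \<Omega>ge(3)[OF that] p0 by (auto simp: powr_powr)
  \<comment> \<open>Choosing \<open>\<epsilon> / 2\<close> bounds \<open>J\<close> by half of the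
    increment of \<open>\<Omega>\<close>, the base case of sewing. It applies on the scale
    \<open>\<epsilon> * \<delta>\<close>, where the increment of \<open>\<omega>'\<close> is at most
    \<open>\<delta>\<close>.\<close>
  obtain \<delta> where \<delta>: "0 < \<delta>" "\<And>s u i. \<lbrakk>a \<le> s; s \<le> u; u \<le> b; i < n; \<omega>' u - \<omega>' s \<le> \<delta>\<rbrakk> \<Longrightarrow>
        \<bar>J i s u\<bar> \<le> \<epsilon> / 2 * (\<omega>' u - \<omega>' s)"
    using J[of "\<epsilon> / 2"] \<epsilon>(1) by auto
  have "\<bar>J i a b\<bar> \<le> (\<Omega> b - \<Omega> a) powr (\<kappa> / p)" if "i < n" for i
  proof (rule sewing[OF k0 \<kappa>(2) \<gamma> nn(1) ab, of \<Omega> "\<epsilon> * \<delta>"])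
    show "continuous_on {a..b} \<Omega>" unfolding \<Omega>_def by (intro continuous_intros cont)
    fix s u i assume *: "a \<le> s" "s \<le> u" "u \<le> b" "\<Omega> u - \<Omega> s \<le> \<epsilon> * \<delta>" "i < n"
    have "\<epsilon> * (\<omega>' u - \<omega>' s) \<le> \<epsilon> * \<delta>" using \<Omega>ge(2)[OF *(1-3)] * by linarith
    hence "\<omega>' u - \<omega>' s \<le> \<delta>" using \<epsilon> by simp
    from \<delta>(2)[OF *(1-3,5) this] show "\<bar>J i s u\<bar> \<le> (\<Omega> u - \<Omega> s) / 2"
      using \<Omega>ge(2)[OF *(1-3)] by simp
  next
    fix s t u i assume *: "a \<le> s" "s \<le> t" "t \<le> u" "u \<le> b" "\<Omega> u - \<Omega> s \<le> 1" "i < n"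
      and IH: "\<And>k. k < n \<Longrightarrow> \<bar>J k s t\<bar> \<le> (\<Omega> t - \<Omega> s) powr (\<kappa> / p)"
    let ?\<rho> = "(\<Omega> u - \<Omega> s) powr (1 / p)"
    have su: "s \<le> u" "t \<le> b" "a \<le> t" using * by auto
    have mon: "\<Omega> t - \<Omega> s \<le> \<Omega> u - \<Omega> s" "\<Omega> u - \<Omega> t \<le> \<Omega> u - \<Omega> s"
      using \<Omega>ge(3)[of s t] \<Omega>ge(3)[of t u] * by auto
    have "\<bar>J i s u\<bar> \<le> \<bar>J i s t\<bar> + \<bar>J i t u\<bar> + M * ?\<rho> powr \<gamma>"
    proof (rule step[OF *(1-4) _ _ _ _ *(6)])
      show "?\<rho> \<le> 1" using powr_le1[of "1/p" "\<Omega> u - \<Omega> s"] \<Omega>ge(3)[of s u] * su p0 by simp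
      show "\<omega> t - \<omega> s \<le> ?\<rho> powr p" "\<omega> u - \<omega> t \<le> ?\<rho> powr p"
        using rp(1)[of s u] * su mon \<Omega>ge(1)[of s t] \<Omega>ge(1)[of t u] by auto
      fix k assume "k < n"
      have "(\<Omega> t - \<Omega> s) powr (\<kappa> / p) \<le> (\<Omega> u - \<Omega> s) powr (\<kappa> / p)"
        using mon \<Omega>ge(3)[of s t] * su k0 p0 by (intro powr_mono2) auto
      thus "\<bar>J k s t\<bar> \<le> ?\<rho> powr \<kappa>" using IH[OF \<open>k < n\<close>] rp(2)[of s u] * su by simp
    qed simp
    thus "\<bar>J i s u\<bar> \<le> \<bar>J i s t\<bar> + \<bar>J i t u\<bar> + M * (\<Omega> u - \<Omega> s) powr (\<gamma> / p)"
      using rp(2)[of s u] * su by simp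
  qed (use \<Omega>m \<epsilon> \<delta> \<Omega>b h' that in \<open>auto simp: h_def\<close>)
  hence fin: "\<bar>J k a b\<bar> \<le> ((\<Omega> b - \<Omega> a) powr (1 / p)) powr \<kappa>" if "k < n" for k
    using that rp(2)[of a b] ab by simp
  let ?\<rho> = "(\<Omega> b - \<Omega> a) powr (1 / p)"
  have "Y \<le> C * ?\<rho>"
  proof (rule Y[OF _ _ _ fin])
    show "?\<rho> \<le> 1" using powr_le1[of "1/p" "\<Omega> b - \<Omega> a"] \<Omega>ge(3)[of a b] \<Omega>b h h' p0 ab by simp
    show "\<omega> b - \<omega> a \<le> ?\<rho> powr p" using rp(1)[of a b] \<Omega>ge(1)[of a b] ab by simp
  qed auto
  also have "?\<rho> \<le> (r powr p) powr (1 / p)"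
    using \<Omega>b h' \<Omega>ge(3)[of a b] ab p0 by (intro powr_mono2) auto
  also have "(r powr p) powr (1 / p) = r" using p0 r by (simp add: powr_powr)
  finally show "Y \<le> 1 / 4" using r nn by (smt (verit) mult_left_mono)
qed

text \<open>In the next two lemmas the coefficients, the signal and the solution have been rescaled, so
  that the constants in (G) become absolute.\<close>

definition young_bound :: "nat \<Rightarrow> nat \<Rightarrow> real" where
  "young_bound n d = real n * (real d + 1)"

definition young_radius :: "real \<Rightarrow> real \<Rightarrow> nat \<Rightarrow> nat \<Rightarrow> real" where
  "young_radius p \<gamma> n d =
    local_radius 1 p \<gamma> (real d * young_bound n d powr (\<gamma> - 1)) (young_bound n d)"

lemma local_displacement_young:
  fixes p \<gamma> :: real and n d :: nat and y x :: "real \<Rightarrow> nat \<Rightarrow> real" and fa :: "real \<Rightarrow> nat \<Rightarrow> nat \<Rightarrow> real"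
  assumes p: "1 < p" "p < \<gamma>" "\<gamma> < 2"
    and ab: "a \<le> b" and reg: "continuous_on {a..b} \<omega>" "continuous_on {a..b} \<omega>'" "mono_on {a..b} \<omega>" "mono_on {a..b} \<omega>'"
    and J: "\<And>\<eta>. 0 < \<eta> \<Longrightarrow> \<exists>\<delta>>0. \<forall>s u i. a \<le> s \<and> s \<le> u \<and> u \<le> b \<and> i < n \<and> \<omega>' u - \<omega>' s \<le> \<delta> \<longrightarrow>
        \<bar>y u i - y s i - (\<Sum>j<d. fa s i j * (x u j - x s j))\<bar> \<le> \<eta> * (\<omega>' u - \<omega>' s)"
    and x: "\<And>s t j. a \<le> s \<Longrightarrow> s \<le> t \<Longrightarrow> t \<le> b \<Longrightarrow> j < d \<Longrightarrow> \<bar>x t j - x s j\<bar> powr p \<le> \<omega> t - \<omega> s"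
    and f1: "\<And>s i j. a \<le> s \<Longrightarrow> s \<le> b \<Longrightarrow> i < n \<Longrightarrow> j < d \<Longrightarrow> \<bar>fa s i j\<bar> \<le> 1"
    and f2: "\<And>s t i j. a \<le> s \<Longrightarrow> s \<le> t \<Longrightarrow> t \<le> b \<Longrightarrow> i < n \<Longrightarrow> j < d \<Longrightarrow>
       \<bar>fa t i j - fa s i j\<bar> \<le> (\<Sum>k<n. \<bar>y t k - y s k\<bar>) powr (\<gamma> - 1)"
    and le: "\<omega> b - \<omega> a \<le> young_radius p \<gamma> n d"
  shows "(\<Sum>k<n. \<bar>y b k - y a k\<bar>) \<le> 1 / 4"
proof -
  let ?J = "\<lambda>i s u. y u i - y s i - (\<Sum>j<d. fa s i j * (x u j - x s j))"
  \<comment> \<open>Each of the \<open>n\<close> components moves by at most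
    \<open>d * \<rho>\<close> through the linear term and by \<open>\<rho>\<close> through the
    error.\<close>
  define C where "C = young_bound n d"
  define M where "M = real d * C powr (\<gamma> - 1)"
  have C: "0 \<le> C" by (simp add: C_def young_bound_def)
  have M: "0 \<le> M" by (simp add: M_def)
  have le: "\<omega> b - \<omega> a \<le> local_radius 1 p \<gamma> M C"
    using le by (simp add: young_radius_def M_def C_def)
  have x': "\<bar>x t j - x s j\<bar> \<le> \<rho>" if "a \<le> s" "s \<le> t" "t \<le> b" "j < d" "\<omega> t - \<omega> s \<le> \<rho> powr p" "0 \<le> \<rho>" for s t j \<rho>
    using x[of s t j] that powr_less_mono2[of p \<rho> "\<bar>x t j - x s j\<bar>"] p by fastforce
  have dy: "(\<Sum>k<n. \<bar>y t k - y s k\<bar>) \<le> C * \<rho>"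
    if "a \<le> s" "s \<le> t" "t \<le> b" "\<omega> t - \<omega> s \<le> \<rho> powr p" "0 \<le> \<rho>" "\<And>k. k < n \<Longrightarrow> \<bar>?J k s t\<bar> \<le> \<rho> powr 1" for s t \<rho>
  proof -
    have "\<bar>y t k - y s k\<bar> \<le> (real d + 1) * \<rho>" if k: "k < n" for k
    proof -
      have "\<bar>\<Sum>j<d. fa s k j * (x t j - x s j)\<bar> \<le> real d * (1 * \<rho>)"
        using that f1 x' \<open>a \<le> s\<close> \<open>s \<le> t\<close> \<open>t \<le> b\<close> \<open>0 \<le> \<rho>\<close> \<open>\<omega> t - \<omega> s \<le> \<rho> powr p\<close>
        by (intro abs_sum_le abs_mult_le) auto
      moreover have "\<bar>?J k s t\<bar> \<le> \<rho>"
        using \<open>k < n \<Longrightarrow> \<bar>?J k s t\<bar> \<le> \<rho> powr 1\<close> k \<open>0 \<le> \<rho>\<close> by simp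
      ultimately show ?thesis by (simp add: algebra_simps)
    qed
    hence "\<bar>\<Sum>k<n. \<bar>y t k - y s k\<bar>\<bar> \<le> real n * ((real d + 1) * \<rho>)" by (intro abs_sum_le) auto
    thus ?thesis by (simp add: C_def young_bound_def)
  qed
  show "(\<Sum>k<n. \<bar>y b k - y a k\<bar>) \<le> 1 / 4"
  proof (rule local_displacement[OF order.refl less_imp_le[OF p(1)] p(2) M C ab reg J _ _ le])
    fix s t u i \<rho> assume *: "a \<le> s" "s \<le> t" "t \<le> u" "u \<le> b" "0 \<le> \<rho>" "\<rho> \<le> 1" "\<omega> t - \<omega> s \<le> \<rho> powr p"
      "\<omega> u - \<omega> t \<le> \<rho> powr p" "i < n" and IH: "\<And>k. k < n \<Longrightarrow> \<bar>?J k s t\<bar> \<le> \<rho> powr 1"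
    \<comment> \<open>The defect pairs the change of the coefficient before \<open>t\<close> with
      the signal after \<open>t\<close>, which gives the order
      \<open>\<rho> powr (\<gamma> - 1) * \<rho>\<close>.\<close>
    have "?J i s u = ?J i s t + ?J i t u + (\<Sum>j<d. (fa t i j - fa s i j) * (x u j - x t j))"
      by (simp add: algebra_simps sum.distrib sum_subtractf)
    moreover have "\<bar>\<Sum>j<d. (fa t i j - fa s i j) * (x u j - x t j)\<bar> \<le> real d * ((C * \<rho>) powr (\<gamma> - 1) * \<rho>)"
    proof (intro abs_sum_le abs_mult_le)
      fix j assume j: "j < d"
      have "\<bar>fa t i j - fa s i j\<bar> \<le> (\<Sum>k<n. \<bar>y t k - y s k\<bar>) powr (\<gamma> - 1)"
        using f2 * j by auto
      also have "\<dots> \<le> (C * \<rho>) powr (\<gamma> - 1)"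
        using dy[of s t \<rho>, OF _ _ _ _ _ IH] * p by (intro powr_mono2 sum_nonneg) auto
      finally show "\<bar>fa t i j - fa s i j\<bar> \<le> (C * \<rho>) powr (\<gamma> - 1)" .
      show "\<bar>x u j - x t j\<bar> \<le> \<rho>" using x' * j by auto
    qed
    moreover have "(C * \<rho>) powr (\<gamma> - 1) * \<rho> = C powr (\<gamma> - 1) * \<rho> powr \<gamma>"
      using C *(5) by (cases "\<rho> = 0") (auto simp: powr_mult powr_diff)
    ultimately show "\<bar>?J i s u\<bar> \<le> \<bar>?J i s t\<bar> + \<bar>?J i t u\<bar> + M * \<rho> powr \<gamma>"
      unfolding M_def by (simp add: mult.assoc)
  next
    fix \<rho> assume "0 \<le> \<rho>" "\<rho> \<le> 1" "\<omega> b - \<omega> a \<le> \<rho> powr p" "\<And>k. k < n \<Longrightarrow> \<bar>?J k a b\<bar> \<le> \<rho> powr 1"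
    thus "(\<Sum>k<n. \<bar>y b k - y a k\<bar>) \<le> C * \<rho>" using dy[of a b \<rho>] ab by auto
  qed
qed

definition second_order_term ::
  "nat \<Rightarrow> nat \<Rightarrow> (nat \<Rightarrow> nat \<Rightarrow> real) \<Rightarrow> (nat \<Rightarrow> nat \<Rightarrow> nat \<Rightarrow> real) \<Rightarrow> (nat \<Rightarrow> nat \<Rightarrow> real) \<Rightarrow> nat \<Rightarrow> real"
  where "second_order_term n d a b A i = (\<Sum>h<n. \<Sum>r<d. \<Sum>j<d. a h r * b h i j * A r j)"

text \<open>Per component: \<open>d\<close> from the linear term, \<open>1\<close> from the error
  and \<open>n * d * d * 3\<close> from the second-order term, where \<open>3\<close> bounds the
  rescaled derivatives.\<close>

definition rough_bound :: "nat \<Rightarrow> nat \<Rightarrow> real" where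
  "rough_bound n d = real n * (real d + (1 + real n * (real d * (real d * 3))))"

text \<open>This is the constant of \<open>second_order_defect_le\<close> for
  \<open>B = 3\<close>.\<close>

definition rough_defect :: "real \<Rightarrow> nat \<Rightarrow> nat \<Rightarrow> real" where
  "rough_defect \<beta> n d = (let C = rough_bound n d; C2 = 1 + real n * (real d * (real d * 3)) in
     real d * C powr \<beta> + real d * (real n * (3 * C2))
      + real n * (real d * (real d * (C powr (\<beta> - 1) + 3 * (real n * (3 * C) + C powr \<beta>)))))"

definition rough_radius :: "real \<Rightarrow> real \<Rightarrow> nat \<Rightarrow> nat \<Rightarrow> real" where
  "rough_radius p \<gamma> n d = local_radius 2 p \<gamma> (rough_defect (\<gamma> - 1) n d) (rough_bound n d)"

lemma rough_bound_nonneg: "0 \<le> rough_bound n d"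
  by (simp add: rough_bound_def)

lemma rough_defect_nonneg: "0 \<le> rough_defect \<beta> n d"
  using rough_bound_nonneg[of n d] unfolding rough_defect_def Let_def
  by (intro add_nonneg_nonneg mult_nonneg_nonneg) auto

lemma abs_le_add3:
  fixes a b c e m :: real
  shows "a - b - c = e \<Longrightarrow> \<bar>e\<bar> \<le> m \<Longrightarrow> \<bar>a\<bar> \<le> \<bar>b\<bar> + \<bar>c\<bar> + m"
  by linarith

lemma local_displacement_rough:
  fixes p \<gamma> :: real and n d :: nat and y x :: "real \<Rightarrow> nat \<Rightarrow> real"
    and fa :: "real \<Rightarrow> nat \<Rightarrow> nat \<Rightarrow> real" and fb :: "real \<Rightarrow> nat \<Rightarrow> nat \<Rightarrow> nat \<Rightarrow> real"
    and area :: "nat \<Rightarrow> nat \<Rightarrow> real \<Rightarrow> real \<Rightarrow> real"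
  assumes p: "2 \<le> p" "p < \<gamma>" "\<gamma> < 3"
    and ab: "a \<le> b" and reg: "continuous_on {a..b} \<omega>" "continuous_on {a..b} \<omega>'" "mono_on {a..b} \<omega>" "mono_on {a..b} \<omega>'"
    and J: "\<And>\<eta>. 0 < \<eta> \<Longrightarrow> \<exists>\<delta>>0. \<forall>s u i. a \<le> s \<and> s \<le> u \<and> u \<le> b \<and> i < n \<and> \<omega>' u - \<omega>' s \<le> \<delta> \<longrightarrow>
        \<bar>y u i - y s i - (\<Sum>j<d. fa s i j * (x u j - x s j))
          - second_order_term n d (fa s) (fb s) (\<lambda>r j. area r j s u) i\<bar> \<le> \<eta> * (\<omega>' u - \<omega>' s)"
    and x: "\<And>s t j. a \<le> s \<Longrightarrow> s \<le> t \<Longrightarrow> t \<le> b \<Longrightarrow> j < d \<Longrightarrow> \<bar>x t j - x s j\<bar> powr p \<le> \<omega> t - \<omega> s"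
    and A: "\<And>s t r j. a \<le> s \<Longrightarrow> s \<le> t \<Longrightarrow> t \<le> b \<Longrightarrow> r < d \<Longrightarrow> j < d \<Longrightarrow> \<bar>area r j s t\<bar> powr (p / 2) \<le> \<omega> t - \<omega> s"
    and chen: "\<And>s t u r j. a \<le> s \<Longrightarrow> s \<le> t \<Longrightarrow> t \<le> u \<Longrightarrow> u \<le> b \<Longrightarrow> r < d \<Longrightarrow> j < d \<Longrightarrow>
      area r j s u = area r j s t + area r j t u + (x t r - x s r) * (x u j - x t j)"
    and f1: "\<And>s i j. a \<le> s \<Longrightarrow> s \<le> b \<Longrightarrow> i < n \<Longrightarrow> j < d \<Longrightarrow> \<bar>fa s i j\<bar> \<le> 1"
    and f2: "\<And>s h i j. a \<le> s \<Longrightarrow> s \<le> b \<Longrightarrow> h < n \<Longrightarrow> i < n \<Longrightarrow> j < d \<Longrightarrow> \<bar>fb s h i j\<bar> \<le> 3"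
    and f3: "\<And>s t i j. a \<le> s \<Longrightarrow> s \<le> t \<Longrightarrow> t \<le> b \<Longrightarrow> i < n \<Longrightarrow> j < d \<Longrightarrow>
       \<bar>fa t i j - fa s i j - (\<Sum>h<n. fb s h i j * (y t h - y s h))\<bar> \<le> (\<Sum>k<n. \<bar>y t k - y s k\<bar>) powr (\<gamma> - 1)"
    and f4: "\<And>s t h i j. a \<le> s \<Longrightarrow> s \<le> t \<Longrightarrow> t \<le> b \<Longrightarrow> h < n \<Longrightarrow> i < n \<Longrightarrow> j < d \<Longrightarrow>
       \<bar>fb t h i j - fb s h i j\<bar> \<le> (\<Sum>k<n. \<bar>y t k - y s k\<bar>) powr (\<gamma> - 2)"
    and le: "\<omega> b - \<omega> a \<le> rough_radius p \<gamma> n d"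
  shows "(\<Sum>k<n. \<bar>y b k - y a k\<bar>) \<le> 1 / 4"
proof -
  let ?F = "\<lambda>i s u. second_order_term n d (fa s) (fb s) (\<lambda>r j. area r j s u) i"
  let ?J = "\<lambda>i s u. y u i - y s i - (\<Sum>j<d. fa s i j * (x u j - x s j)) - ?F i s u"
  define C2 where "C2 = 1 + real n * (real d * (real d * 3))"
  define C where "C = rough_bound n d"
  define M where "M = rough_defect (\<gamma> - 1) n d"
  have C: "0 \<le> C" "C = real n * (real d + C2)" by (simp_all add: C_def C2_def rough_bound_def)
  have C2: "0 \<le> C2" by (simp add: C2_def)
  have M: "0 \<le> M" by (simp add: M_def rough_defect_nonneg)
  have le: "\<omega> b - \<omega> a \<le> local_radius 2 p \<gamma> M C"
    using le by (simp add: rough_radius_def M_def C_def)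
  have x': "\<bar>x t j - x s j\<bar> \<le> \<rho>" if "a \<le> s" "s \<le> t" "t \<le> b" "j < d" "\<omega> t - \<omega> s \<le> \<rho> powr p" "0 \<le> \<rho>" for s t j \<rho>
    using x[of s t j] that powr_less_mono2[of p \<rho> "\<bar>x t j - x s j\<bar>"] p by fastforce
  have A': "\<bar>area r j s t\<bar> \<le> \<rho>\<^sup>2" if "a \<le> s" "s \<le> t" "t \<le> b" "r < d" "j < d" "\<omega> t - \<omega> s \<le> \<rho> powr p" "0 \<le> \<rho>" for s t r j \<rho>
  proof (rule ccontr)
    assume n: "\<not> \<bar>area r j s t\<bar> \<le> \<rho>\<^sup>2"
    have "\<rho>\<^sup>2 = \<rho> powr 2" using that by simp
    hence "(\<rho>\<^sup>2) powr (p / 2) = \<rho> powr p" by (simp add: powr_powr)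
    moreover have "(\<rho>\<^sup>2) powr (p / 2) < \<bar>area r j s t\<bar> powr (p / 2)"
      using n p by (intro powr_less_mono2) auto
    ultimately show False using A[of s t r j] that by simp
  qed
  have dF: "\<bar>?F k s t\<bar> \<le> real n * (real d * (real d * 3)) * \<rho>\<^sup>2"
    if "a \<le> s" "s \<le> t" "t \<le> b" "\<omega> t - \<omega> s \<le> \<rho> powr p" "0 \<le> \<rho>" "k < n" for s t \<rho> k
  proof -
    have "\<bar>?F k s t\<bar> \<le> real n * (real d * (real d * ((1 * 3) * \<rho>\<^sup>2)))"
      unfolding second_order_term_def
      using that f1 f2 A' by (intro abs_sum_le abs_mult_le) auto
    thus ?thesis by (simp add: mult.assoc)
  qed
  \<comment> \<open>Beyond its linear term the solution moves only by the order
    \<open>\<rho>^2\<close>. This is the factor that makes the middle sum of the defect of third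
    order.\<close>
  have dZ: "\<bar>(y t k - y s k) - (\<Sum>j<d. fa s k j * (x t j - x s j))\<bar> \<le> C2 * \<rho>\<^sup>2"
    if "a \<le> s" "s \<le> t" "t \<le> b" "\<omega> t - \<omega> s \<le> \<rho> powr p" "0 \<le> \<rho>" "\<bar>?J k s t\<bar> \<le> \<rho> powr 2" "k < n" for s t \<rho> k
  proof -
    have r: "\<rho> powr 2 = \<rho>\<^sup>2" using that(5) by simp
    have "\<bar>(y t k - y s k) - (\<Sum>j<d. fa s k j * (x t j - x s j))\<bar>
        \<le> \<rho>\<^sup>2 + real n * (real d * (real d * 3)) * \<rho>\<^sup>2"
      using dF[OF that(1-5,7)] that(6) unfolding r by linarith
    thus ?thesis unfolding C2_def distrib_right by simp
  qed
  have dy: "(\<Sum>k<n. \<bar>y t k - y s k\<bar>) \<le> C * \<rho>"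
    if "a \<le> s" "s \<le> t" "t \<le> b" "\<omega> t - \<omega> s \<le> \<rho> powr p" "0 \<le> \<rho>" "\<rho> \<le> 1" "\<And>k. k < n \<Longrightarrow> \<bar>?J k s t\<bar> \<le> \<rho> powr 2" for s t \<rho>
  proof -
    have "\<bar>y t k - y s k\<bar> \<le> (real d + C2) * \<rho>" if k: "k < n" for k
    proof -
      have "\<bar>\<Sum>j<d. fa s k j * (x t j - x s j)\<bar> \<le> real d * (1 * \<rho>)"
        using k f1 x' \<open>a \<le> s\<close> \<open>s \<le> t\<close> \<open>t \<le> b\<close> \<open>0 \<le> \<rho>\<close> \<open>\<omega> t - \<omega> s \<le> \<rho> powr p\<close>
        by (intro abs_sum_le abs_mult_le) auto
      moreover have "C2 * \<rho>\<^sup>2 \<le> C2 * \<rho>"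
        using C2 \<open>0 \<le> \<rho>\<close> \<open>\<rho> \<le> 1\<close> by (intro mult_left_mono) (auto simp: power2_eq_square mult_left_le)
      moreover note dZ[OF \<open>a \<le> s\<close> \<open>s \<le> t\<close> \<open>t \<le> b\<close> \<open>\<omega> t - \<omega> s \<le> \<rho> powr p\<close> \<open>0 \<le> \<rho>\<close>
        \<open>k < n \<Longrightarrow> \<bar>?J k s t\<bar> \<le> \<rho> powr 2\<close>[OF k] k]
      ultimately show ?thesis unfolding distrib_right by linarith
    qed
    hence "\<bar>\<Sum>k<n. \<bar>y t k - y s k\<bar>\<bar> \<le> real n * ((real d + C2) * \<rho>)" by (intro abs_sum_le) auto
    thus ?thesis by (simp add: C(2))
  qed
  show "(\<Sum>k<n. \<bar>y b k - y a k\<bar>) \<le> 1 / 4"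
  proof (rule local_displacement[OF _ p(1,2) M C(1) ab reg J _ _ le])
    fix s t u i \<rho> assume *: "a \<le> s" "s \<le> t" "t \<le> u" "u \<le> b" "0 \<le> \<rho>" "\<rho> \<le> 1" "\<omega> t - \<omega> s \<le> \<rho> powr p"
      "\<omega> u - \<omega> t \<le> \<rho> powr p" "i < n" and IH: "\<And>k. k < n \<Longrightarrow> \<bar>?J k s t\<bar> \<le> \<rho> powr 2"
    let ?E = "(\<Sum>j<d. (fa t i j - fa s i j - (\<Sum>h<n. fb s h i j * (y t h - y s h))) * (x u j - x t j))
      + (\<Sum>j<d. (\<Sum>h<n. fb s h i j * ((y t h - y s h) - (\<Sum>r<d. fa s h r * (x t r - x s r)))) * (x u j - x t j))
      + (\<Sum>h<n. \<Sum>r<d. \<Sum>j<d. (fa t h r * fb t h i j - fa s h r * fb s h i j) * area r j t u)"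
    have tb: "t \<le> b" "a \<le> t" "s \<le> u" "s \<le> b" using * by auto
    have xx: "(x t j - x s j) + (x u j - x t j) = x u j - x s j" for j by simp
    have "?J i s u - ?J i s t - ?J i t u = ?E"
      unfolding second_order_term_def
      using second_order_defect_eq[where Au = "\<lambda>r j. area r j s u" and As = "\<lambda>r j. area r j s t"
          and At = "\<lambda>r j. area r j t u" and xs = "\<lambda>j. x t j - x s j" and xt = "\<lambda>j. x u j - x t j" and n = n and d = d
          and ?y0.0 = "y s i" and ?y1.0 = "y t i" and ?y2.0 = "y u i" and ?fa0.0 = "fa s" and ?fa1.0 = "fa t"
          and ?fb0.0 = "fb s" and ?fb1.0 = "fb t" and v = "\<lambda>h. y t h - y s h" and i = i, OF chen[OF *(1-4)]]
      unfolding xx .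
    moreover have "\<bar>?E\<bar> \<le> M * \<rho> powr (1 + (\<gamma> - 1))"
      unfolding M_def rough_defect_def Let_def C_def[symmetric] C2_def[symmetric]
    proof (rule second_order_defect_le)
      show "1 < \<gamma> - 1" "\<gamma> - 1 < 2" using p by auto
      show "(\<Sum>k<n. \<bar>y t k - y s k\<bar>) \<le> C * \<rho>"
        by (rule dy[OF *(1,2) tb(1) *(7,5,6) IH])
      show "\<And>h. h < n \<Longrightarrow> \<bar>y t h - y s h\<bar> \<le> (\<Sum>k<n. \<bar>y t k - y s k\<bar>)"
        by (rule member_le_sum) auto
      show "\<And>h i j. \<lbrakk>h < n; i < n; j < d\<rbrakk> \<Longrightarrow> \<bar>fb t h i j - fb s h i j\<bar> \<le> (\<Sum>k<n. \<bar>y t k - y s k\<bar>) powr (\<gamma> - 1 - 1)"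
        using f4[OF *(1,2) tb(1)] by simp
      show "\<And>r j. r < d \<Longrightarrow> j < d \<Longrightarrow> \<bar>area r j t u\<bar> \<le> \<rho>\<^sup>2" using A'[OF tb(2) *(3,4) _ _ *(8,5)] .
      show "\<And>h. h < n \<Longrightarrow> \<bar>y t h - y s h - (\<Sum>r<d. fa s h r * (x t r - x s r))\<bar> \<le> C2 * \<rho>\<^sup>2"
        using dZ[OF *(1,2) tb(1) *(7,5) IH] .
      show "\<And>j. j < d \<Longrightarrow> \<bar>x u j - x t j\<bar> \<le> \<rho>" using x'[OF tb(2) *(3,4) _ *(8,5)] .
      show "\<And>h r. h < n \<Longrightarrow> r < d \<Longrightarrow> \<bar>fa t h r\<bar> \<le> 1" using f1[OF tb(2,1)] .
      show "\<And>h i j. h < n \<Longrightarrow> i < n \<Longrightarrow> j < d \<Longrightarrow> \<bar>fb s h i j\<bar> \<le> 3" using f2[OF *(1) tb(4)] .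
      show "\<And>i j. i < n \<Longrightarrow> j < d \<Longrightarrow> \<bar>fa t i j - fa s i j - (\<Sum>h<n. fb s h i j * (y t h - y s h))\<bar>
          \<le> (\<Sum>k<n. \<bar>y t k - y s k\<bar>) powr (\<gamma> - 1)" using f3[OF *(1,2) tb(1)] .
      show "0 \<le> (\<Sum>k<n. \<bar>y t k - y s k\<bar>)" by (intro sum_nonneg) simp
    qed (use * C C2 in simp_all)
    ultimately show "\<bar>?J i s u\<bar> \<le> \<bar>?J i s t\<bar> + \<bar>?J i t u\<bar> + M * \<rho> powr \<gamma>"
      by (intro abs_le_add3) simp_all
  next
    fix \<rho> assume "0 \<le> \<rho>" "\<rho> \<le> 1" "\<omega> b - \<omega> a \<le> \<rho> powr p" "\<And>k. k < n \<Longrightarrow> \<bar>?J k a b\<bar> \<le> \<rho> powr 2"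
    thus "(\<Sum>k<n. \<bar>y b k - y a k\<bar>) \<le> C * \<rho>" using dy[of a b \<rho>] ab by auto
  qed simp
qed

section \<open>Calculus on finite-dimensional space\<close>

lemma Rn_iff: "v \<in> Rn n \<longleftrightarrow> (\<forall>i\<ge>n. v i = 0)"
  by (auto simp: topspace_Euclidean_space)

lemma enorm_nonneg: "0 \<le> enorm n v"
  by (simp add: enorm_def)

lemma enorm_le_sum: "enorm n v \<le> (\<Sum>i<n. \<bar>v i\<bar>)"
  unfolding enorm_def by (rule L2_set_le_sum_abs)

lemma edist_le_sum: "edist n v w \<le> (\<Sum>i<n. \<bar>v i - w i\<bar>)"
  unfolding edist_def by (rule enorm_le_sum)

lemma abs_le_L2_set:
  assumes "finite I" "i \<in> I"
  shows "\<bar>v i\<bar> \<le> L2_set v I"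
proof -
  have "\<bar>v i\<bar> \<le> L2_set (\<lambda>i. \<bar>v i\<bar>) I" using assms by (intro member_le_L2_set) auto
  thus ?thesis by (simp add: L2_set_def)
qed

lemma abs_le_enorm: "i < n \<Longrightarrow> \<bar>v i\<bar> \<le> enorm n v"
  unfolding enorm_def by (rule abs_le_L2_set) auto

lemma enorm_add: "enorm n (\<lambda>i. v i + w i) \<le> enorm n v + enorm n w"
  unfolding enorm_def by (rule L2_set_triangle_ineq)

lemma enorm_mult: "enorm n (\<lambda>i. c * v i) = \<bar>c\<bar> * enorm n v"
  by (simp add: enorm_def L2_set_def power_mult_distrib real_sqrt_mult flip: sum_distrib_left)

lemma enorm_diff_le: "enorm n v - enorm n w \<le> edist n v w"
  using enorm_add[of n w "\<lambda>i. v i - w i"] by (simp add: edist_def)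

lemma enorm_axis:
  assumes "h < n"
  shows "enorm n (\<lambda>i. if i = h then c else 0) = \<bar>c\<bar>"
proof -
  have "(\<Sum>i<n. (if i = h then c else 0)\<^sup>2) = (\<Sum>i<n. if i = h then c\<^sup>2 else 0)"
    by (intro sum.cong) auto
  thus ?thesis using assms by (simp add: enorm_def L2_set_def)
qed

text \<open>The witness in \<open>differentiable_Rn\<close> becomes a parameter, so that it can be
  identified with the partial derivatives.\<close>

definition gradient_at :: "nat \<Rightarrow> ((nat \<Rightarrow> real) \<Rightarrow> real) \<Rightarrow> (nat \<Rightarrow> real) \<Rightarrow> (nat \<Rightarrow> real) \<Rightarrow> bool"
  where "gradient_at n \<phi> y g \<longleftrightarrow> (\<forall>\<epsilon>>0. \<exists>\<delta>>0. \<forall>z\<in>Rn n. edist n z y < \<delta> \<longrightarrow>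
       \<bar>\<phi> z - \<phi> y - (\<Sum>h<n. g h * (z h - y h))\<bar> \<le> \<epsilon> * edist n z y)"

lemma gradient_at_line:
  assumes g: "gradient_at n \<phi> (\<lambda>i. y i + t * v i) g" and y: "y \<in> Rn n" "v \<in> Rn n"
  shows "((\<lambda>s. \<phi> (\<lambda>i. y i + s * v i)) has_real_derivative (\<Sum>h<n. g h * v h)) (at t)"
  unfolding has_field_derivative_def has_derivative_at_alt
proof (intro conjI allI impI)
  show "bounded_linear ((*) (\<Sum>h<n. g h * v h))" by (rule bounded_linear_mult_right)
  fix e :: real assume e: "0 < e"
  define N where "N = enorm n v + 1"
  have N: "0 < N" "enorm n v \<le> N" using enorm_nonneg[of n v] by (auto simp: N_def)
  have ed: "edist n (\<lambda>i. y i + s * v i) (\<lambda>i. y i + t * v i) = \<bar>s - t\<bar> * enorm n v" for s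
  proof -
    have "(\<lambda>i. y i + s * v i - (y i + t * v i)) = (\<lambda>i. (s - t) * v i)" by (auto simp: algebra_simps)
    thus ?thesis unfolding edist_def enorm_mult[symmetric] by simp
  qed
  obtain \<delta> where \<delta>: "0 < \<delta>" "\<And>z. z \<in> Rn n \<Longrightarrow> edist n z (\<lambda>i. y i + t * v i) < \<delta> \<Longrightarrow>
      \<bar>\<phi> z - \<phi> (\<lambda>i. y i + t * v i) - (\<Sum>h<n. g h * (z h - (y h + t * v h)))\<bar> \<le> e / N * edist n z (\<lambda>i. y i + t * v i)"
    using g[unfolded gradient_at_def, rule_format, of "e / N"] e N by auto
  show "\<exists>\<delta>>0. \<forall>s. norm (s - t) < \<delta> \<longrightarrow> norm (\<phi> (\<lambda>i. y i + s * v i) - \<phi> (\<lambda>i. y i + t * v i)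
      - (\<Sum>h<n. g h * v h) * (s - t)) \<le> e * norm (s - t)"
  proof (intro exI[of _ "\<delta> / N"] conjI allI impI)
    show "0 < \<delta> / N" using \<delta> N by simp
    fix s assume "norm (s - t) < \<delta> / N"
    hence "\<bar>s - t\<bar> * N < \<delta>" using N by (simp add: field_simps)
    moreover have le: "\<bar>s - t\<bar> * enorm n v \<le> \<bar>s - t\<bar> * N" using N by (intro mult_left_mono) auto
    ultimately have "\<bar>s - t\<bar> * enorm n v < \<delta>" by linarith
    moreover have "(\<lambda>i. y i + s * v i) \<in> Rn n" using y by (simp add: Rn_iff)
    ultimately have "\<bar>\<phi> (\<lambda>i. y i + s * v i) - \<phi> (\<lambda>i. y i + t * v i)
        - (\<Sum>h<n. g h * (y h + s * v h - (y h + t * v h)))\<bar> \<le> e / N * (\<bar>s - t\<bar> * enorm n v)"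
      using \<delta>(2)[of "\<lambda>i. y i + s * v i"] unfolding ed by simp
    also have "(\<Sum>h<n. g h * (y h + s * v h - (y h + t * v h))) = (\<Sum>h<n. g h * v h) * (s - t)"
      unfolding sum_distrib_right
      by (intro sum.cong refl) (simp only: mult.assoc add_diff_add diff_self add_0 flip: left_diff_distrib, simp add: mult.commute)
    also have "e / N * (\<bar>s - t\<bar> * enorm n v) \<le> e / N * (\<bar>s - t\<bar> * N)"
      using e N le by (intro mult_left_mono) auto
    also have "\<dots> = e * \<bar>s - t\<bar>" using N by simp
    finally show "norm (\<phi> (\<lambda>i. y i + s * v i) - \<phi> (\<lambda>i. y i + t * v i) - (\<Sum>h<n. g h * v h) * (s - t))
        \<le> e * norm (s - t)" by simp
  qed
qed

lemma partial_deriv_gradient: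
  assumes "gradient_at n \<phi> y g" "y \<in> Rn n" "h < n"
  shows "partial_deriv h \<phi> y = g h"
proof -
  \<comment> \<open>The axis is parametrised from \<open>y(h := 0)\<close>, so that the parameter
    value \<open>y h\<close> gives the point \<open>y\<close> and the derivative is the one in
    \<open>partial_deriv\<close>.\<close>
  let ?v = "\<lambda>i. if i = h then 1 else 0 :: real"
  have e: "(\<lambda>i. (y(h := 0)) i + u * ?v i) = y(h := u)" for u by auto
  have "gradient_at n \<phi> (\<lambda>i. (y(h := 0)) i + y h * ?v i) g"
    unfolding e using assms(1) by simp
  hence "((\<lambda>u. \<phi> (\<lambda>i. (y(h := 0)) i + u * ?v i)) has_real_derivative (\<Sum>k<n. g k * ?v k)) (at (y h))"
    using assms(2,3) by (intro gradient_at_line) (auto simp: Rn_iff)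
  hence "((\<lambda>u. \<phi> (y(h := u))) has_real_derivative g h) (at (y h))"
    unfolding e using assms(3) by (simp add: if_distrib cong: if_cong)
  thus ?thesis unfolding partial_deriv_def by (rule DERIV_imp_deriv)
qed

lemma differentiable_Rn_gradient:
  assumes "differentiable_Rn n \<phi> y" "y \<in> Rn n"
  shows "gradient_at n \<phi> y (\<lambda>h. partial_deriv h \<phi> y)"
proof -
  obtain g where g: "gradient_at n \<phi> y g"
    using assms(1) unfolding differentiable_Rn_def gradient_at_def by blast
  have "(\<Sum>h<n. partial_deriv h \<phi> y * (z h - y h)) = (\<Sum>h<n. g h * (z h - y h))" for z
    using partial_deriv_gradient[OF g assms(2)] by (intro sum.cong) auto
  thus ?thesis using g unfolding gradient_at_def by simp
qed

text \<open>The mean value theorem on the segment from \<open>y\<close> to \<open>z\<close>, which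
  stays in the ball by convexity, leaves the difference between an intermediate gradient and the one
  at \<open>y\<close>. The right-hand side uses the sum of absolute values, the quantity in which
  sewing measures displacements.\<close>

lemma taylor_Rn:
  assumes y: "y \<in> Rn n" "z \<in> Rn n" "enorm n y \<le> R" "enorm n z \<le> R"
    and diff: "\<And>w. w \<in> Rn n \<Longrightarrow> enorm n w \<le> R \<Longrightarrow> differentiable_Rn n \<phi> w"
    and hoelder: "\<And>h w. h < n \<Longrightarrow> w \<in> Rn n \<Longrightarrow> enorm n w \<le> R \<Longrightarrow>
      \<bar>partial_deriv h \<phi> w - partial_deriv h \<phi> y\<bar> \<le> K * edist n w y powr \<beta>"
    and K: "0 \<le> K" "0 \<le> \<beta>"
  shows "\<bar>\<phi> z - \<phi> y - (\<Sum>h<n. partial_deriv h \<phi> y * (z h - y h))\<bar>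
    \<le> K * (\<Sum>h<n. \<bar>z h - y h\<bar>) powr (\<beta> + 1)"
proof -
  let ?v = "\<lambda>i. z i - y i"
  define S where "S = (\<Sum>h<n. \<bar>z h - y h\<bar>)"
  let ?w = "\<lambda>t i. y i + t * (z i - y i)"
  have v: "?v \<in> Rn n" using y by (simp add: Rn_iff)
  have wR: "?w t \<in> Rn n" for t using y by (simp add: Rn_iff)
  have wn: "enorm n (?w t) \<le> R" if "0 \<le> t" "t \<le> 1" for t
  proof -
    have e: "?w t = (\<lambda>i. (1 - t) * y i + t * z i)" by (auto simp: algebra_simps)
    have "enorm n (?w t) \<le> enorm n (\<lambda>i. (1 - t) * y i) + enorm n (\<lambda>i. t * z i)"
      unfolding e by (rule enorm_add)
    also have "\<dots> \<le> (1 - t) * R + t * R"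
      unfolding enorm_mult using that y by (intro add_mono mult_mono) (auto simp: enorm_nonneg)
    finally show ?thesis by (simp add: algebra_simps)
  qed
  have der: "((\<lambda>s. \<phi> (?w s)) has_real_derivative (\<Sum>h<n. partial_deriv h \<phi> (?w t) * ?v h)) (at t)"
    if "0 \<le> t" "t \<le> 1" for t
    by (rule gradient_at_line[OF differentiable_Rn_gradient[OF diff[OF wR wn[OF that]] wR] y(1) v])
  obtain t where t: "0 < t" "t < 1" "\<phi> (?w 1) - \<phi> (?w 0) = (1 - 0) * (\<Sum>h<n. partial_deriv h \<phi> (?w t) * ?v h)"
    using MVT2[of 0 1 "\<lambda>s. \<phi> (?w s)" "\<lambda>t. \<Sum>h<n. partial_deriv h \<phi> (?w t) * ?v h", OF zero_less_one der]
    by blast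
  have ed: "edist n (?w t) y \<le> S"
  proof -
    have "edist n (?w t) y = \<bar>t\<bar> * enorm n ?v" unfolding edist_def by (simp add: enorm_mult)
    also have "\<dots> \<le> 1 * S" using t enorm_le_sum[of n ?v] unfolding S_def by (intro mult_mono) (auto simp: enorm_nonneg)
    finally show ?thesis by simp
  qed
  have S: "0 \<le> S" unfolding S_def by (intro sum_nonneg) simp
  have eq: "\<phi> z - \<phi> y - (\<Sum>h<n. partial_deriv h \<phi> y * (z h - y h))
      = (\<Sum>h<n. (partial_deriv h \<phi> (?w t) - partial_deriv h \<phi> y) * ?v h)"
  proof -
    have "?w 1 = z" "?w 0 = y" by auto
    hence "\<phi> z - \<phi> y = (\<Sum>h<n. partial_deriv h \<phi> (?w t) * ?v h)" using t(3) by simp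
    thus ?thesis by (simp only: left_diff_distrib sum_subtractf)
  qed
  have "\<bar>\<Sum>h<n. (partial_deriv h \<phi> (?w t) - partial_deriv h \<phi> y) * ?v h\<bar> \<le> (\<Sum>h<n. \<bar>(partial_deriv h \<phi> (?w t) - partial_deriv h \<phi> y) * ?v h\<bar>)"
    by (rule sum_abs)
  also have "\<dots> \<le> (\<Sum>h<n. (K * S powr \<beta>) * \<bar>?v h\<bar>)"
  proof (rule sum_mono)
    fix h assume "h \<in> {..<n}"
    hence "\<bar>partial_deriv h \<phi> (?w t) - partial_deriv h \<phi> y\<bar> \<le> K * edist n (?w t) y powr \<beta>"
      using hoelder[OF _ wR wn[of t]] t by simp
    also have "\<dots> \<le> K * S powr \<beta>"
      using ed K by (intro mult_left_mono powr_mono2) (auto simp: edist_def enorm_nonneg)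
    finally show "\<bar>(partial_deriv h \<phi> (?w t) - partial_deriv h \<phi> y) * ?v h\<bar> \<le> (K * S powr \<beta>) * \<bar>?v h\<bar>"
      unfolding abs_mult by (intro mult_right_mono) auto
  qed
  also have "\<dots> = K * (S powr \<beta> * S)" unfolding S_def by (simp only: mult.assoc flip: sum_distrib_left)
  also have "S powr \<beta> * S = S powr (\<beta> + 1)" using S by (cases "S = 0") (auto simp: powr_add)
  finally show ?thesis unfolding eq S_def .
qed

section \<open>The growth integral\<close>

definition growth_density :: "real \<Rightarrow> real \<Rightarrow> (real \<Rightarrow> real) \<Rightarrow> (real \<Rightarrow> real) \<Rightarrow> real \<Rightarrow> real"
  where "growth_density p \<beta> D A R = (A R powr (1 - p) * D R powr (p - 1 - \<beta> * p)) powr (1 / \<beta>)"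

lemma growth_density_nonneg: "0 \<le> growth_density p \<beta> D A R"
  by (simp add: growth_density_def)

lemma growth_pairD:
  assumes "growth_pair \<beta> D A"
  shows "1 \<le> R \<Longrightarrow> 0 < D R" "1 \<le> R \<Longrightarrow> 0 < A R" "1 \<le> R \<Longrightarrow> D R \<le> R powr \<beta> * A R"
    "1 \<le> R \<Longrightarrow> R \<le> S \<Longrightarrow> D R \<le> D S" "1 \<le> R \<Longrightarrow> R \<le> S \<Longrightarrow> A R \<le> A S"
  using assms by (auto simp: growth_pair_def mono_on_def)

text \<open>This is the meaning of \<open>D R \<le> R powr \<beta> * A R\<close>: the length at
  which the two bounds balance does not exceed the radius.\<close>

lemma growth_pair_length_le:
  assumes "growth_pair \<beta> D A" "0 < \<beta>" "1 \<le> R"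
  shows "(D R / A R) powr (1 / \<beta>) \<le> R"
proof -
  have "D R / A R \<le> R powr \<beta>"
    using growth_pairD[OF assms(1)] assms(3) by (simp add: field_simps)
  hence "(D R / A R) powr (1 / \<beta>) \<le> (R powr \<beta>) powr (1 / \<beta>)"
    using growth_pairD(1,2)[OF assms(1,3)] assms(2) by (intro powr_mono2) auto
  thus ?thesis using assms by (simp add: powr_powr)
qed

text \<open>Both exponents, \<open>1 - p\<close> and \<open>p - 1 - \<beta> * p\<close>, are
  negative, while \<open>A\<close> and \<open>D\<close> increase.\<close>

lemma growth_density_antimono:
  fixes p \<beta> :: real
  assumes "growth_pair \<beta> D A" "1 < p" "0 < \<beta>" "p - 1 < \<beta> * p" "1 \<le> r" "r \<le> s"
  shows "growth_density p \<beta> D A s \<le> growth_density p \<beta> D A r"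
proof -
  have "A r \<le> A s" "D r \<le> D s" "0 < A r" "0 < D r"
    using growth_pairD[OF assms(1)] assms(5,6) by auto
  thus ?thesis unfolding growth_density_def using assms
    by (intro powr_mono2 mult_mono powr_mono2') auto
qed

text \<open>Cauchy condensation: on \<open>[2^k, 2^(k+1))\<close> a decreasing function is at most
  its value at the left end. Sum and integral are interchanged for step functions, and
  \<open>g\<close> enters through a pointwise comparison with their sum.\<close>

lemma nn_integral_dyadic_le:
  fixes g :: "real \<Rightarrow> real"
  assumes anti: "\<And>r s. 1 \<le> r \<Longrightarrow> r \<le> s \<Longrightarrow> g s \<le> g r" and nn: "\<And>r. 0 \<le> g r"
    and sm: "summable (\<lambda>k. 2 ^ k * g (2 ^ k))"
  shows "(\<integral>\<^sup>+ r\<in>{1..}. ennreal (g r) \<partial>lborel) < \<infinity>"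
proof -
  have ptw: "ennreal (g r) * indicator {1..} r
      \<le> (\<Sum>k. ennreal (g (2 ^ k)) * indicator {2 ^ k..<2 ^ Suc k} r)" for r :: real
  proof (cases "1 \<le> r")
    case True
    define N where "N = (LEAST N. r < 2 ^ Suc N)"
    have ex: "\<exists>N. r < 2 ^ Suc N"
    proof -
      obtain M where "r < 2 ^ M" using real_arch_pow[of 2 r] by auto
      moreover have "(2::real) ^ M \<le> 2 ^ Suc M" by simp
      ultimately show ?thesis by (meson order_less_le_trans)
    qed
    have N: "r < 2 ^ Suc N" unfolding N_def using LeastI_ex[OF ex] .
    have N': "2 ^ N \<le> r"
    proof (cases N)
      case (Suc M)
      hence "\<not> r < 2 ^ Suc M" using not_less_Least[of M "\<lambda>N. r < 2 ^ Suc N"] unfolding N_def by simp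
      thus ?thesis using Suc by simp
    qed (use True in simp)
    have "ennreal (g r) \<le> ennreal (g (2 ^ N)) * indicator {2 ^ N..<2 ^ Suc N} r"
      using N N' anti[of "2 ^ N" r] by (simp add: ennreal_leI)
    also have "\<dots> \<le> (\<Sum>k. ennreal (g (2 ^ k)) * indicator {2 ^ k..<2 ^ Suc k} r)"
    proof -
      define F where "F = (\<lambda>k. ennreal (g (2 ^ k)) * indicator {2 ^ k..<2 ^ Suc k} r)"
      have "sum F {N} \<le> suminf F" by (intro sum_le_suminf) auto
      hence "F N \<le> suminf F" by simp
      thus ?thesis unfolding F_def .
    qed
    finally show ?thesis using True by simp
  qed simp
  have "(\<integral>\<^sup>+ r\<in>{1..}. ennreal (g r) \<partial>lborel)
      \<le> (\<integral>\<^sup>+ (r::real). (\<Sum>k. ennreal (g (2 ^ k)) * indicator {2 ^ k..<2 ^ Suc k} r) \<partial>lborel)"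
    by (rule nn_integral_mono) (rule ptw)
  also have "\<dots> = (\<Sum>k. \<integral>\<^sup>+ (r::real). ennreal (g (2 ^ k)) * indicator {2 ^ k..<2 ^ Suc k} r \<partial>lborel)"
    by (rule nn_integral_suminf) auto
  also have "\<dots> = (\<Sum>k. ennreal (2 ^ k * g (2 ^ k)))"
  proof (rule suminf_cong)
    fix k :: nat
    have "emeasure lborel {2 ^ k..<2 ^ Suc k :: real} = ennreal (2 ^ k)"
      by (subst emeasure_lborel_Ico) simp_all
    thus "(\<integral>\<^sup>+ (r::real). ennreal (g (2 ^ k)) * indicator {2 ^ k..<2 ^ Suc k} r \<partial>lborel) = ennreal (2 ^ k * g (2 ^ k))"
      using nn[of "2 ^ k"] by (subst nn_integral_cmult_indicator) (simp_all add: ennreal_mult mult.commute)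
  qed
  also have "\<dots> < \<infinity>"
  proof -
    have "(\<Sum>k. ennreal (2 ^ k * g (2 ^ k))) \<noteq> top"
      using nn by (intro ennreal_suminf_neq_top[OF sm]) simp
    thus ?thesis by (simp only: infinity_ennreal_def less_top)
  qed
  finally show ?thesis .
qed

text \<open>The times at which \<open>N\<close> is at least \<open>R\<close> form a closed set, so
  their infimum is attained; the intermediate value theorem excludes a value above \<open>R\<close>
  there.\<close>

lemma first_hitting_time:
  fixes N :: "real \<Rightarrow> real"
  assumes cont: "continuous_on {0..t0} N" and "0 \<le> t0" "N 0 \<le> R" "R \<le> N t0"
  obtains T where "0 \<le> T" "T \<le> t0" "N T = R" "\<And>t. 0 \<le> t \<Longrightarrow> t \<le> T \<Longrightarrow> N t \<le> R"
proof -
  define S where "S = {0..t0} \<inter> N -` {R..}"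
  have S: "closed S" "t0 \<in> S" "bdd_below S"
    using continuous_closed_preimage[OF cont, of "{R..}"] assms by (auto simp: S_def)
  define T where "T = Inf S"
  have "T \<in> S" unfolding T_def using closed_contains_Inf[of S] S by auto
  hence T: "0 \<le> T" "T \<le> t0" "R \<le> N T" by (auto simp: S_def)
  have least: "T \<le> t" if "t \<in> S" for t unfolding T_def using that S(3) by (rule cInf_lower)
  have below: "N t < R" if "0 \<le> t" "t < T" for t
    by (rule ccontr) (use least[of t] that T in \<open>auto simp: S_def\<close>)
  have "continuous_on {0..T} N" using cont T by (auto intro: continuous_on_subset)
  then obtain t where t: "0 \<le> t" "t \<le> T" "N t = R"
    using IVT'[of N 0 R T] assms(3) T by auto
  hence "N T = R" using below[of t] by (cases "t = T") auto
  thus ?thesis using T below by (intro that[of T]) (auto simp: order_le_less)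
qed

section \<open>Solutions do not explode\<close>

locale rough_equation =
  fixes p \<gamma> \<beta> :: real and n d :: nat and D A :: "real \<Rightarrow> real"
    and f :: "(nat \<Rightarrow> real) \<Rightarrow> nat \<Rightarrow> nat \<Rightarrow> real" and x :: "real \<Rightarrow> nat \<Rightarrow> real"
    and area :: "nat \<Rightarrow> nat \<Rightarrow> real \<Rightarrow> real \<Rightarrow> real"
  assumes exponents: "(1 < p \<and> p < \<gamma> \<and> \<gamma> < 2) \<or> (2 \<le> p \<and> p < \<gamma> \<and> \<gamma> < 3)"
    and \<beta>_eq: "\<beta> = \<gamma> - 1"
    and growth: "growth_pair \<beta> D A"
    and G: "cond_G p \<beta> n d D A f"
    and driver: "driver p d x area"
begin

abbreviation solves where "solves \<equiv> solution_on p n d f x area"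
abbreviation err where "err \<equiv> increment_error p n d f x area"
abbreviation pd where "pd h i j \<equiv> partial_deriv h (\<lambda>z. f z i j)"

section \<open>Length scale and coefficient bounds extracted from (G)\<close>

lemma p_pos: "0 < p" and p_gt1: "1 < p" and \<beta>_pos: "0 < \<beta>"
  using exponents \<beta>_eq by auto

lemma D_pos: "1 \<le> R \<Longrightarrow> 0 < D R" and A_pos: "1 \<le> R \<Longrightarrow> 0 < A R"
  using growth by (auto simp: growth_pair_def)

text \<open>The factor 1/2 ensures \<open>osc (2 * R) \<le> R\<close>: a point of the ball of radius
  \<open>R\<close> that is displaced by this length stays in the ball of radius
  \<open>2 * R\<close>.\<close>

definition osc :: "real \<Rightarrow> real"
  where "osc R = (D R / A R) powr (1 / \<beta>) / 2"

lemma osc_pos: "1 \<le> R \<Longrightarrow> 0 < osc R"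
  using D_pos[of R] A_pos[of R] by (simp add: osc_def)

lemma osc_le:
  assumes "1 \<le> R"
  shows "osc R \<le> R / 2"
proof -
  have "D R / A R \<le> R powr \<beta>"
    using growth assms A_pos[OF assms] by (auto simp: growth_pair_def field_simps)
  hence "(D R / A R) powr (1 / \<beta>) \<le> (R powr \<beta>) powr (1 / \<beta>)"
    using D_pos[OF assms] A_pos[OF assms] \<beta>_pos by (intro powr_mono2) auto
  thus ?thesis using \<beta>_pos assms by (simp add: osc_def powr_powr)
qed

lemma A_osc_le:
  assumes "1 \<le> R"
  shows "A R * osc R powr \<beta> \<le> D R"
proof -
  have "A R * osc R powr \<beta> \<le> A R * ((D R / A R) powr (1 / \<beta>)) powr \<beta>"
    using D_pos[OF assms] A_pos[OF assms] \<beta>_pos unfolding osc_def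
    by (intro mult_left_mono powr_mono2) auto
  also have "\<dots> = D R" using D_pos[OF assms] A_pos[OF assms] \<beta>_pos by (simp add: powr_powr)
  finally show ?thesis .
qed

lemma coeff_bound:
  assumes "1 \<le> R" "y \<in> Rn n" "enorm n y \<le> R" "i < n" "j < d"
  shows "\<bar>f y i j\<bar> \<le> D R"
proof -
  have "\<bar>(\<lambda>(i, j). f y i j) (i, j)\<bar> \<le> L2_set (\<lambda>(i, j). f y i j) ({..<n} \<times> {..<d})"
    using assms by (intro abs_le_L2_set) auto
  also have "\<dots> \<le> D R" using G assms unfolding cond_G_def by blast
  finally show ?thesis by simp
qed

lemma coeff_hoelder:
  assumes "p < 2" "1 \<le> R" "y \<in> Rn n" "y' \<in> Rn n" "enorm n y \<le> R" "enorm n y' \<le> R" "i < n" "j < d"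
  shows "\<bar>f y' i j - f y i j\<bar> \<le> A R * (\<Sum>k<n. \<bar>y' k - y k\<bar>) powr \<beta>"
proof -
  have "\<bar>(\<lambda>(i, j). f y' i j - f y i j) (i, j)\<bar>
      \<le> L2_set (\<lambda>(i, j). f y' i j - f y i j) ({..<n} \<times> {..<d})"
    using assms by (intro abs_le_L2_set) auto
  also have "\<dots> \<le> A R * edist n y' y powr \<beta>"
    using G[unfolded cond_G_def, rule_format, OF assms(2-4)] assms by simp
  also have "\<dots> \<le> A R * (\<Sum>k<n. \<bar>y' k - y k\<bar>) powr \<beta>"
    using A_pos[OF assms(2)] \<beta>_pos edist_le_sum
    by (intro mult_left_mono powr_mono2) (auto simp: edist_def enorm_nonneg)
  finally show ?thesis by simp
qed

context
  assumes rough: "2 \<le> p"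
begin

lemma coeff_differentiable:
  assumes "1 \<le> R" "y \<in> Rn n" "enorm n y \<le> R" "i < n" "j < d"
  shows "differentiable_Rn n (\<lambda>z. f z i j) y"
  using G[unfolded cond_G_def, rule_format, OF assms(1,2,2)] assms rough by simp

lemma partial_hoelder:
  assumes "1 \<le> R" "y \<in> Rn n" "y' \<in> Rn n" "enorm n y \<le> R" "enorm n y' \<le> R" "h < n" "i < n" "j < d"
  shows "\<bar>pd h i j y' - pd h i j y\<bar>
    \<le> A R * edist n y' y powr (\<beta> - 1)"
proof -
  have "\<bar>(\<lambda>(h, i, j). pd h i j y' - pd h i j y) (h, i, j)\<bar>
      \<le> L2_set (\<lambda>(h, i, j). pd h i j y' - pd h i j y)
          ({..<n} \<times> {..<n} \<times> {..<d})"
    using assms by (intro abs_le_L2_set) auto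
  also have "\<dots> \<le> A R * edist n y' y powr (\<beta> - 1)"
    using G[unfolded cond_G_def, rule_format, OF assms(1-3)] assms rough by simp
  finally show ?thesis by simp
qed

lemma coeff_taylor:
  assumes "1 \<le> R" "y \<in> Rn n" "y' \<in> Rn n" "enorm n y \<le> R" "enorm n y' \<le> R" "i < n" "j < d"
  shows "\<bar>f y' i j - f y i j - (\<Sum>h<n. pd h i j y * (y' h - y h))\<bar>
    \<le> A R * (\<Sum>k<n. \<bar>y' k - y k\<bar>) powr \<beta>"
proof -
  have "\<bar>f y' i j - f y i j - (\<Sum>h<n. pd h i j y * (y' h - y h))\<bar>
    \<le> A R * (\<Sum>k<n. \<bar>y' k - y k\<bar>) powr (\<beta> - 1 + 1)"
    by (rule taylor_Rn[OF assms(2-5)])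
      (use assms coeff_differentiable partial_hoelder A_pos[of R] rough exponents \<beta>_eq in auto)
  thus ?thesis by simp
qed

text \<open>Interpolation between the bounds on \<open>f\<close> and on the Hoelder constant of its derivative.\<close>

lemma partial_bound:
  assumes "1 \<le> R" "y \<in> Rn n" "enorm n y \<le> R" "h < n" "i < n" "j < d"
  defines "l \<equiv> osc (2 * R)"
  shows "\<bar>pd h i j y\<bar> \<le> 3 * D (2 * R) / l"
proof -
  have R: "1 \<le> 2 * R" using assms by simp
  have l: "0 < l" "l \<le> R" "A (2 * R) * l powr \<beta> \<le> D (2 * R)"
    using osc_pos[OF R] osc_le[OF R] A_osc_le[OF R]
    by (auto simp: l_def)
  \<comment> \<open>A displacement by \<open>l\<close> along one axis isolates one partial
    derivative. Two values of \<open>f\<close> and the Taylor remainder, each at most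
    \<open>D (2 * R)\<close>, make up the factor 3.\<close>
  define z where "z = (\<lambda>k. y k + (if k = h then l else 0))"
  have z: "z \<in> Rn n" "enorm n z \<le> 2 * R"
    using enorm_add[of n y "\<lambda>k. if k = h then l else 0"] enorm_axis[OF assms(4), of l] assms l
    by (auto simp: z_def Rn_iff)
  have dz: "z k - y k = (if k = h then l else 0)" for k by (simp add: z_def)
  have d: "(\<Sum>k<n. g k * (z k - y k)) = g h * l" for g
    unfolding dz using assms(4) by (simp add: if_distrib cong: if_cong)
  have d': "(\<Sum>k<n. \<bar>z k - y k\<bar>) = l"
    unfolding dz using assms(4) l by (simp add: if_distrib cong: if_cong)
  have yR: "enorm n y \<le> 2 * R" using assms by simp
  have "\<bar>f z i j - f y i j - pd h i j y * l\<bar> \<le> A (2 * R) * l powr \<beta>"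
    using coeff_taylor[OF R assms(2) z(1) yR z(2) assms(5,6)] unfolding d d' .
  moreover have "\<bar>f z i j\<bar> \<le> D (2 * R)" "\<bar>f y i j\<bar> \<le> D (2 * R)"
    using coeff_bound[OF R] z yR assms by auto
  ultimately have "\<bar>pd h i j y * l\<bar> \<le> 3 * D (2 * R)"
    using l(3) by linarith
  thus ?thesis using l by (simp add: abs_mult field_simps)
qed

end

section \<open>Controls of the driver and of a solution\<close>

definition driver_control :: "real \<Rightarrow> (real \<Rightarrow> real) \<Rightarrow> bool"
  where "driver_control T \<omega> \<longleftrightarrow> control T \<omega> \<and>
    (\<forall>s t j. 0 \<le> s \<and> s \<le> t \<and> t \<le> T \<and> j < d \<longrightarrow> \<bar>x t j - x s j\<bar> powr p \<le> \<omega> t - \<omega> s) \<and>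
    (2 \<le> p \<longrightarrow> (\<forall>r<d. \<forall>j<d. \<forall>s t. 0 \<le> s \<and> s \<le> t \<and> t \<le> T \<longrightarrow> \<bar>area r j s t\<bar> powr (p / 2) \<le> \<omega> t - \<omega> s))"

text \<open>In case (ii) the control from \<open>area_cond\<close> bounds the signal as well, so a
  single control serves both.\<close>

lemma driver_control_exists:
  assumes "0 < T"
  obtains \<omega> where "driver_control T \<omega>"
proof -
  have x: "\<bar>x t j - x s j\<bar> powr p \<le> \<omega> t - \<omega> s"
    if "pvar_bound p d x T \<omega>" "0 \<le> s" "s \<le> t" "t \<le> T" "j < d" for \<omega> s t j
  proof -
    have "\<bar>x t j - x s j\<bar> powr p \<le> edist d (x t) (x s) powr p"
      using abs_le_enorm[OF that(5), of "\<lambda>i. x t i - x s i"] p_pos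
      by (intro powr_mono2) (auto simp: edist_def)
    also have "\<dots> \<le> \<omega> t - \<omega> s" using that unfolding pvar_bound_def by blast
    finally show ?thesis .
  qed
  show ?thesis
  proof (cases "2 \<le> p")
    case True
    then obtain \<omega> where "control T \<omega>" "pvar_bound p d x T \<omega>"
       "\<forall>r<d. \<forall>j<d. \<forall>s t. 0 \<le> s \<and> s \<le> t \<and> t \<le> T \<longrightarrow> \<bar>area r j s t\<bar> powr (p / 2) \<le> \<omega> t - \<omega> s"
      using driver assms unfolding driver_def area_cond_def by blast
    thus ?thesis using x by (intro that[of \<omega>]) (auto simp: driver_control_def)
  next
    case False
    obtain \<omega> where "control T \<omega>" "pvar_bound p d x T \<omega>"
      using driver assms unfolding driver_def finite_pvar_def by blast
    thus ?thesis using x False by (intro that[of \<omega>]) (auto simp: driver_control_def)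
  qed
qed

lemma chen:
  assumes "2 \<le> p" "0 \<le> s" "s \<le> t" "t \<le> u" "r < d" "j < d"
  shows "area r j s u = area r j s t + area r j t u + (x t r - x s r) * (x u j - x t j)"
proof -
  have "area_cond p d x area (u + 1)" using driver assms unfolding driver_def by auto
  thus ?thesis using assms unfolding area_cond_def by auto
qed

lemma err_eq:
  "err y i s t = y t i - y s i - (\<Sum>j<d. f (y s) i j * (x t j - x s j))
    - (if p < 2 then 0 else second_order_term n d (f (y s)) (\<lambda>h i j. pd h i j (y s))
        (\<lambda>r j. area r j s t) i)"
  by (simp add: increment_error_def second_order_term_def)

text \<open>Chen's relation with three equal times forces \<open>area r j s s = 0\<close>. The
  estimate for a solution concerns \<open>s < t\<close>, whereas bisection also meets degenerate
  intervals.\<close>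

lemma err_refl:
  assumes "0 \<le> s"
  shows "err y i s s = 0"
  using chen[OF _ assms order_refl order_refl]
  by (simp add: err_eq second_order_term_def)

text \<open>The function \<open>\<theta>\<close> is traded for arbitrarily small multiples of the
  control at small scales. On intervals where the control is constant, \<open>\<theta> 0 = 0\<close>
  gives the estimate.\<close>

lemma solution_small_error:
  assumes "solves y0 y t1"
  obtains \<omega> where "control t1 \<omega>"
    "\<And>\<eta>. 0 < \<eta> \<Longrightarrow> \<exists>\<delta>>0. \<forall>s u i. 0 \<le> s \<and> s \<le> u \<and> u \<le> t1 \<and> i < n \<and> \<omega> u - \<omega> s \<le> \<delta> \<longrightarrow>
       \<bar>err y i s u\<bar> \<le> \<eta> * (\<omega> u - \<omega> s)"
proof -
  obtain \<omega> \<theta> where w: "control t1 \<omega>" and \<theta>: "\<theta> 0 = 0" "\<theta> \<in> o[at_right 0](\<lambda>\<delta>. \<delta>)"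
    and I: "\<forall>i<n. \<forall>s t. 0 \<le> s \<and> s < t \<and> t \<le> t1 \<longrightarrow>
      \<bar>err y i s t\<bar> \<le> \<theta> (\<omega> t - \<omega> s)"
    using assms unfolding solution_on_def by blast
  show ?thesis
  proof (rule that[OF w])
    fix \<eta> :: real assume \<eta>: "0 < \<eta>"
    have "eventually (\<lambda>\<delta>. norm (\<theta> \<delta>) \<le> \<eta> * norm \<delta>) (at_right 0)"
      using landau_o.smallD[OF \<theta>(2) \<eta>] .
    then obtain b where b: "0 < b" "\<And>\<delta>. 0 < \<delta> \<Longrightarrow> \<delta> < b \<Longrightarrow> \<bar>\<theta> \<delta>\<bar> \<le> \<eta> * \<delta>"
      by (auto simp: eventually_at_right_field)
    have th: "\<theta> \<delta> \<le> \<eta> * \<delta>" if "0 \<le> \<delta>" "\<delta> \<le> b / 2" for \<delta>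
    proof (cases "\<delta> = 0")
      case False
      thus ?thesis using b(2)[of \<delta>] b(1) that by simp
    qed (simp add: \<theta>(1))
    show "\<exists>\<delta>>0. \<forall>s u i. 0 \<le> s \<and> s \<le> u \<and> u \<le> t1 \<and> i < n \<and> \<omega> u - \<omega> s \<le> \<delta> \<longrightarrow>
       \<bar>err y i s u\<bar> \<le> \<eta> * (\<omega> u - \<omega> s)"
    proof (intro exI[of _ "b / 2"] conjI allI impI)
      show "0 < b / 2" using b by simp
      fix s u i assume *: "0 \<le> s \<and> s \<le> u \<and> u \<le> t1 \<and> i < n \<and> \<omega> u - \<omega> s \<le> b / 2"
      have m: "0 \<le> \<omega> u - \<omega> s" using w * mono_onD[of "{0..t1}" \<omega> s u] by (auto simp: control_def)
      show "\<bar>err y i s u\<bar> \<le> \<eta> * (\<omega> u - \<omega> s)"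
      proof (cases "s = u")
        case True
        thus ?thesis using * err_refl by simp
      next
        case False
        hence "\<bar>err y i s u\<bar> \<le> \<theta> (\<omega> u - \<omega> s)" using I * by simp
        also have "\<dots> \<le> \<eta> * (\<omega> u - \<omega> s)" using th m * by blast
        finally show ?thesis .
      qed
    qed
  qed
qed

definition step_radius :: real
  where "step_radius = (if p < 2 then young_radius p \<gamma> n d else rough_radius p \<gamma> n d)"

lemma step_radius_pos: "0 < step_radius"
  using exponents p_pos
  by (auto simp: step_radius_def young_radius_def rough_radius_def young_bound_def
      intro!: local_radius_pos rough_defect_nonneg rough_bound_nonneg)

text \<open>Let \<open>l = osc (2 * R)\<close> be the unit for \<open>y\<close>,
  \<open>D (2 * R)\<close> that for \<open>f\<close>, their quotient that for \<open>x\<close> and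
  its square that for \<open>area\<close>. In these units the constants of (G) become at most 1, and
  partial derivatives at most 3. Undoing the change of units turns the universal
  \<open>step_radius\<close> into the stated multiple of \<open>(l / D) powr p\<close>. The radius
  \<open>2 * R\<close> is inherited from \<open>partial_bound\<close>.\<close>

lemma local_solution_displacement:
  assumes sol: "solves y0 y t1"
    and \<omega>: "driver_control T \<omega>" and ab: "0 \<le> a" "a \<le> b" "b \<le> t1" "b \<le> T"
    and R: "1 \<le> R" "\<And>t. a \<le> t \<Longrightarrow> t \<le> b \<Longrightarrow> enorm n (y t) \<le> R"
    and le: "\<omega> b - \<omega> a \<le> step_radius * (osc (2 * R) / D (2 * R)) powr p"
  shows "(\<Sum>k<n. \<bar>y b k - y a k\<bar>) \<le> osc (2 * R) / 4"
proof -
  define l where "l = osc (2 * R)"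
  define D' where "D' = D (2 * R)"
  define c where "c = D' / l"
  have R2: "1 \<le> 2 * R" using R by simp
  have pos: "0 < l" "0 < D'" "0 < c"
    using osc_pos[OF R2] D_pos[OF R2] by (auto simp: l_def D'_def c_def)
  have Al: "A (2 * R) * l powr \<beta> \<le> D'" using A_osc_le[OF R2] by (simp add: l_def D'_def)
  have yR: "y t \<in> Rn n" "enorm n (y t) \<le> R" "enorm n (y t) \<le> 2 * R" if "a \<le> t" "t \<le> b" for t
    using sol R(1) R(2)[OF that] that ab by (auto simp: solution_on_def Pi_iff)
  obtain \<omega>' where \<omega>': "control t1 \<omega>'" and small:
    "\<And>\<eta>. 0 < \<eta> \<Longrightarrow> \<exists>\<delta>>0. \<forall>s u i. 0 \<le> s \<and> s \<le> u \<and> u \<le> t1 \<and> i < n \<and> \<omega>' u - \<omega>' s \<le> \<delta> \<longrightarrow>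
       \<bar>err y i s u\<bar> \<le> \<eta> * (\<omega>' u - \<omega>' s)"
    using solution_small_error[OF sol] by metis
  define w where "w = (\<lambda>t. c powr p * \<omega> t)"
  have w: "w t - w s = c powr p * (\<omega> t - \<omega> s)" for s t by (simp add: w_def right_diff_distrib)
  have cont: "continuous_on {a..b} w" "continuous_on {a..b} \<omega>'"
    using \<omega> \<omega>' ab unfolding w_def driver_control_def control_def
    by (auto intro!: continuous_intros intro: continuous_on_subset)
  have mono: "mono_on {a..b} w" "mono_on {a..b} \<omega>'"
    using \<omega> \<omega>' ab unfolding w_def driver_control_def control_def mono_on_def by (auto intro!: mult_left_mono)
  have "w b - w a \<le> c powr p * (step_radius * (l / D') powr p)"
    unfolding w using le by (intro mult_left_mono) (auto simp: l_def D'_def)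
  also have "\<dots> = step_radius * (c * (l / D')) powr p"
    using pos by (subst powr_mult) auto
  also have "c * (l / D') = 1" using pos by (simp add: c_def)
  finally have wle: "w b - w a \<le> step_radius" by simp
  have err: "\<exists>\<delta>>0. \<forall>s u i. a \<le> s \<and> s \<le> u \<and> u \<le> b \<and> i < n \<and> \<omega>' u - \<omega>' s \<le> \<delta> \<longrightarrow>
       \<bar>err y i s u / l\<bar> \<le> \<eta> * (\<omega>' u - \<omega>' s)" if "0 < \<eta>" for \<eta>
  proof -
    from that pos have "0 < \<eta> * l" by simp
    from small[OF this] obtain \<delta> where \<delta>: "0 < \<delta>" "\<And>s u i. 0 \<le> s \<Longrightarrow> s \<le> u \<Longrightarrow> u \<le> t1 \<Longrightarrow> i < n \<Longrightarrow> \<omega>' u - \<omega>' s \<le> \<delta> \<Longrightarrow>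
       \<bar>err y i s u\<bar> \<le> \<eta> * l * (\<omega>' u - \<omega>' s)" by blast
    have "\<bar>err y i s u / l\<bar> \<le> \<eta> * (\<omega>' u - \<omega>' s)"
      if "a \<le> s" "s \<le> u" "u \<le> b" "i < n" "\<omega>' u - \<omega>' s \<le> \<delta>" for s u i
      using \<delta>(2)[of s u i] that ab pos by (simp add: field_simps)
    with \<delta>(1) show ?thesis by blast
  qed
  have x': "\<bar>x t j * c - x s j * c\<bar> powr p \<le> w t - w s" if "a \<le> s" "s \<le> t" "t \<le> b" "j < d" for s t j
  proof -
    have "\<bar>x t j * c - x s j * c\<bar> powr p = c powr p * \<bar>x t j - x s j\<bar> powr p"
    proof -
      have "x t j * c - x s j * c = c * (x t j - x s j)" by (simp add: algebra_simps)
      thus ?thesis using pos by (simp only: abs_mult powr_mult abs_of_pos)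
    qed
    also have "\<dots> \<le> c powr p * (\<omega> t - \<omega> s)"
      using \<omega> that ab unfolding driver_control_def by (intro mult_left_mono) auto
    finally show ?thesis by (simp add: w)
  qed
  have f1: "\<bar>f (y s) i j / D'\<bar> \<le> 1" if "a \<le> s" "s \<le> b" "i < n" "j < d" for s i j
    using coeff_bound[OF R2 yR(1)[OF that(1,2)] yR(3)[OF that(1,2)] that(3,4)] pos by (simp add: D'_def)
  have dy: "(\<Sum>k<n. \<bar>y t k / l - y s k / l\<bar>) = (\<Sum>k<n. \<bar>y t k - y s k\<bar>) / l" for s t
    using pos by (simp add: sum_divide_distrib flip: diff_divide_distrib)
  have S: "0 \<le> (\<Sum>k<n. \<bar>y t k - y s k\<bar>)" for s t by (intro sum_nonneg) simp
  \<comment> \<open>Here \<open>A * l powr \<beta> \<le> D\<close> is used: the rescaled Hoelder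
    constant is at most 1.\<close>
  have scale: "A (2 * R) * S powr \<beta> / D' \<le> (S / l) powr \<beta>" if "0 \<le> S" for S
  proof -
    have "A (2 * R) * S powr \<beta> / D' = (A (2 * R) * l powr \<beta> / D') * (S / l) powr \<beta>"
      using pos that by (simp add: powr_divide)
    also have "\<dots> \<le> 1 * (S / l) powr \<beta>" using Al pos by (intro mult_right_mono) auto
    finally show ?thesis by simp
  qed
  have lin: "(\<Sum>j<d. f (y s) i j / D' * (x u j * c - x s j * c)) = (\<Sum>j<d. f (y s) i j * (x u j - x s j)) / l" for s u i
    unfolding sum_divide_distrib using pos by (intro sum.cong) (auto simp: c_def field_simps)
  have "(\<Sum>k<n. \<bar>y b k / l - y a k / l\<bar>) \<le> 1 / 4"
  proof (cases "p < 2")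
    case True
    show ?thesis
    proof (rule local_displacement_young[where \<omega> = w and \<omega>' = \<omega>' and fa = "\<lambda>s i j. f (y s) i j / D'" and d = d
          and x = "\<lambda>t j. x t j * c", OF _ _ _ ab(2) cont mono _ x' f1])
      show "1 < p" "p < \<gamma>" "\<gamma> < 2" using exponents True by auto
      show "w b - w a \<le> young_radius p \<gamma> n d" using wle True by (simp add: step_radius_def)
      fix \<eta> :: real assume "0 < \<eta>"
      from err[OF this] show "\<exists>\<delta>>0. \<forall>s u i. a \<le> s \<and> s \<le> u \<and> u \<le> b \<and> i < n \<and> \<omega>' u - \<omega>' s \<le> \<delta> \<longrightarrow>
        \<bar>y u i / l - y s i / l - (\<Sum>j<d. f (y s) i j / D' * (x u j * c - x s j * c))\<bar> \<le> \<eta> * (\<omega>' u - \<omega>' s)"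
        unfolding lin err_eq using True by (simp add: diff_divide_distrib)
    next
      fix s t i j assume *: "a \<le> s" "s \<le> t" "t \<le> b" "i < n" "j < d"
      have "\<bar>f (y t) i j - f (y s) i j\<bar> \<le> A (2 * R) * (\<Sum>k<n. \<bar>y t k - y s k\<bar>) powr \<beta>"
        using * yR by (intro coeff_hoelder[OF True R2]) auto
      hence "\<bar>f (y t) i j / D' - f (y s) i j / D'\<bar> \<le> A (2 * R) * (\<Sum>k<n. \<bar>y t k - y s k\<bar>) powr \<beta> / D'"
        using pos by (simp add: divide_right_mono flip: diff_divide_distrib)
      also have "\<dots> \<le> (\<Sum>k<n. \<bar>y t k / l - y s k / l\<bar>) powr (\<gamma> - 1)"
        unfolding dy using scale[OF S] by (simp add: \<beta>_eq)
      finally show "\<bar>f (y t) i j / D' - f (y s) i j / D'\<bar> \<le> (\<Sum>k<n. \<bar>y t k / l - y s k / l\<bar>) powr (\<gamma> - 1)" .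
    qed
  next
    case False
    hence p2: "2 \<le> p" by simp
    let ?g = "\<lambda>s h i j. pd h i j (y s)"
    have sec: "second_order_term n d (\<lambda>i j. f (y s) i j / D') (\<lambda>h i j. ?g s h i j / c) (\<lambda>r j. area r j s u * c\<^sup>2) i
        = second_order_term n d (f (y s)) (?g s) (\<lambda>r j. area r j s u) i / l" for s u i
      unfolding second_order_term_def sum_divide_distrib using pos
      by (intro sum.cong refl) (simp add: c_def power2_eq_square field_simps)
    show ?thesis
    proof (rule local_displacement_rough[where \<omega> = w and \<omega>' = \<omega>' and fa = "\<lambda>s i j. f (y s) i j / D'" and d = d
          and x = "\<lambda>t j. x t j * c" and area = "\<lambda>r j s t. area r j s t * c\<^sup>2" and fb = "\<lambda>s h i j. ?g s h i j / c",
          OF p2 _ _ ab(2) cont mono _ x' _ _ f1])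
      show "p < \<gamma>" "\<gamma> < 3" using exponents p2 by auto
      show "w b - w a \<le> rough_radius p \<gamma> n d" using wle False by (simp add: step_radius_def)
      fix \<eta> :: real assume "0 < \<eta>"
      from err[OF this] show "\<exists>\<delta>>0. \<forall>s u i. a \<le> s \<and> s \<le> u \<and> u \<le> b \<and> i < n \<and> \<omega>' u - \<omega>' s \<le> \<delta> \<longrightarrow>
        \<bar>y u i / l - y s i / l - (\<Sum>j<d. f (y s) i j / D' * (x u j * c - x s j * c))
          - second_order_term n d (\<lambda>i j. f (y s) i j / D') (\<lambda>h i j. ?g s h i j / c) (\<lambda>r j. area r j s u * c\<^sup>2) i\<bar>
          \<le> \<eta> * (\<omega>' u - \<omega>' s)"
        unfolding lin sec err_eq using False by (simp add: diff_divide_distrib)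
    next
      fix s t r j assume *: "a \<le> s" "s \<le> t" "t \<le> b" "r < d" "j < d"
      have "(c\<^sup>2) powr (p / 2) = (c powr 2) powr (p / 2)" using pos by simp
      hence c2: "(c\<^sup>2) powr (p / 2) = c powr p" by (simp only: powr_powr) simp
      have "\<bar>area r j s t * c\<^sup>2\<bar> powr (p / 2) = c powr p * \<bar>area r j s t\<bar> powr (p / 2)"
        using pos by (simp add: abs_mult powr_mult c2)
      also have "\<dots> \<le> c powr p * (\<omega> t - \<omega> s)"
        using \<omega> p2 * ab unfolding driver_control_def by (intro mult_left_mono) auto
      finally show "\<bar>area r j s t * c\<^sup>2\<bar> powr (p / 2) \<le> w t - w s" by (simp add: w)
    next
      fix s t u r j assume *: "a \<le> s" "s \<le> t" "t \<le> u" "u \<le> b" "r < d" "j < d"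
      have E: "area r j s u = area r j s t + area r j t u + (x t r - x s r) * (x u j - x t j)"
        using * ab by (intro chen p2) auto
      show "area r j s u * c\<^sup>2 = area r j s t * c\<^sup>2 + area r j t u * c\<^sup>2 + (x t r * c - x s r * c) * (x u j * c - x t j * c)"
        unfolding E by (simp add: power2_eq_square algebra_simps)
    next
      fix s h i j assume *: "a \<le> s" "s \<le> b" "h < n" "i < n" "j < d"
      have "\<bar>?g s h i j\<bar> \<le> 3 * c"
        using partial_bound[OF p2 R(1) yR(1,2)[OF *(1,2)] *(3-5)] by (simp add: c_def D'_def l_def)
      thus "\<bar>?g s h i j / c\<bar> \<le> 3" using pos by (simp add: field_simps)
    next
      fix s t i j assume *: "a \<le> s" "s \<le> t" "t \<le> b" "i < n" "j < d"
      have "(\<Sum>h<n. ?g s h i j / c * (y t h / l - y s h / l)) = (\<Sum>h<n. ?g s h i j * (y t h - y s h)) / D'"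
        unfolding sum_divide_distrib using pos by (intro sum.cong) (auto simp: c_def field_simps)
      hence "\<bar>f (y t) i j / D' - f (y s) i j / D' - (\<Sum>h<n. ?g s h i j / c * (y t h / l - y s h / l))\<bar>
          = \<bar>f (y t) i j - f (y s) i j - (\<Sum>h<n. ?g s h i j * (y t h - y s h))\<bar> / D'"
        using pos by (simp flip: diff_divide_distrib)
      also have "\<dots> \<le> A (2 * R) * (\<Sum>k<n. \<bar>y t k - y s k\<bar>) powr \<beta> / D'"
        using * yR pos by (intro divide_right_mono coeff_taylor[OF p2 R2]) auto
      also have "\<dots> \<le> (\<Sum>k<n. \<bar>y t k / l - y s k / l\<bar>) powr (\<gamma> - 1)"
        unfolding dy using scale[OF S] by (simp add: \<beta>_eq)
      finally show "\<bar>f (y t) i j / D' - f (y s) i j / D' - (\<Sum>h<n. ?g s h i j / c * (y t h / l - y s h / l))\<bar>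
          \<le> (\<Sum>k<n. \<bar>y t k / l - y s k / l\<bar>) powr (\<gamma> - 1)" .
    next
      fix s t h i j assume *: "a \<le> s" "s \<le> t" "t \<le> b" "h < n" "i < n" "j < d"
      let ?S = "\<Sum>k<n. \<bar>y t k - y s k\<bar>"
      have \<beta>1: "0 \<le> \<beta> - 1" using p2 exponents \<beta>_eq by auto
      have "\<bar>?g t h i j - ?g s h i j\<bar> \<le> A (2 * R) * edist n (y t) (y s) powr (\<beta> - 1)"
        using * yR by (intro partial_hoelder[OF p2 R2]) auto
      also have "\<dots> \<le> A (2 * R) * ?S powr (\<beta> - 1)"
        using A_pos[OF R2] \<beta>1 edist_le_sum by (intro mult_left_mono powr_mono2) (auto simp: edist_def enorm_nonneg)
      finally have "\<bar>?g t h i j - ?g s h i j\<bar> / c \<le> A (2 * R) * ?S powr (\<beta> - 1) / c"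
        using pos by (intro divide_right_mono) auto
      also have "\<dots> = (A (2 * R) * l powr \<beta> / D') * (?S / l) powr (\<beta> - 1)"
        using pos S by (simp add: c_def powr_divide powr_diff mult_ac)
      also have "\<dots> \<le> 1 * (?S / l) powr (\<beta> - 1)" using Al pos by (intro mult_right_mono) auto
      finally show "\<bar>?g t h i j / c - ?g s h i j / c\<bar> \<le> (\<Sum>k<n. \<bar>y t k / l - y s k / l\<bar>) powr (\<gamma> - 2)"
        unfolding dy using pos by (simp add: \<beta>_eq flip: diff_divide_distrib)
    qed
  qed
  thus ?thesis unfolding dy l_def[symmetric] using pos by (simp add: field_simps)
qed

text \<open>Pieces of cost exactly \<open>h\<close> are cut off from the right, and each contributes
  at most a quarter of the length scale. The \<open>+ 1\<close> pays for the incomplete piece that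
  remains on the left.\<close>

lemma interval_displacement:
  assumes sol: "solves y0 y t1"
    and \<omega>: "driver_control T \<omega>" and ab: "0 \<le> a" "a \<le> b" "b \<le> t1" "b \<le> T"
    and R: "1 \<le> R" "\<And>t. a \<le> t \<Longrightarrow> t \<le> b \<Longrightarrow> enorm n (y t) \<le> R"
  defines "h \<equiv> step_radius * (osc (2 * R) / D (2 * R)) powr p"
  shows "(\<Sum>k<n. \<bar>y b k - y a k\<bar>) \<le> ((\<omega> b - \<omega> a) / h + 1) * (osc (2 * R) / 4)"
proof -
  define l where "l = osc (2 * R)"
  have R2: "1 \<le> 2 * R" using R by simp
  have h: "0 < h" and l: "0 < l"
    using step_radius_pos osc_pos[OF R2] D_pos[OF R2] by (auto simp: h_def l_def)
  have steps: "(\<Sum>k<n. \<bar>y u k - y a k\<bar>) \<le> (real m + 1) * (l / 4)"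
    if "a \<le> u" "u \<le> b" "\<omega> u - \<omega> a \<le> (real m + 1) * h" for m u
    using that
  proof (induction m arbitrary: u)
    case 0
    thus ?case
      using local_solution_displacement[OF sol \<omega> ab(1) 0(1) _ _ R(1)] ab R by (simp add: h_def l_def)
  next
    case (Suc m)
    show ?case
    proof (cases "\<omega> u - \<omega> a \<le> h")
      case True
      hence "(\<Sum>k<n. \<bar>y u k - y a k\<bar>) \<le> (real m + 1) * (l / 4)"
        using Suc.prems h by (intro Suc.IH) (auto intro: order_trans[OF True])
      also have "\<dots> \<le> (real (Suc m) + 1) * (l / 4)" using l by (intro mult_right_mono) auto
      finally show ?thesis .
    next
      case False
      have c: "continuous_on {a..u} \<omega>"
        using \<omega> ab Suc.prems unfolding driver_control_def control_def by (auto intro: continuous_on_subset)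
      obtain v where v: "a \<le> v" "v \<le> u" "\<omega> v = \<omega> u - h"
        using IVT'[of \<omega> a "\<omega> u - h" u, OF _ _ _ c] False h Suc.prems by auto
      have 1: "(\<Sum>k<n. \<bar>y v k - y a k\<bar>) \<le> (real m + 1) * (l / 4)"
        using Suc.prems v by (intro Suc.IH) (auto simp: algebra_simps)
      have 2: "(\<Sum>k<n. \<bar>y u k - y v k\<bar>) \<le> l / 4"
        unfolding l_def
        by (rule local_solution_displacement[OF sol \<omega> _ v(2) _ _ R(1)])
           (use ab R Suc.prems v in \<open>auto simp: h_def\<close>)
      have "(\<Sum>k<n. \<bar>y u k - y a k\<bar>) \<le> (\<Sum>k<n. \<bar>y u k - y v k\<bar> + \<bar>y v k - y a k\<bar>)"
        by (intro sum_mono) simp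
      also have "\<dots> \<le> l / 4 + (real m + 1) * (l / 4)"
        unfolding sum.distrib using 1 2 by (intro add_mono)
      also have "\<dots> = (real (Suc m) + 1) * (l / 4)"
        by (simp only: of_nat_Suc distrib_right mult_1 ac_simps)
      finally show ?thesis .
    qed
  qed
  have mono: "\<omega> a \<le> \<omega> b"
    using \<omega> ab unfolding driver_control_def control_def mono_on_def by auto
  define m where "m = nat \<lfloor>(\<omega> b - \<omega> a) / h\<rfloor>"
  have "0 \<le> (\<omega> b - \<omega> a) / h" using mono h by simp
  hence m: "(\<omega> b - \<omega> a) / h \<le> real m + 1" "real m \<le> (\<omega> b - \<omega> a) / h"
    unfolding m_def by linarith+
  have "(\<Sum>k<n. \<bar>y b k - y a k\<bar>) \<le> (real m + 1) * (l / 4)"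
    using m(1) h ab by (intro steps) (auto simp: field_simps)
  also have "\<dots> \<le> ((\<omega> b - \<omega> a) / h + 1) * (l / 4)"
    using m(2) l by (intro mult_right_mono) auto
  finally show ?thesis by (simp add: l_def)
qed

text \<open>The incomplete piece explains at most \<open>R / 4\<close> of a displacement of
  \<open>R / 2\<close>, so the remaining displacement uses a cost of at least
  \<open>R * (h / l)\<close>. The ratio \<open>h / l\<close> is a multiple of the density, and
  \<open>2 powr (1 - p)\<close> stems from the factor 1/2 in \<open>osc\<close>.\<close>

lemma crossing_cost:
  assumes sol: "solves y0 y t1"
    and \<omega>: "driver_control T \<omega>" and ab: "0 \<le> a" "a \<le> b" "b \<le> t1" "b \<le> T"
    and R: "1 \<le> R" "\<And>t. a \<le> t \<Longrightarrow> t \<le> b \<Longrightarrow> enorm n (y t) \<le> R"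
    and cross: "R / 2 \<le> enorm n (y b) - enorm n (y a)"
  shows "step_radius * 2 powr (1 - p) * (R * growth_density p \<beta> D A (2 * R)) \<le> \<omega> b - \<omega> a"
proof -
  define l where "l = osc (2 * R)"
  define D' where "D' = D (2 * R)"
  define A' where "A' = A (2 * R)"
  define h where "h = step_radius * (l / D') powr p"
  have R2: "1 \<le> 2 * R" using R by simp
  have pos: "0 < l" "0 < D'" "0 < A'" "0 < h"
    using step_radius_pos osc_pos[OF R2] D_pos[OF R2] A_pos[OF R2]
    by (auto simp: l_def D'_def h_def A'_def)
  have lR: "l \<le> R" using osc_le[OF R2] by (simp add: l_def)
  have "R / 2 \<le> edist n (y b) (y a)" using cross enorm_diff_le[of n "y b" "y a"] by linarith
  also have "\<dots> \<le> (\<Sum>k<n. \<bar>y b k - y a k\<bar>)" by (rule edist_le_sum)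
  also have "\<dots> \<le> ((\<omega> b - \<omega> a) / h + 1) * (l / 4)"
    unfolding h_def l_def D'_def by (rule interval_displacement[OF sol \<omega> ab R])
  also have "\<dots> = (\<omega> b - \<omega> a) * l / (4 * h) + l / 4" unfolding distrib_right by simp
  finally have "R / 2 \<le> (\<omega> b - \<omega> a) * l / (4 * h) + l / 4" .
  hence "R / 4 \<le> (\<omega> b - \<omega> a) * l / (4 * h)" using lR by linarith
  hence W: "R * (h / l) \<le> \<omega> b - \<omega> a" using pos by (simp add: field_simps)
  have "h / l = step_radius * (l powr (p - 1) * D' powr (- p))"
    using pos by (simp add: h_def powr_divide powr_diff powr_minus_divide)
  also have "l powr (p - 1) = 2 powr (1 - p) * (D' / A') powr ((p - 1) / \<beta>)"
  proof -
    have "l = (D' / A') powr (1 / \<beta>) / 2" by (simp add: l_def osc_def D'_def A'_def)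
    hence "l powr (p - 1) = ((D' / A') powr (1 / \<beta>)) powr (p - 1) / 2 powr (p - 1)"
      by (simp only: powr_divide)
    also have "\<dots> = (D' / A') powr ((p - 1) / \<beta>) * 2 powr (- (p - 1))"
      by (simp only: powr_powr powr_minus_divide) simp
    finally show ?thesis by simp
  qed
  also have "\<dots> * D' powr (- p) = 2 powr (1 - p) * growth_density p \<beta> D A (2 * R)"
  proof -
    have "(D' / A') powr ((p - 1) / \<beta>) = D' powr ((p - 1) / \<beta>) * A' powr ((1 - p) / \<beta>)"
      using pos powr_minus_divide[of A' "(p - 1) / \<beta>"] by (simp add: powr_divide minus_divide_left)
    moreover have "D' powr ((p - 1) / \<beta>) * D' powr (- p) = D' powr ((p - 1 - \<beta> * p) / \<beta>)"
      using \<beta>_pos by (simp add: diff_divide_distrib flip: powr_add)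
    moreover have "growth_density p \<beta> D A (2 * R) = A' powr ((1 - p) / \<beta>) * D' powr ((p - 1 - \<beta> * p) / \<beta>)"
      using pos by (simp add: growth_density_def A'_def D'_def powr_mult powr_powr)
    ultimately show ?thesis by (simp add: mult_ac)
  qed
  finally show ?thesis using W by (simp add: mult_ac)
qed

text \<open>The expansion on \<open>[s, t]\<close> has its coefficients at \<open>y s\<close>, so a
  bound at the left endpoint controls the whole increment, uniformly in \<open>s\<close>. This
  carries a bound on \<open>y\<close> beyond the time up to which it was known.\<close>

lemma solution_equicontinuous:
  assumes sol: "solves y0 y t1" and "0 < t1" and R: "1 \<le> R" and \<epsilon>: "0 < \<epsilon>"
  obtains \<delta> where "0 < \<delta>" "\<And>s t i. \<lbrakk>0 \<le> s; s \<le> t; t \<le> t1; t - s < \<delta>; enorm n (y s) \<le> R; i < n\<rbrakk> \<Longrightarrow>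
    \<bar>y t i - y s i\<bar> \<le> \<epsilon>"
proof -
  obtain \<omega> where \<omega>: "driver_control t1 \<omega>" using driver_control_exists[OF \<open>0 < t1\<close>] .
  obtain \<omega>' where \<omega>': "control t1 \<omega>'" and small:
    "\<And>\<eta>. 0 < \<eta> \<Longrightarrow> \<exists>\<delta>>0. \<forall>s u i. 0 \<le> s \<and> s \<le> u \<and> u \<le> t1 \<and> i < n \<and> \<omega>' u - \<omega>' s \<le> \<delta> \<longrightarrow>
       \<bar>err y i s u\<bar> \<le> \<eta> * (\<omega>' u - \<omega>' s)"
    using solution_small_error[OF sol] by metis
  obtain \<mu>' where \<mu>': "0 < \<mu>'" "\<And>s u i. 0 \<le> s \<Longrightarrow> s \<le> u \<Longrightarrow> u \<le> t1 \<Longrightarrow> i < n \<Longrightarrow> \<omega>' u - \<omega>' s \<le> \<mu>' \<Longrightarrow>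
       \<bar>err y i s u\<bar> \<le> 1 * (\<omega>' u - \<omega>' s)"
    using small[OF zero_less_one] by blast
  define P where "P = 3 * D (2 * R) / osc (2 * R)"
  define K where "K = real d * D R + real n * (real d * (real d * (D R * P)))"
  have R2: "1 \<le> 2 * R" using R by simp
  have P: "0 \<le> P" using osc_pos[OF R2] D_pos[OF R2] by (simp add: P_def)
  have K: "0 \<le> K" using P D_pos[OF R] by (simp add: K_def)
  \<comment> \<open>On short intervals signal and area increments will both be at most
    \<open>e\<close>. For the area this uses \<open>e powr p \<le> e powr (p / 2)\<close>, hence the
    minimum with 1.\<close>
  define e where "e = min 1 (\<epsilon> / (2 * (K + 1)))"
  have e: "0 < e" "e \<le> 1" "K * e \<le> \<epsilon> / 2"
  proof -
    show "0 < e" "e \<le> 1" using \<epsilon> K by (auto simp: e_def)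
    have half: "k * (\<epsilon> / (2 * k)) = \<epsilon> / 2" if "0 < k" for k using that by simp
    have "K * e \<le> (K + 1) * (\<epsilon> / (2 * (K + 1)))"
      using K \<open>0 < e\<close> unfolding e_def by (intro mult_mono min.cobounded2) auto
    also have "\<dots> = \<epsilon> / 2" using K by (intro half) simp
    finally show "K * e \<le> \<epsilon> / 2" .
  qed
  have uc: "uniformly_continuous_on {0..t1} \<omega>" "uniformly_continuous_on {0..t1} \<omega>'"
    using \<omega> \<omega>' by (simp_all add: driver_control_def control_def compact_uniformly_continuous)
  have ps: "0 < e powr p" "0 < min \<mu>' (\<epsilon> / 2)" using e \<epsilon> \<mu>'(1) by simp_all
  obtain \<delta>1 where
    \<delta>1: "0 < \<delta>1" "\<And>s t. s \<in> {0..t1} \<Longrightarrow> t \<in> {0..t1} \<Longrightarrow> dist t s < \<delta>1 \<Longrightarrow> dist (\<omega> t) (\<omega> s) < e powr p"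
    using uc(1)[unfolded uniformly_continuous_on_def, rule_format, OF ps(1)] by blast
  obtain \<delta>2 where
    \<delta>2: "0 < \<delta>2" "\<And>s t. s \<in> {0..t1} \<Longrightarrow> t \<in> {0..t1} \<Longrightarrow> dist t s < \<delta>2 \<Longrightarrow> dist (\<omega>' t) (\<omega>' s) < min \<mu>' (\<epsilon> / 2)"
    using uc(2)[unfolded uniformly_continuous_on_def, rule_format, OF ps(2)] by blast
  show ?thesis
  proof (rule that[of "min \<delta>1 \<delta>2"])
    show "0 < min \<delta>1 \<delta>2" using \<delta>1 \<delta>2 by simp
    fix s t i assume *: "0 \<le> s" "s \<le> t" "t \<le> t1" "t - s < min \<delta>1 \<delta>2" "enorm n (y s) \<le> R" "i < n"
    have yR: "y s \<in> Rn n" using sol * by (auto simp: solution_on_def Pi_iff)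
    have w: "\<omega> t - \<omega> s \<le> e powr p" using \<delta>1(2)[of s t] * by (auto simp: dist_real_def)
    have "\<bar>\<omega>' t - \<omega>' s\<bar> < min \<mu>' (\<epsilon> / 2)" using \<delta>2(2)[of s t] * by (auto simp: dist_real_def)
    hence w': "\<omega>' t - \<omega>' s \<le> \<mu>'" "\<omega>' t - \<omega>' s \<le> \<epsilon> / 2"
      unfolding min_less_iff_conj by linarith+
    have err: "\<bar>err y i s t\<bar> \<le> \<epsilon> / 2"
      using \<mu>'(2)[OF *(1-3,6) w'(1)] w'(2) by simp
    have x: "\<bar>x t j - x s j\<bar> \<le> e" if "j < d" for j
    proof (rule ccontr)
      assume "\<not> \<bar>x t j - x s j\<bar> \<le> e"
      hence "e powr p < \<bar>x t j - x s j\<bar> powr p" using e p_pos by (intro powr_less_mono2) auto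
      moreover have "\<bar>x t j - x s j\<bar> powr p \<le> \<omega> t - \<omega> s"
        using \<omega> * that unfolding driver_control_def by blast
      ultimately show False using w by simp
    qed
    have 1: "\<bar>\<Sum>j<d. f (y s) i j * (x t j - x s j)\<bar> \<le> real d * (D R * e)"
      using coeff_bound[OF R yR *(5,6)] x by (intro abs_sum_le abs_mult_le) auto
    have 2: "\<bar>second_order_term n d (f (y s)) (\<lambda>h i j. pd h i j (y s)) (\<lambda>r j. area r j s t) i\<bar>
        \<le> real n * (real d * (real d * (D R * P * e)))" if p2: "2 \<le> p"
    proof -
      have A: "\<bar>area r j s t\<bar> \<le> e" if "r < d" "j < d" for r j
      proof (rule ccontr)
        assume n: "\<not> \<bar>area r j s t\<bar> \<le> e"
        hence "e powr (p / 2) < \<bar>area r j s t\<bar> powr (p / 2)" using e p_pos by (intro powr_less_mono2) auto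
        moreover have "\<bar>area r j s t\<bar> powr (p / 2) \<le> \<omega> t - \<omega> s"
          using \<omega> * that p2 unfolding driver_control_def by blast
        moreover have "e powr p \<le> e powr (p / 2)" using e p_pos by (intro powr_mono') auto
        ultimately show False using w by simp
      qed
      show ?thesis unfolding second_order_term_def
        using coeff_bound[OF R yR *(5)] A partial_bound[OF p2 R yR *(5) _ *(6)]
        by (intro abs_sum_le abs_mult_le) (auto simp: P_def)
    qed
    have "\<bar>y t i - y s i\<bar> \<le> K * e + \<epsilon> / 2"
    proof (cases "p < 2")
      case True
      have "real d * (D R * e) \<le> K * e"
        using P e D_pos[OF R] by (simp add: K_def distrib_right)
      moreover have "\<bar>y t i - y s i - (\<Sum>j<d. f (y s) i j * (x t j - x s j))\<bar> \<le> \<epsilon> / 2"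
        using err True by (simp add: err_eq)
      ultimately show ?thesis using 1 by linarith
    next
      case False
      have "K * e = real d * (D R * e) + real n * (real d * (real d * (D R * P * e)))"
        by (simp add: K_def distrib_right)
      moreover have "\<bar>y t i - y s i - (\<Sum>j<d. f (y s) i j * (x t j - x s j))
          - second_order_term n d (f (y s)) (\<lambda>h i j. pd h i j (y s)) (\<lambda>r j. area r j s t) i\<bar> \<le> \<epsilon> / 2"
        using err False by (simp add: err_eq)
      moreover note 2
      ultimately show ?thesis using 1 False by linarith
    qed
    thus "\<bar>y t i - y s i\<bar> \<le> \<epsilon>" using e(3) by simp
  qed
qed

text \<open>The defining estimates make a solution right-continuous only: it could become unbounded before
  some \<open>t\<close> and restart from \<open>y t\<close>. Hence pass to the first time \<open>\<tau>\<close> before which \<open>y\<close> is unbounded.\<close>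

lemma explosion_reduction:
  assumes "explodes p n d f x area y0 y"
  obtains \<tau> where "0 < \<tau>" "\<And>t1. 0 < t1 \<Longrightarrow> t1 < \<tau> \<Longrightarrow> solves y0 y t1"
    "\<And>s. 0 \<le> s \<Longrightarrow> s < \<tau> \<Longrightarrow> \<exists>R. \<forall>t. 0 \<le> t \<and> t \<le> s \<longrightarrow> enorm n (y t) \<le> R"
    "\<And>R. \<exists>t. 0 \<le> t \<and> t < \<tau> \<and> R < enorm n (y t)"
proof -
  obtain T where T: "0 < T" "\<And>t1. 0 < t1 \<Longrightarrow> t1 < T \<Longrightarrow> solves y0 y t1"
    and lim: "filterlim (\<lambda>t. enorm n (y t)) at_top (at_left T)"
    using assms unfolding explodes_def by blast
  define bdd where "bdd s \<longleftrightarrow> (\<exists>R\<ge>1. \<forall>t. 0 \<le> t \<and> t \<le> s \<longrightarrow> enorm n (y t) \<le> R)" for s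
  \<comment> \<open>A bound on \<open>[0, s]\<close> persists slightly beyond \<open>s\<close>,
    because there each component moves by at most 1 from \<open>y s\<close>. So boundedness cannot
    stop at a time up to and including which it holds.\<close>
  have extend: "\<exists>s'>s. s' < T \<and> bdd s'" if s: "0 \<le> s" "s < T" "bdd s" for s
  proof -
    obtain R where R: "1 \<le> R" "\<And>t. 0 \<le> t \<Longrightarrow> t \<le> s \<Longrightarrow> enorm n (y t) \<le> R"
      using s(3) unfolding bdd_def by blast
    define t1 where "t1 = (s + T) / 2"
    have t1: "0 < t1" "t1 < T" "s < t1" using s by (auto simp: t1_def)
    obtain \<delta> where \<delta>: "0 < \<delta>" "\<And>s t i. \<lbrakk>0 \<le> s; s \<le> t; t \<le> t1; t - s < \<delta>; enorm n (y s) \<le> R; i < n\<rbrakk> \<Longrightarrow>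
        \<bar>y t i - y s i\<bar> \<le> 1"
      using solution_equicontinuous[OF T(2)[OF t1(1,2)] t1(1) R(1) zero_less_one] by metis
    define s' where "s' = min t1 (s + \<delta> / 2)"
    have s': "s < s'" "s' \<le> t1" "s' - s < \<delta>" using t1 \<delta>(1) by (auto simp: s'_def)
    have "enorm n (y t) \<le> R + real n" if t: "0 \<le> t" "t \<le> s'" for t
    proof (cases "t \<le> s")
      case True
      thus ?thesis using R(2)[OF t(1)] by simp
    next
      case False
      have "(\<Sum>i<n. \<bar>y t i - y s i\<bar>) \<le> (\<Sum>i<n. 1)"
        using \<delta>(2)[of s t] False s s' t R by (intro sum_mono) auto
      moreover have "enorm n (y t) - enorm n (y s) \<le> (\<Sum>i<n. \<bar>y t i - y s i\<bar>)"
        using enorm_diff_le edist_le_sum by (rule order_trans)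
      ultimately show ?thesis using R(2)[OF s(1)] by simp
    qed
    hence "bdd s'" using R(1) unfolding bdd_def by (intro exI[of _ "R + real n"]) auto
    thus ?thesis using s' t1 by (intro exI[of _ s']) auto
  qed
  have down: "bdd s" if "bdd s'" "s \<le> s'" for s s' using that unfolding bdd_def by (meson order_trans)
  define B where "B = {s. 0 \<le> s \<and> s < T \<and> bdd s}"
  have "bdd 0" unfolding bdd_def by (intro exI[of _ "max 1 (enorm n (y 0))"]) (auto dest: antisym)
  hence B0: "0 \<in> B" using T(1) by (simp add: B_def)
  have Bb: "bdd_above B" unfolding B_def by (intro bdd_aboveI[of _ T]) auto
  define \<tau> where "\<tau> = Sup B"
  have \<tau>T: "\<tau> \<le> T" unfolding \<tau>_def using B0 by (intro cSup_least) (auto simp: B_def)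
  have up: "s \<le> \<tau>" if "s \<in> B" for s unfolding \<tau>_def using that Bb by (rule cSup_upper)
  have inB: "bdd s" if s: "s < \<tau>" for s
  proof -
    obtain b where "b \<in> B" "s < b" using less_cSupD[of B s] B0 s unfolding \<tau>_def by auto
    thus ?thesis using down[of b s] by (simp add: B_def)
  qed
  have notin: "\<not> bdd \<tau>" if lt: "\<tau> < T"
  proof
    assume "bdd \<tau>"
    moreover have "0 \<le> \<tau>" using up[OF B0] .
    ultimately obtain s' where "\<tau> < s'" "s' \<in> B" using extend[of \<tau>] lt by (auto simp: B_def)
    thus False using up by fastforce
  qed
  show ?thesis
  proof (rule that[of \<tau>])
    obtain s' where "0 < s'" "s' \<in> B" using extend[of 0] B0 by (auto simp: B_def)
    thus "0 < \<tau>" using up by fastforce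
    show "solves y0 y t1" if "0 < t1" "t1 < \<tau>" for t1
      using T(2) that \<tau>T by simp
    show "\<exists>R. \<forall>t. 0 \<le> t \<and> t \<le> s \<longrightarrow> enorm n (y t) \<le> R" if "0 \<le> s" "s < \<tau>" for s
      using inB[OF that(2)] unfolding bdd_def by blast
    fix R
    show "\<exists>t. 0 \<le> t \<and> t < \<tau> \<and> R < enorm n (y t)"
    proof (rule ccontr)
      assume "\<not> (\<exists>t. 0 \<le> t \<and> t < \<tau> \<and> R < enorm n (y t))"
      hence le: "\<And>t. 0 \<le> t \<Longrightarrow> t < \<tau> \<Longrightarrow> enorm n (y t) \<le> R" by (meson not_less)
      \<comment> \<open>For \<open>\<tau> < T\<close>, a bound before \<open>\<tau>\<close> combined
        with the value at \<open>\<tau>\<close> would make \<open>\<tau>\<close> admissible. For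
        \<open>\<tau> = T\<close> it contradicts the divergence of the norm.\<close>
      show False
      proof (cases "\<tau> < T")
        case True
        have "bdd \<tau>" unfolding bdd_def
          using le by (intro exI[of _ "max 1 (max R (enorm n (y \<tau>)))"]) (auto simp: le_max_iff_disj, metis order_le_less)
        thus False using notin True by simp
      next
        case False
        hence "\<tau> = T" using \<tau>T by simp
        have "eventually (\<lambda>t. R < enorm n (y t)) (at_left T)"
          using lim by (simp add: filterlim_at_top_dense)
        moreover have "eventually (\<lambda>t. 0 < t \<and> t < T) (at_left T)"
          using eventually_at_left_field T(1) by (auto intro: exI[of _ 0])
        ultimately have "eventually (\<lambda>t. False) (at_left T)"
          by eventually_elim (use le \<open>\<tau> = T\<close> in \<open>auto simp: not_less[symmetric]\<close>)
        thus False by simp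
      qed
    qed
  qed
qed

text \<open>Under a bound on the whole interval, either of two nearby times can serve as the left
  endpoint in the equicontinuity estimate, so right continuity becomes two-sided.\<close>

lemma continuous_enorm_solution:
  assumes sol: "solves y0 y s" "0 < s" and R: "\<And>t. 0 \<le> t \<Longrightarrow> t \<le> s \<Longrightarrow> enorm n (y t) \<le> R"
  shows "continuous_on {0..s} (\<lambda>t. enorm n (y t))"
  unfolding continuous_on_iff
proof (intro ballI allI impI)
  fix t e :: real assume t: "t \<in> {0..s}" and e: "0 < e"
  define \<epsilon> where "\<epsilon> = e / (real n + 1)"
  have \<epsilon>: "0 < \<epsilon>" "real n * \<epsilon> < e" using e by (auto simp: \<epsilon>_def field_simps)
  have R': "1 \<le> max 1 R" by simp
  obtain \<delta> where \<delta>: "0 < \<delta>" "\<And>r t i. \<lbrakk>0 \<le> r; r \<le> t; t \<le> s; t - r < \<delta>; enorm n (y r) \<le> max 1 R; i < n\<rbrakk> \<Longrightarrow>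
        \<bar>y t i - y r i\<bar> \<le> \<epsilon>"
    using solution_equicontinuous[OF sol R' \<epsilon>(1)] by metis
  show "\<exists>\<delta>>0. \<forall>t'\<in>{0..s}. dist t' t < \<delta> \<longrightarrow> dist (enorm n (y t')) (enorm n (y t)) < e"
  proof (intro exI[of _ \<delta>] conjI ballI impI)
    fix t' assume t': "t' \<in> {0..s}" "dist t' t < \<delta>"
    have d: "\<bar>y t' i - y t i\<bar> \<le> \<epsilon>" if "i < n" for i
    proof (cases "t \<le> t'")
      case True
      thus ?thesis using \<delta>(2)[of t t' i] t t' that R[of t] by (auto simp: dist_real_def)
    next
      case False
      hence "\<bar>y t i - y t' i\<bar> \<le> \<epsilon>" using \<delta>(2)[of t' t i] t t' that R[of t'] by (auto simp: dist_real_def)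
      thus ?thesis by (simp add: abs_minus_commute)
    qed
    have "(\<Sum>i<n. \<bar>y t' i - y t i\<bar>) \<le> (\<Sum>i<n. \<epsilon>)" using d by (intro sum_mono) auto
    hence S: "(\<Sum>i<n. \<bar>y t' i - y t i\<bar>) < e" using \<epsilon>(2) by simp
    have "enorm n (y t') - enorm n (y t) \<le> (\<Sum>i<n. \<bar>y t' i - y t i\<bar>)"
      "enorm n (y t) - enorm n (y t') \<le> (\<Sum>i<n. \<bar>y t i - y t' i\<bar>)"
      by (rule order_trans[OF enorm_diff_le edist_le_sum])+
    thus "dist (enorm n (y t')) (enorm n (y t)) < e"
      using S by (simp add: dist_real_def abs_minus_commute)
  qed (use \<delta> in auto)
qed

lemma no_explosion:
  assumes inf: "growth_integral p \<beta> D A = \<infinity>"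
  shows "\<not> explodes p n d f x area y0 y"
proof
  assume "explodes p n d f x area y0 y"
  then obtain \<tau> where \<tau>: "0 < \<tau>" "\<And>t1. 0 < t1 \<Longrightarrow> t1 < \<tau> \<Longrightarrow> solves y0 y t1"
    and bdd: "\<And>s. 0 \<le> s \<Longrightarrow> s < \<tau> \<Longrightarrow> \<exists>R. \<forall>t. 0 \<le> t \<and> t \<le> s \<longrightarrow> enorm n (y t) \<le> R"
    and unb: "\<And>R. \<exists>t. 0 \<le> t \<and> t < \<tau> \<and> R < enorm n (y t)"
    using explosion_reduction by metis
  define N where "N t = enorm n (y t)" for t
  have cont: "continuous_on {0..s} N" if "0 < s" "s < \<tau>" for s
    using continuous_enorm_solution[OF \<tau>(2)[OF that] that(1)] bdd[of s] that unfolding N_def by auto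
  obtain k0 where k0: "N 0 < 2 ^ k0" using real_arch_pow[of 2 "N 0"] by auto
  define R where "R k = (2::real) ^ (k0 + k)" for k
  have R1: "1 \<le> R k" "N 0 \<le> R k" "R (Suc k) = 2 * R k" for k
  proof -
    have "(2::real) ^ k0 \<le> R k" unfolding R_def by (intro power_increasing) auto
    thus "N 0 \<le> R k" using k0 by simp
  qed (auto simp: R_def)
  have "\<exists>T. 0 \<le> T \<and> T < \<tau> \<and> N T = R k \<and> (\<forall>t. 0 \<le> t \<and> t \<le> T \<longrightarrow> N t \<le> R k)" for k
  proof -
    obtain t0 where t0: "0 \<le> t0" "t0 < \<tau>" "R k < N t0" using unb unfolding N_def by blast
    with R1(2)[of k] have "0 < t0" by (cases "t0 = 0") auto
    obtain T where "0 \<le> T" "T \<le> t0" "N T = R k" "\<And>t. 0 \<le> t \<Longrightarrow> t \<le> T \<Longrightarrow> N t \<le> R k"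
      by (rule first_hitting_time[OF cont[OF \<open>0 < t0\<close> t0(2)] t0(1) R1(2) less_imp_le[OF t0(3)]]) blast
    thus ?thesis using t0(2) by (intro exI[of _ T]) auto
  qed
  then obtain T where T: "\<And>k. 0 \<le> T k" "\<And>k. T k < \<tau>" "\<And>k. N (T k) = R k"
    "\<And>k t. 0 \<le> t \<Longrightarrow> t \<le> T k \<Longrightarrow> N t \<le> R k" by metis
  have Tmono: "T k \<le> T (Suc k)" for k
  proof (rule ccontr)
    assume "\<not> T k \<le> T (Suc k)"
    hence "N (T (Suc k)) \<le> R k" using T(1)[of "Suc k"] by (intro T(4)) auto
    thus False using T(3)[of "Suc k"] R1(1)[of k] R1(3)[of k] by simp
  qed
  \<comment> \<open>The driver lives on all of \<open>[0, \<infinity>)\<close>, so this control is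
    finite on \<open>[0, \<tau>]\<close>, endpoint included. All the infinitely many crossings
    before \<open>\<tau>\<close> have to share its total increment.\<close>
  obtain \<omega> where \<omega>: "driver_control \<tau> \<omega>" using driver_control_exists[OF \<tau>(1)] .
  define c where "c = step_radius * 2 powr (1 - p)"
  have c: "0 < c" using step_radius_pos by (simp add: c_def)
  have cost: "c * (R (Suc k) * growth_density p \<beta> D A (R (Suc (Suc k)))) \<le> \<omega> (T (Suc k)) - \<omega> (T k)" for k
  proof -
    define t1 where "t1 = (T (Suc k) + \<tau>) / 2"
    have t1: "0 < t1" "t1 < \<tau>" "T (Suc k) \<le> t1" using T(1,2)[of "Suc k"] \<tau>(1) by (auto simp: t1_def)
    have "step_radius * 2 powr (1 - p) * (R (Suc k) * growth_density p \<beta> D A (2 * R (Suc k))) \<le> \<omega> (T (Suc k)) - \<omega> (T k)"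
    proof (rule crossing_cost[OF \<tau>(2)[OF t1(1,2)] \<omega> T(1) Tmono t1(3) less_imp_le[OF T(2)] R1(1)])
      show "enorm n (y t) \<le> R (Suc k)" if "T k \<le> t" "t \<le> T (Suc k)" for t
        using T(4)[of t "Suc k"] T(1)[of k] that by (simp add: N_def)
      show "R (Suc k) / 2 \<le> enorm n (y (T (Suc k))) - enorm n (y (T k))"
        using T(3)[of k] T(3)[of "Suc k"] R1(3)[of k] by (simp add: N_def)
    qed
    thus ?thesis by (simp add: c_def R1(3))
  qed
  define F where "F k = 2 ^ k * growth_density p \<beta> D A (2 ^ k)" for k
  have F: "0 \<le> F k" for k by (simp add: F_def growth_density_def)
  \<comment> \<open>The crossing up to \<open>R (Suc k)\<close> is charged at the doubled radius
    \<open>R (Suc (Suc k))\<close>. This explains the shift by \<open>k0 + 2\<close> and the factor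
    2.\<close>
  have FR: "F (k + (k0 + 2)) = 2 * (R (Suc k) * growth_density p \<beta> D A (R (Suc (Suc k))))" for k
    by (simp add: F_def R_def add_ac)
  have "summable (\<lambda>k. F (k + (k0 + 2)))"
  proof (rule summableI_nonneg_bounded)
    fix K
    have "c * (\<Sum>k<K. F (k + (k0 + 2))) = 2 * (\<Sum>k<K. c * (R (Suc k) * growth_density p \<beta> D A (R (Suc (Suc k)))))"
      unfolding FR by (simp add: sum_distrib_left mult_ac)
    also have "\<dots> \<le> 2 * (\<Sum>k<K. \<omega> (T (Suc k)) - \<omega> (T k))"
      using cost by (intro mult_left_mono sum_mono) auto
    also have "(\<Sum>k<K. \<omega> (T (Suc k)) - \<omega> (T k)) = \<omega> (T K) - \<omega> (T 0)"
      by (rule sum_lessThan_telescope)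
    also have "\<dots> \<le> \<omega> \<tau> - \<omega> 0"
      using \<omega> T(1,2)[of K] T(1,2)[of 0] \<tau>(1) unfolding driver_control_def control_def mono_on_def
      by (intro diff_mono) auto
    finally show "(\<Sum>k<K. F (k + (k0 + 2))) \<le> 2 * (\<omega> \<tau> - \<omega> 0) / c"
      using c by (simp add: field_simps)
  qed (rule F)
  hence "summable F" by (simp only: summable_iff_shift)
  hence "(\<integral>\<^sup>+ r\<in>{1..}. ennreal (growth_density p \<beta> D A r) \<partial>lborel) < \<infinity>"
  proof (intro nn_integral_dyadic_le)
    have "p - 1 < \<beta> * p"
    proof -
      have "(p - 1) * 1 < \<beta> * p" using exponents \<beta>_eq by (intro mult_strict_mono) auto
      thus ?thesis by simp
    qed
    thus "\<And>r s. 1 \<le> r \<Longrightarrow> r \<le> s \<Longrightarrow> growth_density p \<beta> D A s \<le> growth_density p \<beta> D A r"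
      using growth_density_antimono[OF growth p_gt1 \<beta>_pos] by blast
  qed (auto simp: F_def[abs_def] growth_density_def)
  thus False using inf unfolding growth_integral_def growth_density_def by simp
qed

end

section \<open>Steps, bumps and tents\<close>

text \<open>The fractions \<open>y / x\<close> and \<open>(x - y) / x\<close> add up to 1, and
  \<open>t \<le> t powr b\<close> holds on the unit interval.\<close>

lemma powr_diff_le:
  fixes x y b :: real
  assumes "0 \<le> y" "y \<le> x" "0 < b" "b \<le> 1"
  shows "x powr b - y powr b \<le> (x - y) powr b"
proof (cases "x = 0")
  case False
  hence x: "0 < x" using assms by simp
  have sub: "t \<le> t powr b" if "0 \<le> t" "t \<le> 1" for t :: real
    using powr_mono'[of b 1 t] that assms by simp
  have "x powr b = x powr b * (y / x + (x - y) / x)" using x by (simp flip: add_divide_distrib)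
  also have "\<dots> \<le> x powr b * ((y / x) powr b + ((x - y) / x) powr b)"
    using assms x by (intro mult_left_mono add_mono sub) auto
  also have "\<dots> = y powr b + (x - y) powr b"
    using assms x by (simp add: powr_divide distrib_left)
  finally show ?thesis by simp
qed (use assms in auto)

lemma abs_powr_diff_le:
  fixes x y b :: real
  assumes "0 \<le> x" "0 \<le> y" "0 < b" "b \<le> 1"
  shows "\<bar>x powr b - y powr b\<bar> \<le> \<bar>x - y\<bar> powr b"
proof (cases "y \<le> x")
  case True
  thus ?thesis using powr_diff_le[of y x b] powr_mono2[of b y x] assms by simp
next
  case False
  thus ?thesis using powr_diff_le[of x y b] powr_mono2[of b x y] assms by simp
qed

text \<open>This is the distance of \<open>u\<close> from the complement of the open unit interval.
  Its powers with exponent below 1 fail to be Lipschitz at 0 and 1, where uniqueness is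
  lost.\<close>

definition hat :: "real \<Rightarrow> real"
  where "hat u = max 0 (min u (1 - u))"

lemma hat_nonneg: "0 \<le> hat u" and hat_le: "hat u \<le> 1 / 2"
  and hat_outside: "u \<le> 0 \<or> 1 \<le> u \<Longrightarrow> hat u = 0"
  by (auto simp: hat_def max_def min_def)

lemma hat_powr_hoelder:
  assumes "0 < b" "b \<le> 1"
  shows "\<bar>hat u powr b - hat v powr b\<bar> \<le> \<bar>u - v\<bar> powr b"
proof -
  have "\<bar>hat u powr b - hat v powr b\<bar> \<le> \<bar>hat u - hat v\<bar> powr b"
    using assms by (intro abs_powr_diff_le hat_nonneg)
  also have "\<dots> \<le> \<bar>u - v\<bar> powr b" using assms by (intro powr_mono2) (auto simp: hat_def)
  finally show ?thesis .
qed

text \<open>A continuously differentiable step from \<open>0\<close> to \<open>1\<close>. It solves the autonomous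
  equation \<open>z' = c * hat z powr (1 - 1 / \<mu>)\<close> and leaves the equilibrium \<open>0\<close>, which is possible
  because the right-hand side is only Hoelder continuous.\<close>

definition cstep :: "real \<Rightarrow> real \<Rightarrow> real"
  where "cstep \<mu> u = (if u \<le> 1 / 2 then 2 powr (\<mu> - 1) * max 0 u powr \<mu>
    else 1 - 2 powr (\<mu> - 1) * max 0 (1 - u) powr \<mu>)"

lemma has_real_derivative_glue:
  fixes g h :: "real \<Rightarrow> real"
  assumes g: "(g has_real_derivative D) (at c)" and h: "(h has_real_derivative D) (at c)" and eq: "g c = h c"
  shows "((\<lambda>x. if x \<le> c then g x else h x) has_real_derivative D) (at c)"
  unfolding has_field_derivative_iff filterlim_at_split
proof
  let ?f = "\<lambda>x. if x \<le> c then g x else h x"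
  have l: "((\<lambda>y. (g y - g c) / (y - c)) \<longlongrightarrow> D) (at_left c)" and r: "((\<lambda>y. (h y - h c) / (y - c)) \<longlongrightarrow> D) (at_right c)"
    using g h unfolding has_field_derivative_iff filterlim_at_split by auto
  have "eventually (\<lambda>y. y < c) (at_left c)" "eventually (\<lambda>y. c < y) (at_right c)"
    by (simp_all add: eventually_at_filter)
  hence el: "eventually (\<lambda>y. (g y - g c) / (y - c) = (?f y - ?f c) / (y - c)) (at_left c)"
    and er: "eventually (\<lambda>y. (h y - h c) / (y - c) = (?f y - ?f c) / (y - c)) (at_right c)"
    by (auto elim!: eventually_mono simp: eq)
  show "((\<lambda>y. (?f y - ?f c) / (y - c)) \<longlongrightarrow> D) (at_left c)"
    by (rule Lim_transform_eventually[OF l el])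
  show "((\<lambda>y. (?f y - ?f c) / (y - c)) \<longlongrightarrow> D) (at_right c)"
    by (rule Lim_transform_eventually[OF r er])
qed

lemma has_real_derivative_pos_part_powr:
  fixes \<mu> :: real
  assumes "1 < \<mu>"
  shows "((\<lambda>u. max 0 u powr \<mu>) has_real_derivative \<mu> * max 0 u powr (\<mu> - 1)) (at u)"
proof -
  consider "u < 0" | "0 < u" | "u = 0" by linarith
  thus ?thesis
  proof cases
    case 1
    have "((\<lambda>_. 0) has_real_derivative 0) (at u)" by simp
    hence "((\<lambda>u. max 0 u powr \<mu>) has_real_derivative 0) (at u)"
      by (rule has_field_derivative_transform_within_open[of _ _ _ "{..<0}"]) (use 1 in auto)
    thus ?thesis using 1 by simp
  next
    case 2
    have "((\<lambda>u. u powr \<mu>) has_real_derivative \<mu> * u powr (\<mu> - 1)) (at u)"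
      using 2 by (rule has_real_derivative_powr)
    hence "((\<lambda>u. max 0 u powr \<mu>) has_real_derivative \<mu> * u powr (\<mu> - 1)) (at u)"
      by (rule has_field_derivative_transform_within_open[of _ _ _ "{0<..}"]) (use 2 in auto)
    thus ?thesis using 2 by simp
  next
    case 3
    have "((\<lambda>u. max 0 u powr \<mu>) has_real_derivative 0) (at 0)"
      unfolding has_field_derivative_def has_derivative_at_alt
    proof (intro conjI allI impI)
      fix e :: real assume e: "0 < e"
      show "\<exists>d>0. \<forall>h. norm (h - 0) < d \<longrightarrow> norm (max 0 h powr \<mu> - max 0 0 powr \<mu> - 0 * (h - 0)) \<le> e * norm (h - 0)"
      proof (intro exI[of _ "e powr (1 / (\<mu> - 1))"] conjI allI impI)
        fix h :: real assume h: "norm (h - 0) < e powr (1 / (\<mu> - 1))"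
        show "norm (max 0 h powr \<mu> - max 0 0 powr \<mu> - 0 * (h - 0)) \<le> e * norm (h - 0)"
        proof (cases "0 < h")
          case True
          have "h powr (\<mu> - 1) \<le> (e powr (1 / (\<mu> - 1))) powr (\<mu> - 1)"
            using h True assms by (intro powr_mono2) auto
          also have "\<dots> = e" using assms e by (simp add: powr_powr)
          finally have "h powr (\<mu> - 1) * h \<le> e * h" using True by simp
          thus ?thesis using True by (simp add: powr_diff)
        qed (use e in \<open>auto simp: mult_le_0_iff\<close>)
      qed (use e in auto)
    qed (rule bounded_linear_mult_right)
    thus ?thesis using 3 by simp
  qed
qed

lemma cstep_has_derivative:
  assumes "1 < \<mu>"
  shows "(cstep \<mu> has_real_derivative \<mu> * 2 powr (\<mu> - 1) * hat u powr (\<mu> - 1)) (at u)"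
proof -
  let ?g = "\<lambda>u. 2 powr (\<mu> - 1) * max 0 u powr \<mu>" and ?h = "\<lambda>u. 1 - 2 powr (\<mu> - 1) * max 0 (1 - u) powr \<mu>"
  have g: "(?g has_real_derivative \<mu> * 2 powr (\<mu> - 1) * max 0 u powr (\<mu> - 1)) (at u)" for u
    using DERIV_cmult[OF has_real_derivative_pos_part_powr[OF assms], of "2 powr (\<mu> - 1)" u] by (simp add: mult_ac)
  have h: "(?h has_real_derivative \<mu> * 2 powr (\<mu> - 1) * max 0 (1 - u) powr (\<mu> - 1)) (at u)" for u
  proof -
    have "((\<lambda>u. ?g (1 - u)) has_real_derivative \<mu> * 2 powr (\<mu> - 1) * max 0 (1 - u) powr (\<mu> - 1) * (- 1)) (at u)"
      by (rule DERIV_chain2[OF g]) (auto intro!: derivative_eq_intros)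
    from DERIV_diff[OF DERIV_const[of 1] this] show ?thesis by simp
  qed
  have c: "cstep \<mu> = (\<lambda>u. if u \<le> 1 / 2 then ?g u else ?h u)" by (auto simp: cstep_def)
  consider "u < 1 / 2" | "1 / 2 < u" | "u = 1 / 2" by linarith
  thus ?thesis
  proof cases
    case 1
    have "(cstep \<mu> has_real_derivative \<mu> * 2 powr (\<mu> - 1) * max 0 u powr (\<mu> - 1)) (at u)"
      by (rule has_field_derivative_transform_within_open[OF g, of "{..<1/2}"]) (use 1 in \<open>auto simp: cstep_def\<close>)
    thus ?thesis using 1 by (simp add: hat_def)
  next
    case 2
    have "(cstep \<mu> has_real_derivative \<mu> * 2 powr (\<mu> - 1) * max 0 (1 - u) powr (\<mu> - 1)) (at u)"
      by (rule has_field_derivative_transform_within_open[OF h, of "{1/2<..}"]) (use 2 in \<open>auto simp: cstep_def\<close>)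
    thus ?thesis using 2 by (simp add: hat_def)
  next
    case 3
    have "2 powr (\<mu> - 1) * (1 / 2) powr \<mu> = 1 / 2" by (simp add: powr_diff powr_divide)
    thus ?thesis unfolding c 3
      using g[of "1/2"] h[of "1/2"] by (intro has_real_derivative_glue) (simp_all add: hat_def)
  qed
qed

lemma two_powr_mult_half:
  fixes u \<mu> :: real
  assumes "0 \<le> u" "u \<le> 1 / 2" "0 < \<mu>"
  shows "2 powr (\<mu> - 1) * u powr \<mu> \<le> 1 / 2"
proof -
  have "u powr \<mu> \<le> (1 / 2) powr \<mu>" using assms by (intro powr_mono2) auto
  hence "2 powr (\<mu> - 1) * u powr \<mu> \<le> 2 powr (\<mu> - 1) * (1 / 2) powr \<mu>" by (intro mult_left_mono) auto
  also have "\<dots> = 1 / 2" by (simp add: powr_diff powr_divide)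
  finally show ?thesis .
qed

lemma cstep_le_0: "u \<le> 0 \<Longrightarrow> cstep \<mu> u = 0" and cstep_ge_1: "1 \<le> u \<Longrightarrow> cstep \<mu> u = 1"
  by (auto simp: cstep_def)

text \<open>The two halves of \<open>cstep\<close> are mirror images, and each stays on its own side
  of \<open>1 / 2\<close>, so the distance to the nearer endpoint is the power itself.\<close>

lemma hat_cstep:
  assumes "0 < \<mu>"
  shows "hat (cstep \<mu> u) = 2 powr (\<mu> - 1) * hat u powr \<mu>"
proof -
  consider "u \<le> 0" | "0 \<le> u" "u \<le> 1 / 2" | "1 / 2 < u" "u \<le> 1" | "1 \<le> u" by linarith
  thus ?thesis
  proof cases
    case 2
    thus ?thesis using two_powr_mult_half[of u \<mu>] assms by (simp add: hat_def cstep_def)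
  next
    case 3
    thus ?thesis using two_powr_mult_half[of "1 - u" \<mu>] assms by (simp add: hat_def cstep_def)
  qed (auto simp: cstep_le_0 cstep_ge_1 hat_outside)
qed

lemma cstep_bounds:
  assumes "0 < \<mu>"
  shows "0 \<le> cstep \<mu> u" "cstep \<mu> u \<le> 1"
proof -
  consider "u \<le> 0" | "0 \<le> u" "u \<le> 1 / 2" | "1 / 2 < u" "u \<le> 1" | "1 \<le> u" by linarith
  hence "0 \<le> cstep \<mu> u \<and> cstep \<mu> u \<le> 1"
  proof cases
    case 2
    thus ?thesis using two_powr_mult_half[of u \<mu>] assms by (simp add: cstep_def)
  next
    case 3
    thus ?thesis using two_powr_mult_half[of "1 - u" \<mu>] assms by (simp add: cstep_def)
  qed (auto simp: cstep_le_0 cstep_ge_1)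
  thus "0 \<le> cstep \<mu> u" "cstep \<mu> u \<le> 1" by auto
qed

text \<open>The left-hand side is the derivative of \<open>cstep m\<close>, the right-hand side the
  coefficient of a unit cell along the solution. The choice of \<open>m\<close> amounts to
  \<open>m * b = m - 1\<close>, which matches the exponents.\<close>

lemma cstep_equation:
  assumes "0 < b" "b < 1"
  defines "m \<equiv> 1 / (1 - b)"
  shows "m * 2 powr (m - 1) * hat u powr (m - 1) = m * 2 powr b * hat (cstep m u) powr b"
proof -
  have m: "0 < m" "m * b = m - 1" using assms by (auto simp: m_def field_simps)
  have "2 powr b * hat (cstep m u) powr b = 2 powr b * (2 powr ((m - 1) * b) * hat u powr (m * b))"
    unfolding hat_cstep[OF m(1)] by (simp add: powr_mult powr_powr hat_nonneg)
  also have "\<dots> = 2 powr (m * b) * hat u powr (m * b)"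
    by (simp add: left_diff_distrib flip: powr_add mult.assoc)
  finally show ?thesis unfolding m(2) by simp
qed

text \<open>The exceptional points will be the turning times of the signal.\<close>

lemma abs_diff_le_finite_exceptions:
  fixes \<phi> :: "real \<Rightarrow> real"
  assumes "finite E" "s \<le> t" "continuous_on {s..t} \<phi>" "0 \<le> M"
    and der: "\<And>r. s < r \<Longrightarrow> r < t \<Longrightarrow> r \<notin> E \<Longrightarrow> (\<phi> has_real_derivative \<phi>' r) (at r) \<and> \<bar>\<phi>' r\<bar> \<le> M"
  shows "\<bar>\<phi> t - \<phi> s\<bar> \<le> M * (t - s)"
proof -
  have "(\<phi>' has_integral \<phi> t - \<phi> s) {s..t}"
    using assms by (intro fundamental_theorem_of_calculus_interior_strong[of E])
      (auto simp flip: has_real_derivative_iff_has_vector_derivative)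
  hence "norm (\<phi> t - \<phi> s) \<le> M * measure lborel {s..t}"
    using assms by (intro has_integral_bound_real[of M "E \<union> {s, t}" \<phi>']) auto
  thus ?thesis using assms by simp
qed

section \<open>Profiles superposed on a grid of cells\<close>

definition superposition ::
  "(nat \<Rightarrow> real) \<Rightarrow> (nat \<Rightarrow> real) \<Rightarrow> (nat \<Rightarrow> real) \<Rightarrow> (real \<Rightarrow> real) \<Rightarrow> real \<Rightarrow> real"
  where "superposition e l w K x = (\<Sum>i. w i * K ((x - e i) / l i))"

locale grid =
  fixes e l :: "nat \<Rightarrow> real"
  assumes l_pos: "\<And>i. 0 < l i" and e_Suc: "\<And>i. e (Suc i) = e i + l i"
begin

lemma e_mono:
  assumes "i \<le> j"
  shows "e i \<le> e j"
  using assms by (induction rule: dec_induct) (simp_all add: e_Suc add_increasing2 less_imp_le l_pos)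

lemma cell_exists:
  assumes "e 0 \<le> x" "x < e N"
  obtains i where "i < N" "e i \<le> x" "x < e (Suc i)"
proof -
  define M where "M = (LEAST M. x < e M)"
  have M: "x < e M" "M \<le> N"
    unfolding M_def using assms(2) by (auto intro: LeastI Least_le)
  have "M \<noteq> 0" using M assms by (metis not_less)
  then obtain i where i: "M = Suc i" by (cases M) auto
  hence "\<not> x < e i" using not_less_Least[of i "\<lambda>M. x < e M"] by (simp add: M_def)
  thus ?thesis using that[of i] M i by auto
qed

text \<open>A profile vanishes to the left of its own cell, so the cells from \<open>e N\<close> on
  do not contribute at points up to \<open>e N\<close>, and the series is locally finite.\<close>

lemma superposition_eq_sum:
  assumes K: "\<And>u. u \<le> 0 \<Longrightarrow> K u = 0" and x: "x \<le> e N"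
  shows "superposition e l w K x = (\<Sum>i<N. w i * K ((x - e i) / l i))"
  unfolding superposition_def
proof (rule suminf_finite)
  fix i assume "i \<notin> {..<N}"
  hence "x - e i \<le> 0" using e_mono[of N i] x by simp
  hence "(x - e i) / l i \<le> 0" using l_pos[of i] by (simp add: divide_nonpos_pos)
  thus "w i * K ((x - e i) / l i) = 0" using K by simp
qed simp

text \<open>The value \<open>c\<close> of the profile past its cell is 0 for a bump and 1 for a
  step; in the latter case the completed cells contribute a partial sum.\<close>

lemma superposition_cell:
  assumes K: "\<And>u. u \<le> 0 \<Longrightarrow> K u = 0" and K1: "\<And>u. 1 \<le> u \<Longrightarrow> K u = c" and x: "e i \<le> x" "x \<le> e (Suc i)"
  shows "superposition e l w K x = c * (\<Sum>k<i. w k) + w i * K ((x - e i) / l i)"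
proof -
  have F: "w k * K ((x - e k) / l k) = c * w k" if "k < i" for k
  proof -
    have "e (Suc k) \<le> x" using e_mono[of "Suc k" i] that x by simp
    hence "1 \<le> (x - e k) / l k" using l_pos[of k] by (simp add: e_Suc)
    thus ?thesis using K1 by simp
  qed
  have "(\<Sum>k<i. w k * K ((x - e k) / l k)) = c * (\<Sum>k<i. w k)"
    unfolding sum_distrib_left using F by (intro sum.cong) auto
  thus ?thesis
    using superposition_eq_sum[of K x "Suc i" w, OF K x(2)] by simp
qed

lemma superposition_has_derivative:
  assumes K: "\<And>u. u \<le> 0 \<Longrightarrow> K u = 0" and K': "\<And>u. u \<le> 0 \<Longrightarrow> K' u = 0"
    and der: "\<And>u. (K has_real_derivative K' u) (at u)" and x: "x < e N"
  shows "(superposition e l w K has_real_derivative superposition e l (\<lambda>i. w i / l i) K' x) (at x)"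
proof -
  have "((\<lambda>x. \<Sum>i<N. w i * K ((x - e i) / l i)) has_real_derivative (\<Sum>i<N. w i / l i * K' ((x - e i) / l i))) (at x)"
  proof (rule DERIV_sum)
    fix i
    have "((\<lambda>x. K ((x - e i) / l i)) has_real_derivative K' ((x - e i) / l i) * (1 / l i)) (at x)"
      using l_pos[of i] by (intro DERIV_chain2[OF der]) (auto intro!: derivative_eq_intros)
    from DERIV_cmult[OF this, of "w i"]
    show "((\<lambda>x. w i * K ((x - e i) / l i)) has_real_derivative w i / l i * K' ((x - e i) / l i)) (at x)"
      by simp
  qed
  moreover have eq: "superposition e l w K z = (\<Sum>i<N. w i * K ((z - e i) / l i))" if "z < e N" for z
    using superposition_eq_sum[of K z N w, OF K] that by simp
  ultimately have "(superposition e l w K has_real_derivative (\<Sum>i<N. w i / l i * K' ((x - e i) / l i))) (at x)"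
    by (elim has_field_derivative_transform_within_open[of _ _ _ "{..<e N}"])
      (use x eq in auto)
  thus ?thesis using superposition_eq_sum[of K' x N, OF K'] x by simp
qed

lemma superposition_before:
  assumes K: "\<And>u. u \<le> 0 \<Longrightarrow> K u = 0" and x: "x \<le> e 0"
  shows "superposition e l w K x = 0"
  using superposition_eq_sum[of K x 0 w, OF K x] by simp

text \<open>This crude constant depends on \<open>N\<close>. It suffices for estimates on
  \<open>[0, t1]\<close>, where constants may degenerate as the explosion is approached; the bounds
  of (G) come from \<open>hoelder_glue\<close>.\<close>

lemma superposition_hat_hoelder:
  assumes b: "0 < b" "b \<le> 1"
  obtains C where "0 \<le> C" "\<And>x z. x \<le> e N \<Longrightarrow> z \<le> e N \<Longrightarrow>
    \<bar>superposition e l w (\<lambda>u. hat u powr b) x - superposition e l w (\<lambda>u. hat u powr b) z\<bar> \<le> C * \<bar>x - z\<bar> powr b"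
proof -
  define C where "C = (\<Sum>i<N. \<bar>w i\<bar> * (1 / l i) powr b)"
  have K: "\<And>u. u \<le> 0 \<Longrightarrow> hat u powr b = 0" by (simp add: hat_outside)
  show ?thesis
  proof (rule that[of C])
    show "0 \<le> C" unfolding C_def by (intro sum_nonneg) auto
    fix x z assume xz: "x \<le> e N" "z \<le> e N"
    have "\<bar>(\<Sum>i<N. w i * hat ((x - e i) / l i) powr b) - (\<Sum>i<N. w i * hat ((z - e i) / l i) powr b)\<bar>
        \<le> (\<Sum>i<N. \<bar>w i * hat ((x - e i) / l i) powr b - w i * hat ((z - e i) / l i) powr b\<bar>)"
      unfolding sum_subtractf[symmetric] by (rule sum_abs)
    also have "\<dots> \<le> (\<Sum>i<N. \<bar>w i\<bar> * (1 / l i) powr b * \<bar>x - z\<bar> powr b)"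
    proof (rule sum_mono)
      fix i
      have "\<bar>hat ((x - e i) / l i) powr b - hat ((z - e i) / l i) powr b\<bar> \<le> \<bar>(x - e i) / l i - (z - e i) / l i\<bar> powr b"
        by (rule hat_powr_hoelder[OF b])
      also have "(x - e i) / l i - (z - e i) / l i = 1 / l i * (x - z)" by (simp flip: diff_divide_distrib)
      also have "\<bar>1 / l i * (x - z)\<bar> powr b = (1 / l i) powr b * \<bar>x - z\<bar> powr b"
        using l_pos[of i] by (simp only: abs_mult powr_mult) simp
      finally have "\<bar>w i\<bar> * \<bar>hat ((x - e i) / l i) powr b - hat ((z - e i) / l i) powr b\<bar>
          \<le> \<bar>w i\<bar> * ((1 / l i) powr b * \<bar>x - z\<bar> powr b)" by (rule mult_left_mono) simp
      thus "\<bar>w i * hat ((x - e i) / l i) powr b - w i * hat ((z - e i) / l i) powr b\<bar>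
          \<le> \<bar>w i\<bar> * (1 / l i) powr b * \<bar>x - z\<bar> powr b"
        by (simp only: right_diff_distrib[symmetric] abs_mult mult.assoc)
    qed
    also have "\<dots> = C * \<bar>x - z\<bar> powr b" by (simp add: C_def sum_distrib_right)
    finally show "\<bar>superposition e l w (\<lambda>u. hat u powr b) x - superposition e l w (\<lambda>u. hat u powr b) z\<bar>
        \<le> C * \<bar>x - z\<bar> powr b"
      using superposition_eq_sum[of "\<lambda>u. hat u powr b", OF K] xz by simp
  qed
qed

end

text \<open>Height \<open>h\<close> and slope \<open>h powr (1 - q)\<close> give the half-width
  \<open>h powr q\<close>. A rise by \<open>h\<close> thus takes exactly the time that a modulus of
  continuity with exponent \<open>1 / q\<close> requires.\<close>

definition tent :: "real \<Rightarrow> real \<Rightarrow> real \<Rightarrow> real \<Rightarrow> real"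
  where "tent q h c t = max 0 (h - h powr (1 - q) * \<bar>t - c\<bar>)"

text \<open>Up to the half-width the slope gives the bound, beyond it the height does.\<close>

lemma tent_hoelder:
  assumes q: "1 \<le> q" and h: "0 < h"
  shows "tent q h c t \<le> tent q h c s + \<bar>t - s\<bar> powr (1 / q)"
proof (cases "\<bar>t - s\<bar> \<le> h powr q")
  case True
  have "h powr (1 - q) * \<bar>t - s\<bar> \<le> \<bar>t - s\<bar> powr (1 / q)"
  proof (cases "t = s")
    case False
    have "\<bar>t - s\<bar> powr (1 - 1 / q) \<le> (h powr q) powr (1 - 1 / q)"
      using True q by (intro powr_mono2) auto
    also have "\<dots> = h powr (q - 1)" using q by (simp add: powr_powr right_diff_distrib)
    finally have "h powr (1 - q) * \<bar>t - s\<bar> powr (1 - 1 / q) \<le> h powr (1 - q) * h powr (q - 1)"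
      by (intro mult_left_mono) auto
    also have "\<dots> = 1" using h by (simp flip: powr_add)
    finally have "h powr (1 - q) * \<bar>t - s\<bar> powr (1 - 1 / q) * \<bar>t - s\<bar> powr (1 / q) \<le> 1 * \<bar>t - s\<bar> powr (1 / q)"
      by (intro mult_right_mono) auto
    thus ?thesis using False by (simp add: mult.assoc flip: powr_add)
  qed simp
  moreover have "h powr (1 - q) * \<bar>s - c\<bar> \<le> h powr (1 - q) * (\<bar>t - c\<bar> + \<bar>t - s\<bar>)"
    by (intro mult_left_mono) auto
  ultimately show ?thesis by (auto simp: tent_def distrib_left)
next
  case False
  have "tent q h c t \<le> h" using h by (simp add: tent_def)
  also have "h = (h powr q) powr (1 / q)" using q h by (simp add: powr_powr)
  also have "\<dots> \<le> \<bar>t - s\<bar> powr (1 / q)" using False q by (intro powr_mono2) auto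
  finally show ?thesis by (simp add: tent_def)
qed

lemma tent_eq_0:
  assumes "0 < h" "h powr q \<le> \<bar>t - c\<bar>"
  shows "tent q h c t = 0"
proof -
  have "h powr (1 - q) * h powr q \<le> h powr (1 - q) * \<bar>t - c\<bar>" using assms by (intro mult_left_mono) auto
  thus ?thesis using assms by (simp add: tent_def flip: powr_add)
qed

text \<open>A supremum inherits a common modulus of continuity at once, independently of the number
  of tents. The modulus holds on the whole line, so the signal also continues past the explosion
  time.\<close>

definition tents :: "real \<Rightarrow> (nat \<Rightarrow> real) \<Rightarrow> (nat \<Rightarrow> real) \<Rightarrow> real \<Rightarrow> real"
  where "tents q h c t = (SUP j. tent q (h j) (c j) t)"

lemma tents_hoelder:
  assumes q: "1 \<le> q" and h: "\<And>j. 0 < h j" "\<And>j. h j \<le> M"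
  shows "\<bar>tents q h c t - tents q h c s\<bar> powr q \<le> \<bar>t - s\<bar>"
proof -
  have bdd: "bdd_above (range (\<lambda>j. tent q (h j) (c j) t))" for t
  proof (rule bdd_aboveI2)
    fix j
    have "0 \<le> h j powr (1 - q) * \<bar>t - c j\<bar>" by simp
    thus "tent q (h j) (c j) t \<le> M" using h(1)[of j] h(2)[of j] unfolding tent_def by linarith
  qed
  have le: "tents q h c t \<le> tents q h c s + \<bar>t - s\<bar> powr (1 / q)" for t s
    unfolding tents_def
  proof (rule cSUP_least)
    fix j
    have "tent q (h j) (c j) t \<le> tent q (h j) (c j) s + \<bar>t - s\<bar> powr (1 / q)"
      by (rule tent_hoelder[OF q h(1)])
    also have "tent q (h j) (c j) s \<le> (SUP j. tent q (h j) (c j) s)"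
      by (rule cSUP_upper[OF _ bdd]) simp
    finally show "tent q (h j) (c j) t \<le> (SUP j. tent q (h j) (c j) s) + \<bar>t - s\<bar> powr (1 / q)" by simp
  qed simp
  have "\<bar>tents q h c t - tents q h c s\<bar> \<le> \<bar>t - s\<bar> powr (1 / q)"
    using le[of t s] le[of s t] by (simp add: abs_minus_commute)
  hence "\<bar>tents q h c t - tents q h c s\<bar> powr q \<le> (\<bar>t - s\<bar> powr (1 / q)) powr q"
    using q by (intro powr_mono2) auto
  also have "\<dots> = \<bar>t - s\<bar>" using q by (simp add: powr_powr)
  finally show ?thesis .
qed

lemma tents_eq:
  assumes h: "\<And>j. 0 < h j" and far: "\<And>k. k \<noteq> j \<Longrightarrow> h k powr q \<le> \<bar>t - c k\<bar>"
  shows "tents q h c t = tent q (h j) (c j) t"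
proof -
  have "tent q (h k) (c k) t \<le> tent q (h j) (c j) t" for k
  proof (cases "k = j")
    case False
    thus ?thesis using tent_eq_0[OF h far[OF False]] by (simp add: tent_def)
  qed simp
  thus ?thesis unfolding tents_def by (intro cSup_eq_maximum) auto
qed

section \<open>An oscillating field and its exploding path\<close>

text \<open>The number \<open>\<epsilon> i\<close> is the change of the signal while the path
  crosses cell \<open>i\<close>, and \<open>\<epsilon> i powr q\<close> is the time this takes.
  Equal values within a pair let the signal return to 0 and become a row of tents.\<close>

locale oscillation = grid e l for e l :: "nat \<Rightarrow> real" +
  fixes q b :: real and \<epsilon> :: "nat \<Rightarrow> real"
  assumes q: "1 \<le> q" and b: "0 < b" "b < 1" and \<epsilon>_pos: "\<And>i. 0 < \<epsilon> i"
    and \<epsilon>_pair: "\<And>j. \<epsilon> (Suc (2 * j)) = \<epsilon> (2 * j)"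
    and e_lim: "filterlim e at_top sequentially"
    and \<epsilon>_summable: "summable (\<lambda>i. \<epsilon> i powr q)"
begin

definition m :: real where "m = 1 / (1 - b)"

text \<open>The constant \<open>m * 2 powr b\<close> is that of \<open>cstep_equation\<close>. The
  factor \<open>l i / \<epsilon> i\<close> lets a signal change of size \<open>\<epsilon> i\<close>
  move the path by \<open>l i\<close>.\<close>

definition field :: "real \<Rightarrow> real"
  where "field = superposition e l (\<lambda>i. (-1) ^ i * (l i / \<epsilon> i) * (m * 2 powr b)) (\<lambda>u. hat u powr b)"

definition \<delta> :: "nat \<Rightarrow> real" where "\<delta> i = \<epsilon> i powr q"
definition T :: "nat \<Rightarrow> real" where "T i = (\<Sum>k<i. \<delta> k)"
definition explosion_time :: real where "explosion_time = (\<Sum>i. \<delta> i)"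
definition path :: "real \<Rightarrow> real" where "path t = e 0 + superposition T \<delta> l (cstep m) t"
definition signal :: "real \<Rightarrow> real" where "signal = tents q (\<lambda>j. \<epsilon> (2 * j)) (\<lambda>j. T (Suc (2 * j)))"

lemma m_gt1: "1 < m"
  using b by (simp add: m_def field_simps)

lemma \<delta>_pos: "0 < \<delta> i"
  using \<epsilon>_pos[of i] by (simp add: \<delta>_def)

sublocale time: grid T \<delta>
  by standard (auto simp: \<delta>_pos T_def)

lemma T_0: "T 0 = 0"
  by (simp add: T_def)

lemma T_less: "T i < explosion_time"
  unfolding T_def explosion_time_def using \<epsilon>_summable \<delta>_pos
  by (intro sum_less_suminf) (auto simp: \<delta>_def[abs_def])

lemma T_exceeds:
  assumes "t < explosion_time"
  obtains N where "t < T N"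
proof -
  have "T \<longlonglongrightarrow> explosion_time"
    using summable_LIMSEQ[of \<delta>] \<epsilon>_summable unfolding T_def[abs_def] explosion_time_def \<delta>_def[abs_def] by blast
  hence "eventually (\<lambda>N. t < T N) sequentially" using assms by (rule order_tendstoD)
  thus ?thesis using that by (auto simp: eventually_sequentially)
qed

lemma explosion_time_pos: "0 < explosion_time"
  using T_less[of 0] by (simp add: T_0)

lemma path_cell:
  assumes "T i \<le> t" "t \<le> T (Suc i)"
  shows "path t = e i + l i * cstep m ((t - T i) / \<delta> i)"
proof -
  have "(\<Sum>k<i. l k) = e i - e 0" by (induction i) (auto simp: e_Suc)
  thus ?thesis
    using time.superposition_cell[of "cstep m" 1 i t l] assms
    by (simp add: path_def cstep_le_0 cstep_ge_1)
qed

lemma path_in_cell: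
  assumes "T i \<le> t" "t \<le> T (Suc i)"
  shows "e i \<le> path t" "path t \<le> e (Suc i)"
proof -
  have "0 \<le> l i * cstep m ((t - T i) / \<delta> i)" "l i * cstep m ((t - T i) / \<delta> i) \<le> l i * 1"
    using cstep_bounds[of m] m_gt1 l_pos[of i] by (auto intro!: mult_left_mono)
  thus "e i \<le> path t" "path t \<le> e (Suc i)" unfolding path_cell[OF assms] e_Suc by auto
qed

lemma path_0: "path 0 = e 0"
  using path_cell[of 0 0] T_0 \<delta>_pos[of 0] by (simp add: cstep_le_0 T_def)

lemma field_path:
  assumes "T i \<le> t" "t \<le> T (Suc i)"
  shows "field (path t) = (-1) ^ i * (l i / \<epsilon> i) * (m * 2 powr (m - 1) * hat ((t - T i) / \<delta> i) powr (m - 1))"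
proof -
  have "(path t - e i) / l i = cstep m ((t - T i) / \<delta> i)"
    using l_pos[of i] by (simp add: path_cell[OF assms])
  thus ?thesis
    unfolding field_def using cstep_equation[OF b, of "(t - T i) / \<delta> i"]
    by (subst superposition_cell[where c = 0 and i = i]) (auto simp: path_in_cell[OF assms] hat_outside m_def)
qed

text \<open>The slope \<open>\<epsilon> i powr (1 - q)\<close> of the signal times
  \<open>l i / \<epsilon> i\<close> is \<open>l i / \<delta> i\<close>, the mean speed across the
  cell. Both ends of the time cell are included, since the profile's derivative vanishes there and
  neighbouring cells agree.\<close>

lemma path_has_derivative:
  assumes "T i \<le> t" "t \<le> T (Suc i)"
  shows "(path has_real_derivative (-1) ^ i * \<epsilon> i powr (1 - q) * field (path t)) (at t)"
    and "0 \<le> (-1) ^ i * \<epsilon> i powr (1 - q) * field (path t)"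
    and "(-1) ^ i * \<epsilon> i powr (1 - q) * field (path t) \<le> l i / \<delta> i * (m * 2 powr (m - 1))"
proof -
  let ?K = "\<lambda>u. m * 2 powr (m - 1) * hat u powr (m - 1)"
  \<comment> \<open>One cell more than expected, because \<open>t\<close> may be the right end of
    its own cell.\<close>
  have lt: "t < T (Suc (Suc i))" using assms \<delta>_pos[of "Suc i"] by (simp add: T_def)
  have "(superposition T \<delta> l (cstep m) has_real_derivative superposition T \<delta> (\<lambda>i. l i / \<delta> i) ?K t) (at t)"
    by (rule time.superposition_has_derivative[OF _ _ cstep_has_derivative[OF m_gt1] lt])
      (auto simp: cstep_le_0 hat_outside)
  also have "superposition T \<delta> (\<lambda>i. l i / \<delta> i) ?K t = l i / \<delta> i * ?K ((t - T i) / \<delta> i)"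
    by (subst time.superposition_cell[where c = 0 and i = i]) (auto simp: assms hat_outside)
  finally have "(path has_real_derivative l i / \<delta> i * ?K ((t - T i) / \<delta> i)) (at t)"
    unfolding path_def[abs_def] by (auto intro!: derivative_eq_intros)
  moreover have eq: "(-1) ^ i * \<epsilon> i powr (1 - q) * field (path t) = l i / \<delta> i * ?K ((t - T i) / \<delta> i)"
  proof -
    have 1: "((-1) ^ i * (-1) ^ i :: real) = 1" by (simp flip: power_mult_distrib)
    have 2: "\<epsilon> i powr (1 - q) / \<epsilon> i = 1 / \<delta> i"
      using \<epsilon>_pos[of i] by (simp add: \<delta>_def powr_diff)
    have "\<sigma> * c * (\<sigma> * (l i / \<epsilon> i) * X) = (\<sigma> * \<sigma>) * (c / \<epsilon> i) * (l i * X)" for \<sigma> c X by simp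
    thus ?thesis unfolding field_path[OF assms] by (simp only: 1 2) simp
  qed
  ultimately show "(path has_real_derivative (-1) ^ i * \<epsilon> i powr (1 - q) * field (path t)) (at t)" by simp
  show "0 \<le> (-1) ^ i * \<epsilon> i powr (1 - q) * field (path t)"
    unfolding eq using m_gt1 l_pos[of i] \<delta>_pos[of i] by (intro mult_nonneg_nonneg) auto
  have "hat ((t - T i) / \<delta> i) powr (m - 1) \<le> 1"
    using m_gt1 hat_le[of "(t - T i) / \<delta> i"] hat_nonneg by (intro powr_le1) auto
  hence "?K ((t - T i) / \<delta> i) \<le> m * 2 powr (m - 1) * 1"
    using m_gt1 by (intro mult_left_mono) auto
  thus "(-1) ^ i * \<epsilon> i powr (1 - q) * field (path t) \<le> l i / \<delta> i * (m * 2 powr (m - 1))"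
    unfolding eq using l_pos[of i] \<delta>_pos[of i] by (intro mult_left_mono) auto
qed

lemma signal_hoelder: "\<bar>signal t - signal s\<bar> powr q \<le> \<bar>t - s\<bar>"
proof -
  obtain M where "\<And>i. norm (\<epsilon> i powr q) \<le> M"
    using summable_imp_Bseq[OF \<epsilon>_summable] by (auto simp: Bseq_def)
  hence M: "\<epsilon> i powr q \<le> M" for i by (metis abs_le_D1 real_norm_def)
  have "\<epsilon> i \<le> M powr (1 / q)" for i
  proof -
    have "\<epsilon> i = (\<epsilon> i powr q) powr (1 / q)" using q \<epsilon>_pos[of i] by (simp add: powr_powr)
    also have "\<dots> \<le> M powr (1 / q)" using M q by (intro powr_mono2) auto
    finally show ?thesis .
  qed
  thus ?thesis unfolding signal_def using q \<epsilon>_pos by (intro tents_hoelder) auto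
qed

lemma continuous_signal: "continuous_on X signal"
  unfolding continuous_on_iff
proof (intro ballI allI impI)
  fix t d :: real assume d: "0 < d"
  show "\<exists>r>0. \<forall>s\<in>X. dist s t < r \<longrightarrow> dist (signal s) (signal t) < d"
  proof (intro exI[of _ "d powr q"] conjI ballI impI)
    fix s assume "dist s t < d powr q"
    hence "\<bar>signal s - signal t\<bar> powr q < d powr q" using signal_hoelder[of s t] by (simp add: dist_real_def)
    thus "dist (signal s) (signal t) < d"
      using powr_mono2[of q d "\<bar>signal s - signal t\<bar>"] q d by (force simp: dist_real_def)
  qed (use d in auto)
qed

text \<open>The half-width of tent \<open>j\<close> is the duration of either cell of pair
  \<open>j\<close>, so the tents have disjoint interiors and only one is active.\<close>

lemma signal_cell:
  assumes t: "T (2 * j) \<le> t" "t \<le> T (Suc (Suc (2 * j)))"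
  shows "signal t = \<epsilon> (2 * j) - \<epsilon> (2 * j) powr (1 - q) * \<bar>t - T (Suc (2 * j))\<bar>"
proof -
  have \<delta>2: "\<delta> (Suc (2 * k)) = \<epsilon> (2 * k) powr q" "\<delta> (2 * k) = \<epsilon> (2 * k) powr q" for k
    by (simp_all add: \<delta>_def \<epsilon>_pair)
  have c: "T (Suc (2 * k)) = T (2 * k) + \<epsilon> (2 * k) powr q"
    "T (Suc (Suc (2 * k))) = T (Suc (2 * k)) + \<epsilon> (2 * k) powr q" for k
    by (simp_all add: T_def \<delta>2)
  have "signal t = tent q (\<epsilon> (2 * j)) (T (Suc (2 * j))) t"
    unfolding signal_def
  proof (rule tents_eq[OF \<epsilon>_pos])
    fix k assume "k \<noteq> j"
    then consider "k < j" | "j < k" by linarith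
    thus "\<epsilon> (2 * k) powr q \<le> \<bar>t - T (Suc (2 * k))\<bar>"
    proof cases
      case 1
      hence "T (Suc (Suc (2 * k))) \<le> T (2 * j)" by (intro time.e_mono) simp
      thus ?thesis using c[of k] t by simp
    next
      case 2
      hence "T (Suc (Suc (2 * j))) \<le> T (2 * k)" by (intro time.e_mono) simp
      thus ?thesis using c[of k] t by simp
    qed
  qed
  moreover have "\<bar>t - T (Suc (2 * j))\<bar> \<le> \<epsilon> (2 * j) powr q" using t c[of j] by (simp add: abs_le_iff)
  hence "\<epsilon> (2 * j) powr (1 - q) * \<bar>t - T (Suc (2 * j))\<bar> \<le> \<epsilon> (2 * j) powr (1 - q) * \<epsilon> (2 * j) powr q"
    by (intro mult_left_mono) auto
  hence "\<epsilon> (2 * j) powr (1 - q) * \<bar>t - T (Suc (2 * j))\<bar> \<le> \<epsilon> (2 * j)"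
    using \<epsilon>_pos[of "2 * j"] by (simp flip: powr_add)
  ultimately show ?thesis by (simp add: tent_def)
qed

lemma signal_has_derivative:
  assumes "T i < t" "t < T (Suc i)"
  shows "(signal has_real_derivative (-1) ^ i * \<epsilon> i powr (1 - q)) (at t)"
proof -
  define j where "j = i div 2"
  have der: "((\<lambda>t. \<epsilon> (2 * j) - \<epsilon> i powr (1 - q) * ((-1) ^ i * (T (Suc (2 * j)) - t)))
      has_real_derivative (-1) ^ i * \<epsilon> i powr (1 - q)) (at t)"
    by (auto intro!: derivative_eq_intros)
  have "signal s = \<epsilon> (2 * j) - \<epsilon> i powr (1 - q) * ((-1) ^ i * (T (Suc (2 * j)) - s))"
    if s: "s \<in> {T i<..<T (Suc i)}" for s
  proof -
    have "T (2 * j) \<le> s \<and> s \<le> T (Suc (Suc (2 * j))) \<and> \<epsilon> i = \<epsilon> (2 * j)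
      \<and> (-1) ^ i * (T (Suc (2 * j)) - s) = \<bar>s - T (Suc (2 * j))\<bar>"
    proof (cases "even i")
      case True
      hence i: "i = 2 * j" by (simp add: j_def)
      have "T (Suc i) \<le> T (Suc (Suc i))" by (intro time.e_mono) simp
      thus ?thesis using s unfolding i by simp
    next
      case False
      hence i: "i = Suc (2 * j)" by (simp add: j_def)
      have "T (2 * j) \<le> T i" unfolding i by (intro time.e_mono) simp
      thus ?thesis using s \<epsilon>_pair[of j] unfolding i by simp
    qed
    hence *: "T (2 * j) \<le> s" "s \<le> T (Suc (Suc (2 * j)))" and e: "\<epsilon> i = \<epsilon> (2 * j)"
      and sg: "(-1) ^ i * (T (Suc (2 * j)) - s) = \<bar>s - T (Suc (2 * j))\<bar>" by blast+
    show ?thesis unfolding e sg by (rule signal_cell[OF *])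
  qed
  thus ?thesis
    using assms by (intro has_field_derivative_transform_within_open[OF der, of "{T i<..<T (Suc i)}"]) auto
qed

lemma path_ge:
  assumes "T N \<le> t" "t < explosion_time"
  shows "e N \<le> path t"
proof -
  obtain M where "t < T M" using T_exceeds[OF assms(2)] .
  moreover have "T 0 \<le> t" using time.e_mono[of 0 N] assms by simp
  ultimately obtain i where i: "T i \<le> t" "t < T (Suc i)" using time.cell_exists by metis
  have "N \<le> i"
  proof (rule ccontr)
    assume "\<not> N \<le> i"
    hence "T (Suc i) \<le> T N" by (intro time.e_mono) simp
    thus False using i assms by simp
  qed
  thus ?thesis using e_mono[of N i] path_in_cell(1)[of i t] i by simp
qed

lemma path_explodes: "filterlim path at_top (at_left explosion_time)"
  unfolding filterlim_at_top
proof
  fix Z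
  obtain N where "Z \<le> e N"
    using e_lim unfolding filterlim_at_top eventually_sequentially by blast
  thus "eventually (\<lambda>t. Z \<le> path t) (at_left explosion_time)"
    unfolding eventually_at_left_field using T_less[of N] path_ge[of N]
    by (intro exI[of _ "T N"]) (auto intro: order_trans)
qed

text \<open>With the coefficient frozen at \<open>path s\<close>, the difference
  \<open>path r - G * signal r\<close> has, off the turning times, a derivative proportional to
  \<open>field (path r) - G\<close>. This is of order \<open>(t - s) powr b\<close>, since the path
  is Lipschitz and the field Hoelder. The constant depends on \<open>t1\<close>, as the definition
  of a solution allows.\<close>

lemma path_increment:
  assumes "t1 < explosion_time"
  obtains C where "0 \<le> C" "\<And>s t. 0 \<le> s \<Longrightarrow> s \<le> t \<Longrightarrow> t \<le> t1 \<Longrightarrow>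
    \<bar>path t - path s - field (path s) * (signal t - signal s)\<bar> \<le> C * (t - s) powr (1 + b)"
proof -
  obtain N where N: "t1 < T N" using T_exceeds[OF assms] .
  have cell: "\<exists>i<N. T i \<le> r \<and> r < T (Suc i)" if "0 \<le> r" "r \<le> t1" for r
    using time.cell_exists[of r N] that N by (metis T_0 order_le_less_trans)
  define \<Lambda> where "\<Lambda> = (\<Sum>i<N. l i / \<delta> i * (m * 2 powr (m - 1)))"
  define S where "S = (\<Sum>i<N. \<epsilon> i powr (1 - q))"
  have nn: "0 \<le> l i / \<delta> i * (m * 2 powr (m - 1))" for i
    using m_gt1 l_pos[of i] \<delta>_pos[of i] by simp
  have \<Lambda>: "0 \<le> \<Lambda>" "\<And>i. i < N \<Longrightarrow> l i / \<delta> i * (m * 2 powr (m - 1)) \<le> \<Lambda>"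
    unfolding \<Lambda>_def using nn by (simp add: sum_nonneg, intro member_le_sum) simp_all
  have S: "0 \<le> S" "\<And>i. i < N \<Longrightarrow> \<epsilon> i powr (1 - q) \<le> S"
    unfolding S_def by (simp add: sum_nonneg, intro member_le_sum) simp_all
  obtain K where K: "0 \<le> K" "\<And>x z. x \<le> e N \<Longrightarrow> z \<le> e N \<Longrightarrow> \<bar>field x - field z\<bar> \<le> K * \<bar>x - z\<bar> powr b"
    unfolding field_def by (rule superposition_hat_hoelder[OF b(1) less_imp_le[OF b(2)]]) blast
  obtain c where c: "\<And>r. 0 \<le> r \<Longrightarrow> r \<le> t1 \<Longrightarrow> c r < N"
    "\<And>r. 0 \<le> r \<Longrightarrow> r \<le> t1 \<Longrightarrow> T (c r) \<le> r" "\<And>r. 0 \<le> r \<Longrightarrow> r \<le> t1 \<Longrightarrow> r < T (Suc (c r))"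
    using cell by metis
  define path' where "path' r = (-1) ^ c r * \<epsilon> (c r) powr (1 - q) * field (path r)" for r
  have path': "(path has_real_derivative path' r) (at r)" "\<bar>path' r\<bar> \<le> \<Lambda>" if r: "0 \<le> r" "r \<le> t1" for r
  proof -
    note D = path_has_derivative[OF c(2)[OF r] less_imp_le[OF c(3)[OF r]]]
    show "(path has_real_derivative path' r) (at r)" unfolding path'_def by (rule D)
    show "\<bar>path' r\<bar> \<le> \<Lambda>" unfolding path'_def using D(2,3) \<Lambda>(2)[OF c(1)[OF r]] by linarith
  qed
  have cont: "continuous_on {s..t} path" if "0 \<le> s" "t \<le> t1" for s t
    by (intro continuous_at_imp_continuous_on ballI DERIV_isCont[OF path'(1)]) (use that in auto)
  have lip: "\<bar>path t - path s\<bar> \<le> \<Lambda> * (t - s)" if "0 \<le> s" "s \<le> t" "t \<le> t1" for s t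
    by (rule abs_diff_le_finite_exceptions[of "{}" s t path \<Lambda> path'])
      (use that \<Lambda>(1) path' cont in auto)
  have le: "path r \<le> e N" if "0 \<le> r" "r \<le> t1" for r
  proof -
    show ?thesis
      using path_in_cell(2)[OF c(2)[OF that] less_imp_le[OF c(3)[OF that]]] e_mono[of "Suc (c r)" N] c(1)[OF that]
      by simp
  qed
  show ?thesis
  proof (rule that[of "S * K * \<Lambda> powr b"])
    show "0 \<le> S * K * \<Lambda> powr b" using S K by simp
    fix s t assume st: "0 \<le> s" "s \<le> t" "t \<le> t1"
    define G where "G = field (path s)"
    define \<phi>' where "\<phi>' r = (-1) ^ c r * \<epsilon> (c r) powr (1 - q) * (field (path r) - G)" for r
    have "\<bar>(path t - G * signal t) - (path s - G * signal s)\<bar> \<le> S * K * \<Lambda> powr b * (t - s) powr b * (t - s)"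
    proof (rule abs_diff_le_finite_exceptions[of "T ` {..N}" s t "\<lambda>r. path r - G * signal r" _ \<phi>'])
      show "continuous_on {s..t} (\<lambda>r. path r - G * signal r)"
        using st by (intro continuous_intros cont continuous_signal) auto
      show "0 \<le> S * K * \<Lambda> powr b * (t - s) powr b" using S K by simp
      fix r assume r: "s < r" "r < t" "r \<notin> T ` {..N}"
      have r0: "0 \<le> r" "r \<le> t1" using r st by auto
      define i where "i = c r"
      have i: "i < N" "T i \<le> r" "r < T (Suc i)" using c[OF r0] by (simp_all add: i_def)
      have "T i < r" using i r(3) by (cases "T i = r") auto
      have "((\<lambda>r. path r - G * signal r) has_real_derivative
          (-1) ^ i * \<epsilon> i powr (1 - q) * field (path r) - G * ((-1) ^ i * \<epsilon> i powr (1 - q))) (at r)"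
        using path_has_derivative(1)[OF i(2) less_imp_le[OF i(3)]] signal_has_derivative[OF \<open>T i < r\<close> i(3)]
        by (intro DERIV_diff DERIV_cmult)
      moreover have eq: "\<phi>' r = (-1) ^ i * \<epsilon> i powr (1 - q) * (field (path r) - G)"
        by (simp add: \<phi>'_def i_def)
      moreover have "\<bar>\<phi>' r\<bar> \<le> S * K * \<Lambda> powr b * (t - s) powr b"
      proof -
        have "\<bar>field (path r) - G\<bar> \<le> K * \<bar>path r - path s\<bar> powr b"
          unfolding G_def using le r0 st by (intro K(2)) auto
        also have "\<dots> \<le> K * (\<Lambda> * (t - s)) powr b"
        proof -
          have "\<bar>path r - path s\<bar> \<le> \<Lambda> * (r - s)" using lip[of s r] r r0 st by simp
          also have "\<dots> \<le> \<Lambda> * (t - s)" using r \<Lambda> by (intro mult_left_mono) auto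
          finally show ?thesis using K b by (intro mult_left_mono powr_mono2) auto
        qed
        also have "\<dots> = K * \<Lambda> powr b * (t - s) powr b" by (simp add: powr_mult)
        finally have "\<epsilon> i powr (1 - q) * \<bar>field (path r) - G\<bar> \<le> S * (K * \<Lambda> powr b * (t - s) powr b)"
          using S(2)[OF i(1)] S(1) by (intro mult_mono) auto
        thus ?thesis unfolding eq by (simp add: abs_mult power_abs mult.assoc)
      qed
      ultimately show "((\<lambda>r. path r - G * signal r) has_real_derivative \<phi>' r) (at r) \<and> \<bar>\<phi>' r\<bar> \<le> S * K * \<Lambda> powr b * (t - s) powr b"
        unfolding eq by (simp add: right_diff_distrib mult_ac)
    qed (use st in auto)
    also have "S * K * \<Lambda> powr b * (t - s) powr b * (t - s) = S * K * \<Lambda> powr b * (t - s) powr (1 + b)"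
      using st by (cases "s = t") (auto simp: powr_add mult_ac)
    finally show "\<bar>path t - path s - field (path s) * (signal t - signal s)\<bar> \<le> S * K * \<Lambda> powr b * (t - s) powr (1 + b)"
      unfolding G_def by (simp add: algebra_simps)
  qed
qed

end

text \<open>As \<open>F\<close> vanishes at all grid points, the values at \<open>x\<close> and at
  \<open>z\<close> are each compared with a zero lying between the two points. The number of cells
  in between does not enter, and the price is a factor 2; hence the cell constants
  \<open>A R / 2\<close> in the applications.\<close>

lemma (in grid) hoelder_glue:
  assumes unbdd: "\<And>Z. \<exists>i. Z < e i" and zero: "\<And>x. x \<le> e 0 \<Longrightarrow> F x = 0" "\<And>i. F (e i) = 0"
    and cell: "\<And>i x z. e i \<le> x \<Longrightarrow> x \<le> z \<Longrightarrow> z \<le> e (Suc i) \<Longrightarrow> z \<le> X \<Longrightarrow> \<bar>F x - F z\<bar> \<le> C * \<bar>x - z\<bar> powr b"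
    and C: "0 \<le> C" and b: "0 < b" and xz: "x \<le> z" "z \<le> X"
  shows "\<bar>F x - F z\<bar> \<le> 2 * C * \<bar>x - z\<bar> powr b"
proof (cases "z \<le> e 0")
  case True
  thus ?thesis using zero xz C by simp
next
  case False
  have grow: "C * \<bar>u\<bar> powr b \<le> C * \<bar>x - z\<bar> powr b" if "\<bar>u\<bar> \<le> \<bar>x - z\<bar>" for u
    using that C b by (intro mult_left_mono powr_mono2) auto
  obtain N where "z < e N" using unbdd by blast
  then obtain k where k: "e k \<le> z" "z < e (Suc k)" using cell_exists[of z N] False by auto
  show ?thesis
  proof (cases "e k \<le> x")
    case True
    have "\<bar>F x - F z\<bar> \<le> C * \<bar>x - z\<bar> powr b" using True k xz by (intro cell[of k]) auto
    moreover have "0 \<le> C * \<bar>x - z\<bar> powr b" using C by simp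
    ultimately show ?thesis by linarith
  next
    case False
    have "\<bar>F (e k) - F z\<bar> \<le> C * \<bar>e k - z\<bar> powr b" using k xz by (intro cell[of k]) auto
    hence 1: "\<bar>F z\<bar> \<le> C * \<bar>x - z\<bar> powr b" using grow[of "e k - z"] k False zero(2)[of k] by simp
    have 2: "\<bar>F x\<bar> \<le> C * \<bar>x - z\<bar> powr b"
    proof (cases "x \<le> e 0")
      case True
      thus ?thesis using zero(1) C by simp
    next
      case False
      then obtain i where i: "i < k" "e i \<le> x" "x < e (Suc i)"
        using cell_exists[of x k] \<open>\<not> e k \<le> x\<close> by auto
      have ik: "e (Suc i) \<le> e k" using i by (intro e_mono) simp
      have "\<bar>F x - F (e (Suc i))\<bar> \<le> C * \<bar>x - e (Suc i)\<bar> powr b"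
        using i ik k xz by (intro cell[of i]) auto
      thus ?thesis using grow[of "x - e (Suc i)"] i ik k zero(2)[of "Suc i"] by simp
    qed
    show ?thesis using 1 2 by linarith
  qed
qed

lemma abs_signed_mult:
  fixes w u :: real
  shows "0 \<le> w \<Longrightarrow> \<bar>(-1) ^ i * (w * u)\<bar> = w * \<bar>u\<bar>"
  by (simp add: abs_mult power_abs)

lemma (in oscillation) field_cell:
  assumes "e i \<le> x" "x \<le> e (Suc i)"
  shows "field x = (-1) ^ i * (l i / \<epsilon> i) * (m * 2 powr b) * hat ((x - e i) / l i) powr b"
  unfolding field_def by (subst superposition_cell[where c = 0 and i = i]) (auto simp: assms hat_outside)

lemma (in oscillation) field_cell_hoelder:
  assumes "e i \<le> x" "x \<le> e (Suc i)" "e i \<le> z" "z \<le> e (Suc i)"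
  shows "\<bar>field x - field z\<bar> \<le> l i / \<epsilon> i * m * 2 powr b * l i powr (- b) * \<bar>x - z\<bar> powr b"
proof -
  have w: "0 \<le> l i / \<epsilon> i * m * 2 powr b" using l_pos[of i] \<epsilon>_pos[of i] m_gt1 by simp
  have "field x - field z = (-1) ^ i * (l i / \<epsilon> i * m * 2 powr b * (hat ((x - e i) / l i) powr b - hat ((z - e i) / l i) powr b))"
    unfolding field_cell[OF assms(1,2)] field_cell[OF assms(3,4)] by (simp add: right_diff_distrib mult_ac)
  hence "\<bar>field x - field z\<bar> = l i / \<epsilon> i * m * 2 powr b * \<bar>hat ((x - e i) / l i) powr b - hat ((z - e i) / l i) powr b\<bar>"
    using w by (simp only: abs_signed_mult)
  also have "\<dots> \<le> l i / \<epsilon> i * m * 2 powr b * \<bar>(x - e i) / l i - (z - e i) / l i\<bar> powr b"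
    using b w by (intro mult_left_mono hat_powr_hoelder) auto
  also have "\<bar>(x - e i) / l i - (z - e i) / l i\<bar> = \<bar>x - z\<bar> / l i"
    using l_pos[of i] by (simp flip: diff_divide_distrib)
  also have "(\<bar>x - z\<bar> / l i) powr b = l i powr (- b) * \<bar>x - z\<bar> powr b"
    using l_pos[of i] by (simp add: powr_divide powr_minus_divide)
  finally show ?thesis by (simp only: mult.assoc)
qed

lemma (in oscillation) field_cell_bound:
  assumes "e i \<le> x" "x \<le> e (Suc i)"
  shows "\<bar>field x\<bar> \<le> l i / \<epsilon> i * m"
proof -
  have w: "0 \<le> l i / \<epsilon> i * m" using l_pos[of i] \<epsilon>_pos[of i] m_gt1 by simp
  have "2 powr b * hat ((x - e i) / l i) powr b \<le> 2 powr b * (1 / 2) powr b"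
    using b hat_le hat_nonneg by (intro mult_left_mono powr_mono2) auto
  also have "\<dots> = 1" by (simp flip: powr_mult)
  finally have h: "2 powr b * hat ((x - e i) / l i) powr b \<le> 1" .
  have "field x = (-1) ^ i * ((l i / \<epsilon> i * m) * (2 powr b * hat ((x - e i) / l i) powr b))"
    unfolding field_cell[OF assms] by simp
  hence "\<bar>field x\<bar> = (l i / \<epsilon> i * m) * (2 powr b * hat ((x - e i) / l i) powr b)"
    using w by (simp only: abs_signed_mult) (simp add: abs_mult)
  also have "\<dots> \<le> (l i / \<epsilon> i * m) * 1" using w h by (intro mult_left_mono)
  finally show ?thesis by simp
qed

lemma (in oscillation) field_before: "x \<le> e 0 \<Longrightarrow> field x = 0"
  unfolding field_def by (rule superposition_before) (auto simp: hat_outside)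

lemma (in oscillation) field_grid_point: "field (e i) = 0"
  using field_cell[of i "e i"] l_pos[of i] by (simp add: e_Suc hat_outside)

lemma (in oscillation) e_unbounded: "\<exists>i. Z < e i"
  using e_lim unfolding filterlim_at_top_dense eventually_sequentially by blast

text \<open>A cell pair consists of a cell on which the field is positive and one on which it is negative.\<close>

locale cell_pairs =
  fixes Y L1 L2 \<eta> :: "nat \<Rightarrow> real" and q b :: real
  assumes L1: "\<And>j. 0 < L1 j" and L2: "\<And>j. 0 < L2 j" and \<eta>: "\<And>j. 0 < \<eta> j"
    and Y_Suc: "\<And>j. Y (Suc j) = Y j + L1 j + L2 j"
    and Y_unbounded: "\<And>Z. \<exists>j. Z \<le> Y j"
    and \<eta>_summable: "summable (\<lambda>j. \<eta> j powr q)"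
    and q: "1 \<le> q" and b: "0 < b" "b < 1"
begin

definition e :: "nat \<Rightarrow> real" where "e i = (if even i then Y (i div 2) else Y (i div 2) + L1 (i div 2))"
definition l :: "nat \<Rightarrow> real" where "l i = (if even i then L1 (i div 2) else L2 (i div 2))"
definition \<epsilon> :: "nat \<Rightarrow> real" where "\<epsilon> i = \<eta> (i div 2)"

lemma Y_mono: "i \<le> j \<Longrightarrow> Y i \<le> Y j"
proof (induction rule: dec_induct)
  case (step n)
  thus ?case using L1[of n] L2[of n] by (simp add: Y_Suc)
qed simp

lemma Y_le_e: "Y (i div 2) \<le> e i"
  using L1[of "i div 2"] by (simp add: e_def)

lemma sum_double:
  fixes g :: "nat \<Rightarrow> real"
  shows "(\<Sum>i<2 * N. g (i div 2)) = 2 * (\<Sum>j<N. g j)"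
  by (induction N) auto

sublocale oscillation e l q b \<epsilon>
proof
  show "0 < l i" "0 < \<epsilon> i" for i using L1 L2 \<eta> by (auto simp: l_def \<epsilon>_def)
  show "e (Suc i) = e i + l i" for i
    by (auto simp: e_def l_def Y_Suc elim!: oddE evenE)
  show "\<epsilon> (Suc (2 * j)) = \<epsilon> (2 * j)" for j by (simp add: \<epsilon>_def)
  show "filterlim e at_top sequentially"
    unfolding filterlim_at_top eventually_sequentially
  proof
    fix Z
    obtain j where j: "Z \<le> Y j" using Y_unbounded by blast
    have "Z \<le> e i" if "2 * j \<le> i" for i
    proof -
      have "j \<le> i div 2" using that by presburger
      thus ?thesis using j Y_mono[of j "i div 2"] Y_le_e[of i] by simp
    qed
    thus "\<exists>N. \<forall>n\<ge>N. Z \<le> e n" by blast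
  qed
  show "summable (\<lambda>i. \<epsilon> i powr q)"
  proof (rule summableI_nonneg_bounded)
    fix N
    have "(\<Sum>i<N. \<epsilon> i powr q) \<le> (\<Sum>i<2 * N. \<epsilon> i powr q)" by (intro sum_mono2) auto
    also have "\<dots> = 2 * (\<Sum>j<N. \<eta> j powr q)"
      unfolding \<epsilon>_def by (rule sum_double)
    also have "\<dots> \<le> 2 * (\<Sum>j. \<eta> j powr q)"
      using \<eta>_summable by (intro mult_left_mono sum_le_suminf) auto
    finally show "(\<Sum>i<N. \<epsilon> i powr q) \<le> 2 * (\<Sum>j. \<eta> j powr q)" .
  qed simp
qed (use q b in auto)

end

text \<open>The steps may shrink as \<open>Y\<close> grows, but while \<open>Y\<close> stays below
  \<open>Z\<close> they have a positive lower bound depending on \<open>Z\<close> alone.\<close>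

lemma unbounded_of_steps:
  fixes Y :: "nat \<Rightarrow> real"
  assumes "\<And>Z. \<exists>c>0. \<forall>j. Y j \<le> Z \<longrightarrow> Y j + c \<le> Y (Suc j)"
  shows "\<exists>j. Z \<le> Y j"
proof (rule ccontr)
  assume "\<not> ?thesis"
  hence Z: "Y j \<le> Z" for j by (meson linear)
  obtain c where c: "0 < c" "\<And>j. Y j \<le> Z \<Longrightarrow> Y j + c \<le> Y (Suc j)" using assms by blast
  have "Y 0 + real j * c \<le> Y j" for j
  proof (induction j)
    case (Suc j)
    thus ?case using c(2)[OF Z, of j] by (simp add: distrib_right)
  qed simp
  moreover obtain j where "Z - Y 0 < real j * c" using reals_Archimedean3[OF c(1)] by blast
  ultimately show False using Z[of j] by (smt (verit))
qed

lemma summable_contraction: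
  fixes s r :: "nat \<Rightarrow> real"
  assumes s: "\<And>j. 0 \<le> s j" and r: "\<And>j. 0 \<le> r j" "summable r" and \<rho>: "0 \<le> \<rho>" "\<rho> < 1"
    and step: "\<And>j. s (Suc j) \<le> \<rho> * s j + r j"
  shows "summable s"
proof (rule summableI_nonneg_bounded[OF s])
  fix N
  \<comment> \<open>The solution of \<open>B = s 0 + (\<rho> * B + suminf r)\<close>, the bound that
    the induction on partial sums reproduces.\<close>
  define B where "B = (s 0 + suminf r) / (1 - \<rho>)"
  have "0 \<le> suminf r" using r by (intro suminf_nonneg)
  hence B: "0 \<le> B" "s 0 + (\<rho> * B + suminf r) = B"
    using s[of 0] \<rho> by (auto simp: B_def field_simps)
  show "sum s {..<N} \<le> B"
  proof (induction N)
    case (Suc N)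
    have "sum s {..<Suc N} = s 0 + (\<Sum>j<N. s (Suc j))" by (rule sum.lessThan_Suc_shift)
    also have "(\<Sum>j<N. s (Suc j)) \<le> (\<Sum>j<N. \<rho> * s j + r j)" by (intro sum_mono step)
    also have "\<dots> = \<rho> * sum s {..<N} + sum r {..<N}" by (simp add: sum.distrib sum_distrib_left)
    also have "\<dots> \<le> \<rho> * B + suminf r"
      using Suc \<rho> r by (intro add_mono mult_left_mono sum_le_suminf) auto
    finally show ?case using B(2) by simp
  qed (use B in simp)
qed

text \<open>After division by 4 the cell from \<open>Y j\<close> to \<open>Y (Suc j)\<close> lies to
  the left of \<open>z j\<close>, where \<open>g\<close> is at least \<open>g (z j)\<close>; so a
  quarter of the sum is a lower sum of the integral. The condition \<open>4 \<le> Y 0\<close> keeps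
  the shrunken cells in \<open>[1, \<infinity>)\<close>.\<close>

lemma summable_density:
  fixes g :: "real \<Rightarrow> real" and Y z :: "nat \<Rightarrow> real"
  assumes g: "\<And>r. 0 \<le> g r" "\<And>r s. 1 \<le> r \<Longrightarrow> r \<le> s \<Longrightarrow> g s \<le> g r"
    and fin: "(\<integral>\<^sup>+ r\<in>{1..}. ennreal (g r) \<partial>lborel) < \<infinity>"
    and Y: "4 \<le> Y 0" "\<And>j. Y j \<le> Y (Suc j)" "\<And>j. Y (Suc j) \<le> 4 * z j"
  shows "summable (\<lambda>j. (Y (Suc j) - Y j) * g (z j))"
proof -
  define I where "I = (\<integral>\<^sup>+ r\<in>{1..}. ennreal (g r) \<partial>lborel)"
  define a where "a j = Y j / 4" for j
  have a: "1 \<le> a 0" "a j \<le> a (Suc j)" "a (Suc j) \<le> z j" for j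
    using Y by (auto simp: a_def divide_right_mono field_simps)
  have a1: "1 \<le> a j" for j
  proof (induction j)
    case (Suc j)
    thus ?case using a(2)[of j] by simp
  qed (use a in simp)
  have ptw: "(\<Sum>j<N. ennreal (g (z j)) * indicator {a j..<a (Suc j)} r) \<le> ennreal (g r) * indicator {1..<a N} r"
    for r N
  proof (induction N)
    case (Suc N)
    show ?case
    proof (cases "r < a N")
      case True
      hence "(\<Sum>j<Suc N. ennreal (g (z j)) * indicator {a j..<a (Suc j)} r) \<le> ennreal (g r) * indicator {1..<a N} r"
        using Suc by simp
      also have "\<dots> \<le> ennreal (g r) * indicator {1..<a (Suc N)} r"
        using a(2)[of N] by (intro mult_left_mono) (auto simp: indicator_def)
      finally show ?thesis .
    next
      case False
      have "(\<Sum>j<N. ennreal (g (z j)) * indicator {a j..<a (Suc j)} r) = 0"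
        using Suc False by simp
      moreover have "ennreal (g (z N)) * indicator {a N..<a (Suc N)} r \<le> ennreal (g r) * indicator {1..<a (Suc N)} r"
      proof (cases "r < a (Suc N)")
        case True
        have "g (z N) \<le> g r" using True False a(3)[of N] a1[of N] by (intro g(2)) auto
        thus ?thesis using True False a1[of N] by (simp add: ennreal_leI)
      qed simp
      ultimately show ?thesis by simp
    qed
  qed simp
  have "(\<Sum>j<N. (Y (Suc j) - Y j) * g (z j)) \<le> 4 * enn2real I" for N
  proof -
    have "ennreal (\<Sum>j<N. (a (Suc j) - a j) * g (z j)) = (\<Sum>j<N. ennreal (g (z j)) * emeasure lborel {a j..<a (Suc j)})"
    proof -
      have "ennreal (\<Sum>j<N. (a (Suc j) - a j) * g (z j)) = (\<Sum>j<N. ennreal ((a (Suc j) - a j) * g (z j)))"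
        using a g by (subst sum_ennreal) auto
      thus ?thesis using a g by (simp add: ennreal_mult mult.commute cong: sum.cong)
    qed
    also have "\<dots> = (\<Sum>j<N. \<integral>\<^sup>+ r. ennreal (g (z j)) * indicator {a j..<a (Suc j)} r \<partial>lborel)"
      by (intro sum.cong refl nn_integral_cmult_indicator[symmetric]) simp
    also have "\<dots> = (\<integral>\<^sup>+ r. (\<Sum>j<N. ennreal (g (z j)) * indicator {a j..<a (Suc j)} r) \<partial>lborel)"
      by (rule nn_integral_sum[symmetric]) simp
    also have "\<dots> \<le> I"
      unfolding I_def
    proof (rule nn_integral_mono)
      fix r :: real
      have "ennreal (g r) * indicator {1..<a N} r \<le> ennreal (g r) * indicator {1..} r"
        by (intro mult_left_mono) (auto simp: indicator_def)
      thus "(\<Sum>j<N. ennreal (g (z j)) * indicator {a j..<a (Suc j)} r) \<le> ennreal (g r) * indicator {1..} r"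
        using ptw by (rule order_trans[rotated])
    qed
    also have "I = ennreal (enn2real I)" using fin unfolding I_def[symmetric] by simp
    finally have "(\<Sum>j<N. (a (Suc j) - a j) * g (z j)) \<le> enn2real I" by (simp add: ennreal_le_iff)
    moreover have "(\<Sum>j<N. (Y (Suc j) - Y j) * g (z j)) = 4 * (\<Sum>j<N. (a (Suc j) - a j) * g (z j))"
      unfolding sum_distrib_left by (intro sum.cong) (auto simp: a_def field_simps)
    ultimately show ?thesis by simp
  qed
  thus ?thesis using Y(2) g(1) by (intro summableI_nonneg_bounded[of _ "4 * enn2real I"]) auto
qed

section \<open>Explosion\<close>

definition line_point :: "real \<Rightarrow> nat \<Rightarrow> real"
  where "line_point u i = (if i = 0 then u else 0)"

lemma line_point_simps [simp]: "line_point u 0 = u" "line_point u \<in> Rn (Suc 0)"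
  by (auto simp: line_point_def Rn_iff)

lemma enorm_1: "enorm (Suc 0) v = \<bar>v 0\<bar>"
  by (simp add: enorm_def L2_set_def lessThan_Suc)

lemma edist_1: "edist (Suc 0) v w = \<bar>v 0 - w 0\<bar>"
  by (simp add: edist_def enorm_1)

lemma L2_set_pairs_1: "L2_set g ({..<Suc 0} \<times> {..<Suc 0}) = \<bar>g (0, 0 :: nat)\<bar>"
proof -
  have "{..<Suc 0} \<times> {..<Suc 0} = {(0::nat, 0)}" by auto
  thus ?thesis by (simp add: L2_set_def)
qed

lemma L2_set_triples_1: "L2_set g ({..<Suc 0} \<times> {..<Suc 0} \<times> {..<Suc 0}) = \<bar>g (0 :: nat, 0 :: nat, 0 :: nat)\<bar>"
proof -
  have "{..<Suc 0} \<times> {..<Suc 0} \<times> {..<Suc 0} = {(0::nat, 0::nat, 0)}" by auto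
  thus ?thesis by (simp add: L2_set_def)
qed

lemma partial_deriv_1: "partial_deriv 0 (\<lambda>z. F (z 0)) y = deriv F (y 0)"
  by (simp add: partial_deriv_def)

lemma differentiable_Rn_1:
  assumes "(F has_real_derivative F') (at (y 0))"
  shows "differentiable_Rn (Suc 0) (\<lambda>z. F (z 0)) y"
  unfolding differentiable_Rn_def
proof (intro exI[of _ "\<lambda>_. F'"] allI impI)
  fix \<epsilon> :: real assume "0 < \<epsilon>"
  then obtain d where d: "0 < d" "\<And>z. \<bar>z - y 0\<bar> < d \<Longrightarrow> \<bar>F z - F (y 0) - F' * (z - y 0)\<bar> \<le> \<epsilon> * \<bar>z - y 0\<bar>"
    using assms unfolding has_field_derivative_def has_derivative_at_alt by (auto simp: dist_real_def)
  show "\<exists>\<delta>>0. \<forall>z\<in>Rn (Suc 0). edist (Suc 0) z y < \<delta> \<longrightarrow>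
      \<bar>F (z 0) - F (y 0) - (\<Sum>h<Suc 0. F' * (z h - y h))\<bar> \<le> \<epsilon> * edist (Suc 0) z y"
    using d by (intro exI[of _ d]) (auto simp: edist_1)
qed

lemma cond_G_1_young:
  assumes "p < 2"
    and "\<And>R u. 1 \<le> R \<Longrightarrow> \<bar>u\<bar> \<le> R \<Longrightarrow> \<bar>F u\<bar> \<le> D R"
    and "\<And>R u v. 1 \<le> R \<Longrightarrow> \<bar>u\<bar> \<le> R \<Longrightarrow> \<bar>v\<bar> \<le> R \<Longrightarrow> \<bar>F v - F u\<bar> \<le> A R * \<bar>v - u\<bar> powr \<beta>"
  shows "cond_G p \<beta> (Suc 0) (Suc 0) D A (\<lambda>y i j. F (y 0))"
  unfolding cond_G_def enorm_1 edist_1 L2_set_pairs_1 using assms by simp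

lemma cond_G_1_rough:
  assumes "2 \<le> p"
    and "\<And>R u. 1 \<le> R \<Longrightarrow> \<bar>u\<bar> \<le> R \<Longrightarrow> \<bar>F u\<bar> \<le> D R"
    and der: "\<And>u. (F has_real_derivative F' u) (at u)"
    and "\<And>R u v. 1 \<le> R \<Longrightarrow> \<bar>u\<bar> \<le> R \<Longrightarrow> \<bar>v\<bar> \<le> R \<Longrightarrow> \<bar>F' v - F' u\<bar> \<le> A R * \<bar>v - u\<bar> powr (\<beta> - 1)"
  shows "cond_G p \<beta> (Suc 0) (Suc 0) D A (\<lambda>y i j. F (y 0))"
proof -
  have "deriv F = F'" using DERIV_imp_deriv[OF der] by auto
  thus ?thesis
    unfolding cond_G_def enorm_1 edist_1 L2_set_pairs_1 L2_set_triples_1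
    using assms differentiable_Rn_1[OF der] by (auto simp: partial_deriv_1)
qed

lemma powr_smallo:
  fixes C b :: real
  assumes b: "0 < b"
  shows "(\<lambda>\<delta>. C * \<delta> powr (1 + b)) \<in> o[at_right 0](\<lambda>\<delta>. \<delta>)"
proof (rule landau_o.smallI)
  fix c :: real assume c: "0 < c"
  define r where "r = (c / (\<bar>C\<bar> + 1)) powr (1 / b)"
  have r: "0 < r" using c by (simp add: r_def)
  have "\<bar>C * \<delta> powr (1 + b)\<bar> \<le> c * \<bar>\<delta>\<bar>" if \<delta>: "0 < \<delta>" "\<delta> < r" for \<delta>
  proof -
    have "\<delta> powr b \<le> r powr b" using \<delta> b by (intro powr_mono2) auto
    also have "\<dots> = c / (\<bar>C\<bar> + 1)" using b c by (simp add: r_def powr_powr)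
    finally have "(\<bar>C\<bar> + 1) * \<delta> powr b \<le> c" by (simp add: field_simps)
    moreover have "\<bar>C\<bar> * \<delta> powr b \<le> (\<bar>C\<bar> + 1) * \<delta> powr b" by (intro mult_right_mono) auto
    ultimately have "\<bar>C\<bar> * \<delta> powr b \<le> c" by linarith
    hence "\<bar>C\<bar> * \<delta> powr b * \<delta> \<le> c * \<delta>" using \<delta> by (intro mult_right_mono) auto
    thus ?thesis using \<delta> by (simp add: abs_mult powr_add mult_ac)
  qed
  thus "eventually (\<lambda>\<delta>. norm (C * \<delta> powr (1 + b)) \<le> c * norm \<delta>) (at_right 0)"
    unfolding eventually_at_right_field using r by (intro exI[of _ r]) auto
qed

lemma continuous_map_line_point:
  assumes "continuous_on {0..} g"
  shows "continuous_map (top_of_set {0..}) (Euclidean_space (Suc 0)) (\<lambda>t. line_point (g t))"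
  unfolding Euclidean_space_def continuous_map_in_subtopology
proof (intro conjI)
  show "continuous_map (top_of_set {0..}) (powertop_real UNIV) (\<lambda>t. line_point (g t))"
    unfolding continuous_map_componentwise_UNIV line_point_def using assms by (auto intro: continuous_intros)
qed (auto simp: line_point_def)

text \<open>The identity serves as control and \<open>C * \<delta> powr (1 + b)\<close> as
  \<open>\<theta>\<close>; \<open>C\<close> may change with \<open>t1\<close>.\<close>

lemma explodes_1:
  assumes b: "0 < b" and \<tau>: "0 < \<tau>" and y0: "y 0 = z0" and lim: "filterlim y at_top (at_left \<tau>)"
    and inc: "\<And>t1. 0 < t1 \<Longrightarrow> t1 < \<tau> \<Longrightarrow> \<exists>C\<ge>0. \<forall>s t. 0 \<le> s \<and> s \<le> t \<and> t \<le> t1 \<longrightarrow>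
      \<bar>increment_error p (Suc 0) (Suc 0) f x area (\<lambda>t. line_point (y t)) 0 s t\<bar> \<le> C * (t - s) powr (1 + b)"
  shows "explodes p (Suc 0) (Suc 0) f x area (line_point z0) (\<lambda>t. line_point (y t))"
  unfolding explodes_def
proof (intro exI[of _ \<tau>] conjI allI impI \<tau>)
  fix t1 assume t1: "0 < t1 \<and> t1 < \<tau>"
  then obtain C where C: "0 \<le> C" "\<And>s t. 0 \<le> s \<Longrightarrow> s \<le> t \<Longrightarrow> t \<le> t1 \<Longrightarrow>
      \<bar>increment_error p (Suc 0) (Suc 0) f x area (\<lambda>t. line_point (y t)) 0 s t\<bar> \<le> C * (t - s) powr (1 + b)"
    using inc[of t1] by blast
  show "solution_on p (Suc 0) (Suc 0) f x area (line_point z0) (\<lambda>t. line_point (y t)) t1"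
    unfolding solution_on_def
  proof (intro conjI)
    have "control t1 (\<lambda>t. t)" by (simp add: control_def monotone_on_def)
    moreover have "(\<lambda>\<delta>. C * \<delta> powr (1 + b)) \<in> o[at_right 0](\<lambda>\<delta>. \<delta>)" using b by (rule powr_smallo)
    ultimately show "\<exists>\<omega> \<theta>. control t1 \<omega> \<and> (\<forall>\<delta>\<ge>0. 0 \<le> \<theta> \<delta>) \<and> \<theta> 0 = 0 \<and> \<theta> \<in> o[at_right 0](\<lambda>\<delta>. \<delta>) \<and>
       (\<forall>i<Suc 0. \<forall>s t. 0 \<le> s \<and> s < t \<and> t \<le> t1 \<longrightarrow>
          \<bar>increment_error p (Suc 0) (Suc 0) f x area (\<lambda>t. line_point (y t)) i s t\<bar> \<le> \<theta> (\<omega> t - \<omega> s))"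
      using C by (intro exI[of _ "\<lambda>t. t"] exI[of _ "\<lambda>\<delta>. C * \<delta> powr (1 + b)"]) auto
  qed (use y0 in auto)
next
  have "filterlim (\<lambda>t. \<bar>y t\<bar>) at_top (at_left \<tau>)"
    using lim by (rule filterlim_at_top_mono) (simp add: abs_ge_self)
  thus "filterlim (\<lambda>t. enorm (Suc 0) (line_point (y t))) at_top (at_left \<tau>)" by (simp add: enorm_1)
qed

section \<open>The construction in case (i)\<close>

lemma growth_density_summable:
  assumes p: "1 < p" "0 < \<beta>" "p - 1 < \<beta> * p" and G: "growth_pair \<beta> D A" "growth_integral p \<beta> D A < \<infinity>"
    and Y: "4 \<le> Y 0" "\<And>j. Y j \<le> Y (Suc j)" "\<And>j. Y (Suc j) \<le> 4 * z j"
  shows "summable (\<lambda>j. (Y (Suc j) - Y j) * growth_density p \<beta> D A (z j))"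
  using G p by (intro summable_density Y)
    (auto simp: growth_density_def[symmetric] growth_integral_def growth_density_nonneg intro: growth_density_antimono)

lemma explosion_young:
  fixes p \<gamma> \<beta> :: real
  assumes p: "1 < p" "p < \<gamma>" "\<gamma> < 2" and \<beta>: "\<beta> = \<gamma> - 1"
    and G: "growth_pair \<beta> D A" and fin: "growth_integral p \<beta> D A < \<infinity>"
  shows "\<exists>(n::nat) (d::nat) f x area y0 y. n \<ge> 1 \<and> d \<ge> 1 \<and> cond_G p \<beta> n d D A f \<and> driver p d x area \<and>
    explodes p n d f x area y0 y"
proof -
  note GD = growth_pairD[OF G]
  have b: "0 < \<beta>" "\<beta> < 1" using p \<beta> by auto
  have "(p - 1) * 1 < \<beta> * p" using p \<beta> by (intro mult_strict_mono) auto
  hence pb: "p - 1 < \<beta> * p" by simp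
  define M where "M = 1 / (1 - \<beta>)"
  have M: "0 < M" using b by (simp add: M_def)
  \<comment> \<open>A pair of such cells has total length
    \<open>(D R / A R) powr (1 / \<beta>)\<close>, which is at most \<open>R\<close>. So the radius
    at most doubles from one pair to the next.\<close>
  define L where "L R = (D R / A R) powr (1 / \<beta>) / 2" for R
  have L: "0 < L R" "L R \<le> R / 2" if "1 \<le> R" for R
    using GD(1,2)[OF that] growth_pair_length_le[OF G b(1) that] by (auto simp: L_def)
  define Y where "Y = rec_nat 4 (\<lambda>_ u. u + L u + L u)"
  have Y0: "Y 0 = 4" and YS: "Y (Suc j) = Y j + L (Y j) + L (Y j)" for j by (simp_all add: Y_def)
  have Y4: "4 \<le> Y j" for j
  proof (induction j)
    case (Suc j)
    thus ?case using L(1)[of "Y j"] by (simp add: YS)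
  qed (simp add: Y0)
  have Y1: "1 \<le> Y j" for j using Y4[of j] by simp
  note LY = L(1)[OF Y1] L(2)[OF Y1]
  have Ymono: "Y j \<le> Y (Suc j)" for j using LY(1)[of j] by (simp add: YS)
  have Ydbl: "Y (Suc j) \<le> 2 * Y j" for j using LY(2)[of j] by (simp add: YS)
  \<comment> \<open>The 8 sets the amplitude of the field to \<open>D / 8\<close>. Its Hoelder
    constant on a cell is then \<open>2 powr \<beta> * 2 powr \<beta> / 8 * A\<close>, at most
    \<open>A / 2\<close>, and gluing doubles it.\<close>
  define \<eta> where "\<eta> j = 8 * M * L (Y j) / D (Y j)" for j
  have \<eta>: "0 < \<eta> j" for j using M LY(1)[of j] GD(1)[OF Y1[of j]] by (simp add: \<eta>_def)
  have unb: "\<exists>j. Z \<le> Y j" for Z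
  proof (rule unbounded_of_steps)
    fix Z
    define c where "c = 2 * ((D 4 / A (max 4 Z)) powr (1 / \<beta>) / 2)"
    have Z1: "1 \<le> max 4 Z" by (simp add: le_max_iff_disj)
    have "0 < c" using GD(1)[of 4] GD(2)[OF Z1] by (simp add: c_def)
    moreover have "Y j + c \<le> Y (Suc j)" if "Y j \<le> Z" for j
    proof -
      have "D 4 / A (max 4 Z) \<le> D (Y j) / A (Y j)"
        using GD(4)[of 4 "Y j"] GD(5)[OF Y1, of j "max 4 Z"] GD(1)[of 4] GD(2)[OF Y1[of j]] Y4[of j] that
        by (intro frac_le) auto
      hence "(D 4 / A (max 4 Z)) powr (1 / \<beta>) \<le> (D (Y j) / A (Y j)) powr (1 / \<beta>)"
        using GD(1)[of 4] GD(2)[OF Z1] b by (intro powr_mono2) auto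
      thus ?thesis by (simp add: YS L_def c_def)
    qed
    ultimately show "\<exists>c>0. \<forall>j. Y j \<le> Z \<longrightarrow> Y j + c \<le> Y (Suc j)" by blast
  qed
  have "summable (\<lambda>j. (Y (Suc j) - Y j) * growth_density p \<beta> D A (Y j))"
  proof (rule growth_density_summable[OF p(1) b(1) pb G fin])
    show "Y (Suc j) \<le> 4 * Y j" for j using Ydbl[of j] Y1[of j] by simp
  qed (auto simp: Y0 Ymono)
  hence "summable (\<lambda>j. (4 * M) powr p * ((Y (Suc j) - Y j) * growth_density p \<beta> D A (Y j)))"
    by (rule summable_mult)
  also have "(\<lambda>j. (4 * M) powr p * ((Y (Suc j) - Y j) * growth_density p \<beta> D A (Y j))) = (\<lambda>j. \<eta> j powr p)"
  proof
    fix j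
    have pos: "0 < D (Y j)" "0 < A (Y j)" using GD(1,2)[OF Y1[of j]] by auto
    let ?X = "D (Y j) / A (Y j)"
    have "\<eta> j powr p = (4 * M) powr p * (?X powr (1 / \<beta>)) powr p * D (Y j) powr (- p)"
    proof -
      have "\<eta> j = (4 * M) * ?X powr (1 / \<beta>) / D (Y j)" by (simp add: \<eta>_def L_def)
      thus ?thesis by (simp only: powr_divide powr_mult powr_minus_divide) simp
    qed
    \<comment> \<open>One factor \<open>?X powr (1 / \<beta>)\<close> is split off because it equals
      the length of the pair; the rest becomes the integrand.\<close>
    also have "(?X powr (1 / \<beta>)) powr p = ?X powr (1 / \<beta>) * ?X powr ((p - 1) / \<beta>)"
      by (simp add: powr_powr diff_divide_distrib flip: powr_add)
    also have "?X powr ((p - 1) / \<beta>) = D (Y j) powr ((p - 1) / \<beta>) * A (Y j) powr ((1 - p) / \<beta>)"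
      using pos powr_minus_divide[of "A (Y j)" "(p - 1) / \<beta>"] by (simp add: powr_divide minus_divide_left)
    also have "?X powr (1 / \<beta>) = Y (Suc j) - Y j" by (simp add: YS L_def)
    also have "(4 * M) powr p * ((Y (Suc j) - Y j) * (D (Y j) powr ((p - 1) / \<beta>) * A (Y j) powr ((1 - p) / \<beta>))) * D (Y j) powr (- p)
        = (4 * M) powr p * ((Y (Suc j) - Y j) * (A (Y j) powr ((1 - p) / \<beta>) * (D (Y j) powr ((p - 1) / \<beta>) * D (Y j) powr (- p))))"
      by (simp only: mult_ac)
    also have "D (Y j) powr ((p - 1) / \<beta>) * D (Y j) powr (- p) = D (Y j) powr ((p - 1 - \<beta> * p) / \<beta>)"
      using b by (simp add: diff_divide_distrib flip: powr_add)
    also have "A (Y j) powr ((1 - p) / \<beta>) * D (Y j) powr ((p - 1 - \<beta> * p) / \<beta>) = growth_density p \<beta> D A (Y j)"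
      using pos by (simp add: growth_density_def powr_mult powr_powr)
    finally show "(4 * M) powr p * ((Y (Suc j) - Y j) * growth_density p \<beta> D A (Y j)) = \<eta> j powr p"
      by simp
  qed
  finally have sm: "summable (\<lambda>j. \<eta> j powr p)" .
  interpret cell_pairs Y "\<lambda>j. L (Y j)" "\<lambda>j. L (Y j)" \<eta> p \<beta>
    by standard (use LY \<eta> YS unb sm p b in auto)
  have m: "m = M" by (simp add: m_def M_def)
  have l: "l i = L (Y (i div 2))" for i by (simp add: l_def)
  have amp: "l i / \<epsilon> i * m = D (Y (i div 2)) / 8" for i
    using M LY(1)[of "i div 2"] GD(1)[OF Y1[of "i div 2"]] by (simp add: l m \<epsilon>_def \<eta>_def)
  have Yx: "1 \<le> Y (i div 2)" "Y (i div 2) \<le> x" if "e i \<le> x" for i x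
    using Y_le_e[of i] Y1 that by auto
  have bound: "\<bar>field u\<bar> \<le> D R" if R: "1 \<le> R" "\<bar>u\<bar> \<le> R" for R u
  proof (cases "u \<le> e 0")
    case True
    thus ?thesis using field_before GD(1)[OF R(1)] by simp
  next
    case False
    obtain N where "u < e N" using e_unbounded by blast
    then obtain i where i: "e i \<le> u" "u < e (Suc i)" using cell_exists[of u N] False by auto
    have "\<bar>field u\<bar> \<le> D (Y (i div 2)) / 8" using field_cell_bound[of i u] i unfolding amp by simp
    also have "\<dots> \<le> D (Y (i div 2))" using GD(1)[OF Y1[of "i div 2"]] by simp
    also have "\<dots> \<le> D R" using Yx[OF i(1)] R by (intro GD(4)) auto
    finally show ?thesis .
  qed
  have cellH: "\<bar>field u - field v\<bar> \<le> A R / 2 * \<bar>u - v\<bar> powr \<beta>"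
    if R: "1 \<le> R" and uv: "e i \<le> u" "u \<le> v" "v \<le> e (Suc i)" "v \<le> R" for R i u v
  proof -
    let ?Y = "Y (i div 2)"
    have pos: "0 < D ?Y" "0 < A ?Y" using GD(1,2)[OF Y1[of "i div 2"]] by auto
    have "l i powr (- \<beta>) = (2 powr \<beta>) * (A ?Y / D ?Y)"
    proof -
      have "L ?Y powr \<beta> = D ?Y / A ?Y / 2 powr \<beta>"
        unfolding L_def using pos b by (simp only: powr_divide powr_powr) simp
      thus ?thesis by (simp only: l powr_minus_divide) simp
    qed
    hence "l i / \<epsilon> i * m * 2 powr \<beta> * l i powr (- \<beta>) = D ?Y / 8 * 2 powr \<beta> * (2 powr \<beta> * (A ?Y / D ?Y))"
      by (simp only: amp)
    also have "\<dots> = (2 powr \<beta> * 2 powr \<beta>) / 8 * A ?Y" using pos by simp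
    also have "\<dots> \<le> (2 powr 1 * 2 powr 1) / 8 * A ?Y"
      using pos b by (intro mult_right_mono divide_right_mono mult_mono powr_mono) auto
    also have "\<dots> \<le> A R / 2" using GD(5)[OF Yx(1)[OF uv(1)], of R] Yx(2)[OF uv(1)] uv by simp
    finally have K: "l i / \<epsilon> i * m * 2 powr \<beta> * l i powr (- \<beta>) \<le> A R / 2" .
    have "\<bar>field u - field v\<bar> \<le> l i / \<epsilon> i * m * 2 powr \<beta> * l i powr (- \<beta>) * \<bar>u - v\<bar> powr \<beta>"
      using uv by (intro field_cell_hoelder) auto
    also have "\<dots> \<le> A R / 2 * \<bar>u - v\<bar> powr \<beta>" using K by (intro mult_right_mono) auto
    finally show ?thesis .
  qed
  have hoelder: "\<bar>field u - field v\<bar> \<le> A R * \<bar>u - v\<bar> powr \<beta>" if R: "1 \<le> R" and uv: "u \<le> v" "v \<le> R" for R u v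
    using hoelder_glue[OF e_unbounded field_before field_grid_point cellH[OF R] _ b(1) uv] GD(2)[OF R] by simp
  have "cond_G p \<beta> (Suc 0) (Suc 0) D A (\<lambda>y i j. field (y 0))"
  proof (rule cond_G_1_young)
    fix R u v :: real assume *: "1 \<le> R" "\<bar>u\<bar> \<le> R" "\<bar>v\<bar> \<le> R"
    show "\<bar>field v - field u\<bar> \<le> A R * \<bar>v - u\<bar> powr \<beta>"
    proof (cases "u \<le> v")
      case True
      thus ?thesis using hoelder[OF *(1), of u v] * by (simp add: abs_minus_commute)
    next
      case False
      thus ?thesis using hoelder[OF *(1), of v u] * by simp
    qed
  qed (use p bound in auto)
  moreover have "driver p (Suc 0) (\<lambda>t. line_point (signal t)) (\<lambda>r j s t. 0)"
    unfolding driver_def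
  proof (intro conjI allI impI)
    show "continuous_map (top_of_set {0..}) (Euclidean_space (Suc 0)) (\<lambda>t. line_point (signal t))"
      by (rule continuous_map_line_point[OF continuous_signal])
    fix T' :: real
    show "finite_pvar p (Suc 0) (\<lambda>t. line_point (signal t)) T'"
      unfolding finite_pvar_def pvar_bound_def
    proof (intro exI[of _ "\<lambda>t. t"] conjI allI impI)
      show "control T' (\<lambda>t. t)" by (simp add: control_def monotone_on_def)
      fix s t :: real assume "0 \<le> s \<and> s \<le> t \<and> t \<le> T'"
      thus "edist (Suc 0) (line_point (signal t)) (line_point (signal s)) powr p \<le> t - s"
        using signal_hoelder[of t s] by (simp add: edist_1)
    qed
  qed (use p in auto)
  moreover have "explodes p (Suc 0) (Suc 0) (\<lambda>y i j. field (y 0)) (\<lambda>t. line_point (signal t)) (\<lambda>r j s t. 0) (line_point (e 0)) (\<lambda>t. line_point (path t))"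
  proof (rule explodes_1[OF b(1) explosion_time_pos path_0 path_explodes])
    fix t1 assume "t1 < explosion_time"
    then obtain C where "0 \<le> C" "\<And>s t. 0 \<le> s \<Longrightarrow> s \<le> t \<Longrightarrow> t \<le> t1 \<Longrightarrow>
      \<bar>path t - path s - field (path s) * (signal t - signal s)\<bar> \<le> C * (t - s) powr (1 + \<beta>)"
      using path_increment by blast
    thus "\<exists>C\<ge>0. \<forall>s t. 0 \<le> s \<and> s \<le> t \<and> t \<le> t1 \<longrightarrow>
      \<bar>increment_error p (Suc 0) (Suc 0) (\<lambda>y i j. field (y 0)) (\<lambda>t. line_point (signal t)) (\<lambda>r j s t. 0) (\<lambda>t. line_point (path t)) 0 s t\<bar>
        \<le> C * (t - s) powr (1 + \<beta>)"
      using p by (intro exI[of _ C]) (simp add: increment_error_def)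
  qed
  moreover have "(1::nat) \<le> Suc 0" by simp
  ultimately show ?thesis by blast
qed

section \<open>The construction in case (ii)\<close>

lemma abs_diff_quotient_le:
  fixes a a' c c' :: real
  assumes "0 < c" "0 < c'"
  shows "\<bar>a / c - a' / c'\<bar> \<le> \<bar>a - a'\<bar> / c + \<bar>a'\<bar> * (\<bar>c' - c\<bar> / (c * c'))"
proof -
  have "a / c - a' / c' = (a - a') / c + a' * ((c' - c) / (c * c'))"
    using assms by (simp add: field_simps)
  also have "\<bar>\<dots>\<bar> \<le> \<bar>(a - a') / c\<bar> + \<bar>a' * ((c' - c) / (c * c'))\<bar>" by (rule abs_triangle_ineq)
  also have "\<dots> = \<bar>a - a'\<bar> / c + \<bar>a'\<bar> * (\<bar>c' - c\<bar> / (c * c'))"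
    using assms by (simp add: abs_mult)
  finally show ?thesis .
qed

text \<open>On pair \<open>j\<close> the primitive \<open>H\<close> rises from
  \<open>(v j)^2 / 2\<close> to \<open>(v j)^2\<close> and falls to
  \<open>(v (Suc j))^2 / 2\<close>. Thus \<open>F = sqrt (2 * H)\<close> stays between
  \<open>v j\<close> and \<open>2 * v j\<close>, is never 0, and starts the next pair at
  \<open>v (Suc j)\<close>. The sequence \<open>v\<close> is a slowed-down version of
  \<open>D / 24\<close>.\<close>

lemma explosion_rough:
  fixes p \<gamma> \<beta> :: real
  assumes p: "2 \<le> p" "p < \<gamma>" "\<gamma> < 3" and \<beta>: "\<beta> = \<gamma> - 1"
    and G: "growth_pair \<beta> D A" and fin: "growth_integral p \<beta> D A < \<infinity>"
  shows "\<exists>(n::nat) (d::nat) f x area y0 y. n \<ge> 1 \<and> d \<ge> 1 \<and> cond_G p \<beta> n d D A f \<and> driver p d x area \<and>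
    explodes p n d f x area y0 y"
proof -
  note GD = growth_pairD[OF G]
  have b: "1 < \<beta>" "\<beta> < 2" using p \<beta> by auto
  have \<beta>0: "0 < \<beta>" and \<beta>1: "1 < \<beta>" and p1: "1 < p" using b p by auto
  have "(p - 1) * 1 < \<beta> * p" using p \<beta> by (intro mult_strict_mono) auto
  hence pb: "p - 1 < \<beta> * p" by simp
  define M where "M = 1 / (1 - (\<beta> - 1))"
  have M: "0 < M" using b by (simp add: M_def)
  \<comment> \<open>With this length, \<open>3 * u / L powr \<beta>\<close>, the Hoelder constant
    found below for \<open>F'\<close> on a cell, becomes \<open>A / 2\<close>.\<close>
  define L where "L R u = (6 * u / A R) powr (1 / \<beta>)" for R u
  \<comment> \<open>Since \<open>(6 / 5)^2 < 2\<close>, the second cell has positive length. The 24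
    gives \<open>6 * u / A \<le> D / (4 * A)\<close>, hence \<open>L \<le> R / 2\<close> because
    \<open>\<beta> < 2\<close>, and it keeps \<open>2 * u\<close> below \<open>D\<close>.\<close>
  define nxt where "nxt R u = min (6 / 5 * u) (D R / 24)" for R u
  \<comment> \<open>Both cells of a pair share one value of \<open>\<epsilon>\<close>, so the
    changes of \<open>H\<close> are proportional to the squared lengths. The fall has to be
    \<open>2 - (nxt R u / u)^2\<close> times the rise.\<close>
  define L' where "L' R u = L R u * sqrt (2 - (nxt R u / u)\<^sup>2)" for R u
  \<comment> \<open>The amplitude starts at \<open>D 1 / 24\<close> although the radius starts at 4:
    to the left of 4 the coefficient is the constant \<open>v 0\<close> and has to obey (G) already
    for \<open>R = 1\<close>.\<close>
  define state where "state = rec_nat (4, D 1 / 24) (\<lambda>_ (R, u). (R + L R u + L' R u, nxt R u))"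
  define Y where "Y j = fst (state j)" for j
  define v where "v j = snd (state j)" for j
  have Y0: "Y 0 = 4" and v0: "v 0 = D 1 / 24" by (simp_all add: Y_def v_def state_def)
  have YS: "Y (Suc j) = Y j + L (Y j) (v j) + L' (Y j) (v j)" and vS: "v (Suc j) = nxt (Y j) (v j)" for j
    by (simp_all add: Y_def v_def state_def case_prod_beta)
  have LY: "0 < L R u" "L R u \<le> R / 2" if "1 \<le> R" "0 < u" "u \<le> D R / 24" for R u
  proof -
    have pos: "0 < A R" "0 < D R" using GD(1,2) that by auto
    show "0 < L R u" using pos that by (simp add: L_def)
    have "L R u \<le> ((D R / A R) * (1 / 4)) powr (1 / \<beta>)"
      unfolding L_def using pos that \<beta>0 by (intro powr_mono2) (auto simp: field_simps)
    also have "\<dots> = (D R / A R) powr (1 / \<beta>) * (1 / 4) powr (1 / \<beta>)" by (rule powr_mult)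
    also have "\<dots> \<le> R * (1 / 2)"
    proof (intro mult_mono growth_pair_length_le[OF G \<beta>0 that(1)])
      have "(1 / 4 :: real) powr (1 / \<beta>) \<le> (1 / 4) powr (1 / 2)"
        using b by (intro powr_mono') (auto simp: field_simps)
      also have "\<dots> = 1 / 2" using powr_half_sqrt[of "1 / 4"] by (simp add: real_sqrt_divide)
      finally show "(1 / 4 :: real) powr (1 / \<beta>) \<le> 1 / 2" .
    qed (use that in auto)
    finally show "L R u \<le> R / 2" by simp
  qed
  have nxt: "u \<le> nxt R u" "nxt R u \<le> 6 / 5 * u" "nxt R u \<le> D R / 24" if "0 < u" "u \<le> D R / 24" for R u
    using that by (auto simp: nxt_def)
  have ratio: "14 / 25 \<le> 2 - (nxt R u / u)\<^sup>2" "2 - (nxt R u / u)\<^sup>2 \<le> 1" if "0 < u" "u \<le> D R / 24" for R u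
  proof -
    have r: "1 \<le> nxt R u / u" "nxt R u / u \<le> 6 / 5" using nxt[OF that] that by (auto simp: field_simps)
    have "(nxt R u / u)\<^sup>2 \<le> (6 / 5)\<^sup>2" using r by (intro power_mono) auto
    thus "14 / 25 \<le> 2 - (nxt R u / u)\<^sup>2" by (simp add: power2_eq_square)
    have "1\<^sup>2 \<le> (nxt R u / u)\<^sup>2" using r by (intro power_mono) auto
    thus "2 - (nxt R u / u)\<^sup>2 \<le> 1" by simp
  qed
  have L'Y: "0 < L' R u" "L' R u \<le> L R u" "(L' R u)\<^sup>2 = (L R u)\<^sup>2 * (2 - (nxt R u / u)\<^sup>2)"
    if "1 \<le> R" "0 < u" "u \<le> D R / 24" for R u
  proof -
    note r = ratio[OF that(2,3)] and L = LY[OF that]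
    show "0 < L' R u" unfolding L'_def using r L by (intro mult_pos_pos) auto
    have "sqrt (2 - (nxt R u / u)\<^sup>2) \<le> 1" using r by simp
    thus "L' R u \<le> L R u" unfolding L'_def using L by (simp add: mult_left_le)
    show "(L' R u)\<^sup>2 = (L R u)\<^sup>2 * (2 - (nxt R u / u)\<^sup>2)"
      unfolding L'_def using r by (simp add: power_mult_distrib)
  qed
  have inv: "4 \<le> Y j \<and> 0 < v j \<and> v j \<le> D (Y j) / 24" for j
  proof (induction j)
    case 0
    show ?case using GD(1)[of 1] GD(4)[of 1 4] by (simp add: Y0 v0)
  next
    case (Suc j)
    hence Y1: "1 \<le> Y j" by simp
    have "Y j \<le> Y (Suc j)" using LY(1)[OF Y1, of "v j"] L'Y(1)[OF Y1, of "v j"] Suc by (simp add: YS)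
    moreover from this have "D (Y j) \<le> D (Y (Suc j))" using Y1 by (intro GD(4))
    moreover have "v j \<le> v (Suc j)" "v (Suc j) \<le> D (Y j) / 24" using nxt[of "v j" "Y j"] Suc by (auto simp: vS)
    ultimately show ?case using Suc by auto
  qed
  have Y1: "1 \<le> Y j" and vpos: "0 < v j" and vD: "v j \<le> D (Y j) / 24" for j
    using inv[of j] by auto
  define l1 where "l1 j = L (Y j) (v j)" for j
  define l2 where "l2 j = L' (Y j) (v j)" for j
  have l1: "0 < l1 j" "l1 j \<le> Y j / 2" and l2: "0 < l2 j" "l2 j \<le> l1 j"
    and l2_sq: "(l2 j)\<^sup>2 = (l1 j)\<^sup>2 * (2 - (v (Suc j) / v j)\<^sup>2)" for j
    using LY[OF Y1 vpos vD, of j] L'Y[OF Y1 vpos vD, of j] by (auto simp: l1_def l2_def vS)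
  have YS': "Y (Suc j) = Y j + l1 j + l2 j" for j by (simp add: YS l1_def l2_def)
  have Ymono: "Y j \<le> Y (Suc j)" and Ydbl: "Y (Suc j) \<le> 2 * Y j" for j
    using l1[of j] l2[of j] by (auto simp: YS')
  have v_step: "v j \<le> v (Suc j)" for j using nxt(1)[OF vpos vD] by (simp add: vS)
  have v_ge: "v 0 \<le> v j" for j
  proof (induction j)
    case (Suc j)
    thus ?case using v_step[of j] by simp
  qed simp
  have pos: "0 < A (Y j)" "0 < D (Y j)" for j using GD(1,2)[OF Y1] by auto
  have l1_powr: "l1 j powr \<beta> = 6 * v j / A (Y j)" for j
    using pos(1)[of j] vpos[of j] \<beta>0 by (simp add: l1_def L_def powr_powr)
  \<comment> \<open>This value makes the rise of \<open>H\<close> on the first cell equal to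
    \<open>(v j)^2 / 2\<close>. It is quadratic in \<open>l1 j / v j\<close> since it measures an
    area.\<close>
  define \<eta> where "\<eta> j = 2 * M / \<beta> * (l1 j / v j)\<^sup>2" for j
  have \<eta>: "0 < \<eta> j" for j using M \<beta>0 l1[of j] vpos[of j] by (simp add: \<eta>_def)
  have unb: "\<exists>j. Z \<le> Y j" for Z
  proof (rule unbounded_of_steps)
    fix Z
    define c where "c = (6 * v 0 / A (max 4 Z)) powr (1 / \<beta>)"
    have Z1: "1 \<le> max 4 Z" by (simp add: le_max_iff_disj)
    have "0 < c" using vpos[of 0] GD(2)[OF Z1] by (simp add: c_def)
    moreover have "Y j + c \<le> Y (Suc j)" if "Y j \<le> Z" for j
    proof -
      have "6 * v 0 / A (max 4 Z) \<le> 6 * v j / A (Y j)"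
        using v_ge[of j] vpos[of j] GD(5)[OF Y1, of j "max 4 Z"] pos(1)[of j] that by (intro frac_le) auto
      hence "c \<le> l1 j"
        unfolding c_def l1_def L_def using vpos[of 0] GD(2)[OF Z1] \<beta>0 by (intro powr_mono2) auto
      thus ?thesis using l2[of j] by (simp add: YS')
    qed
    ultimately show "\<exists>c>0. \<forall>j. Y j \<le> Z \<longrightarrow> Y j + c \<le> Y (Suc j)" by blast
  qed
  \<comment> \<open>Up to a constant this is \<open>\<eta> j powr (p / 2)\<close>, the cost of pair
    \<open>j\<close>.\<close>
  define s where "s j = (l1 j / v j) powr p" for j
  define \<rho> where "\<rho> = ((6 / 5) powr (1 / \<beta> - 1)) powr p"
  \<comment> \<open>The density is taken one pair before the increment, because
    \<open>v (Suc j)\<close> is limited by \<open>D (Y j)\<close>. The factor 4 in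
    \<open>growth_density_summable\<close> absorbs this delay.\<close>
  define r where "r j = 24 powr p * ((Y (Suc (Suc j)) - Y (Suc j)) * growth_density p \<beta> D A (Y j))" for j
  text \<open>When \<open>D\<close> jumps, the amplitude \<open>v\<close> lags behind \<open>D\<close> and grows geometrically. The costs
    \<open>s\<close> of these catch-up steps decrease geometrically because \<open>\<beta> > 1\<close>.\<close>
  have step: "s (Suc j) \<le> \<rho> * s j + r j" for j
  proof -
    have sn: "0 \<le> s j" "0 \<le> \<rho>" "0 \<le> r j"
      using Ymono[of "Suc j"] by (auto simp: s_def \<rho>_def r_def growth_density_def)
    have AA: "A (Y j) \<le> A (Y (Suc j))" using Y1 Ymono by (intro GD(5))
    have l1S: "l1 (Suc j) \<le> (6 * v (Suc j) / A (Y j)) powr (1 / \<beta>)"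
      unfolding l1_def L_def using AA pos(1) vpos[of "Suc j"] \<beta>0
      by (intro powr_mono2 frac_le) (auto simp: less_imp_le)
    consider "v (Suc j) = 6 / 5 * v j" | "v (Suc j) = D (Y j) / 24" unfolding vS nxt_def min_def by metis
    thus ?thesis
    proof cases
      case 1
      have "l1 (Suc j) / v (Suc j) \<le> (6 / 5 * (6 * v j / A (Y j))) powr (1 / \<beta>) / (6 / 5 * v j)"
        using l1S vpos[of j] unfolding 1 by (intro divide_right_mono) (auto simp: mult_ac)
      also have "\<dots> = (6 / 5) powr (1 / \<beta> - 1) * (l1 j / v j)"
      proof -
        have "(6 / 5 * (6 * v j / A (Y j))) powr (1 / \<beta>) = (6 / 5) powr (1 / \<beta>) * l1 j"
          unfolding l1_def L_def by (rule powr_mult)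
        thus ?thesis by (simp only: powr_diff) simp
      qed
      finally have "s (Suc j) \<le> ((6 / 5) powr (1 / \<beta> - 1) * (l1 j / v j)) powr p"
        unfolding s_def using p1 l1(1)[of "Suc j"] vpos[of "Suc j"] by (intro powr_mono2) auto
      also have "\<dots> = \<rho> * s j" unfolding \<rho>_def s_def by (rule powr_mult)
      finally show ?thesis using sn by simp
    next
      case 2
      let ?D = "D (Y j)" and ?A = "A (Y j)"
      have "l1 (Suc j) powr (p - 1) \<le> ((6 * v (Suc j) / ?A) powr (1 / \<beta>)) powr (p - 1)"
        using l1S l1(1)[of "Suc j"] p1 by (intro powr_mono2) auto
      also have "\<dots> = (6 * v (Suc j) / ?A) powr ((p - 1) / \<beta>)" by (simp add: powr_powr)
      also have "\<dots> \<le> (?D / ?A) powr ((p - 1) / \<beta>)"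
        using pos[of j] p1 \<beta>0 unfolding 2 by (intro powr_mono2 divide_right_mono) auto
      also have "\<dots> = ?D powr ((p - 1) / \<beta>) * ?A powr ((1 - p) / \<beta>)"
        using pos[of j] powr_minus_divide[of ?A "(p - 1) / \<beta>"] by (simp add: powr_divide minus_divide_left)
      finally have l: "l1 (Suc j) powr (p - 1) \<le> ?D powr ((p - 1) / \<beta>) * ?A powr ((1 - p) / \<beta>)" .
      have "s (Suc j) = l1 (Suc j) powr (1 + (p - 1)) / v (Suc j) powr p"
        by (simp add: s_def powr_divide)
      also have "l1 (Suc j) powr (1 + (p - 1)) = l1 (Suc j) * l1 (Suc j) powr (p - 1)"
        using l1(1)[of "Suc j"] by (simp only: powr_add powr_one)
      also have "v (Suc j) powr p = ?D powr p / 24 powr p" unfolding 2 by (rule powr_divide)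
      also have "l1 (Suc j) * l1 (Suc j) powr (p - 1) / (?D powr p / 24 powr p)
          = 24 powr p * (l1 (Suc j) * (l1 (Suc j) powr (p - 1) * ?D powr (- p)))"
        by (simp only: powr_minus_divide) simp
      also have "\<dots> \<le> 24 powr p * (l1 (Suc j) * ((?D powr ((p - 1) / \<beta>) * ?A powr ((1 - p) / \<beta>)) * ?D powr (- p)))"
        using l l1(1)[of "Suc j"] by (intro mult_left_mono mult_right_mono) auto
      also have "(?D powr ((p - 1) / \<beta>) * ?A powr ((1 - p) / \<beta>)) * ?D powr (- p)
          = ?A powr ((1 - p) / \<beta>) * (?D powr ((p - 1) / \<beta>) * ?D powr (- p))" by (simp only: mult_ac)
      also have "?D powr ((p - 1) / \<beta>) * ?D powr (- p) = ?D powr ((p - 1 - \<beta> * p) / \<beta>)"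
        using \<beta>0 by (simp add: diff_divide_distrib flip: powr_add)
      also have "?A powr ((1 - p) / \<beta>) * ?D powr ((p - 1 - \<beta> * p) / \<beta>) = growth_density p \<beta> D A (Y j)"
        using pos[of j] by (simp add: growth_density_def powr_mult powr_powr)
      also have "24 powr p * (l1 (Suc j) * growth_density p \<beta> D A (Y j)) \<le> r j"
        unfolding r_def using l2(1)[of "Suc j"] YS'[of "Suc j"]
        by (intro mult_left_mono mult_right_mono) (auto simp: growth_density_def)
      finally show ?thesis using mult_nonneg_nonneg[OF sn(2,1)] by simp
    qed
  qed
  have "summable r"
    unfolding r_def[abs_def]
  proof (intro summable_mult growth_density_summable[OF p1 \<beta>0 pb G fin])
    show "4 \<le> Y (Suc 0)" using Ymono[of 0] by (simp add: Y0)
    show "Y (Suc (Suc j)) \<le> 4 * Y j" for j using Ydbl[of j] Ydbl[of "Suc j"] by simp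
  qed (rule Ymono)
  moreover have "0 \<le> r j" for j
    using Ymono[of "Suc j"] by (simp add: r_def growth_density_def)
  moreover have "\<rho> < 1"
  proof -
    have "(6 / 5 :: real) powr (1 / \<beta> - 1) < 1"
      using \<beta>1 powr_less_mono[of "1 / \<beta> - 1" 0 "6 / 5 :: real"] by simp
    hence "\<rho> < 1 powr p" unfolding \<rho>_def using p1 by (intro powr_less_mono2) simp_all
    thus ?thesis by simp
  qed
  moreover have "0 \<le> \<rho>" "0 \<le> s j" for j by (simp_all add: s_def \<rho>_def)
  ultimately have "summable s" using step by (intro summable_contraction[of s r \<rho>])
  hence "summable (\<lambda>j. (2 * M / \<beta>) powr (p / 2) * s j)" by (rule summable_mult)
  also have "(\<lambda>j. (2 * M / \<beta>) powr (p / 2) * s j) = (\<lambda>j. \<eta> j powr (p / 2))"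
  proof
    fix j
    have "((l1 j / v j)\<^sup>2) powr (p / 2) = ((l1 j / v j) powr 2) powr (p / 2)"
      using l1(1)[of j] vpos[of j] by simp
    hence "((l1 j / v j)\<^sup>2) powr (p / 2) = s j" unfolding s_def by (simp only: powr_powr) simp
    thus "(2 * M / \<beta>) powr (p / 2) * s j = \<eta> j powr (p / 2)"
      unfolding \<eta>_def by (simp only: powr_mult)
  qed
  finally have sm: "summable (\<lambda>j. \<eta> j powr (p / 2))" .
  interpret cell_pairs Y l1 l2 \<eta> "p / 2" "\<beta> - 1"
    by (standard; use l1 l2 \<eta> YS' unb sm p b in simp)
  have m: "m = M" by (simp add: m_def M_def)
  \<comment> \<open>This is the total change of \<open>H\<close> across cell \<open>i\<close>; the
    \<open>\<beta>\<close> in the denominator cancels the one in the derivative of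
    \<open>cstep \<beta>\<close>.\<close>
  define h where "h i = (-1) ^ i * (m * (l i)\<^sup>2 / (\<beta> * \<epsilon> i))" for i
  define H where "H x = (v 0)\<^sup>2 / 2 + superposition e l h (cstep \<beta>) x" for x
  have h_even: "h (2 * j) = (v j)\<^sup>2 / 2" for j
    using M \<beta>0 l1(1)[of j] vpos[of j] by (simp add: h_def m l_def \<epsilon>_def \<eta>_def power_divide)
  have h_odd: "h (Suc (2 * j)) = (v (Suc j))\<^sup>2 / 2 - (v j)\<^sup>2" for j
  proof -
    have "h (Suc (2 * j)) = - (M * ((l1 j)\<^sup>2 * (2 - (v (Suc j) / v j)\<^sup>2)) / (\<beta> * \<eta> j))"
      by (simp add: h_def m l_def \<epsilon>_def l2_sq)
    also have "\<dots> = - ((v j)\<^sup>2 / 2 * (2 - (v (Suc j) / v j)\<^sup>2))"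
      using M \<beta>0 l1(1)[of j] vpos[of j] by (simp add: \<eta>_def power_divide)
    also have "\<dots> = (v (Suc j))\<^sup>2 / 2 - (v j)\<^sup>2"
      using vpos[of j] by (simp add: power_divide right_diff_distrib)
    finally show ?thesis .
  qed
  have h_sum: "(\<Sum>k<2 * j. h k) = (v j)\<^sup>2 / 2 - (v 0)\<^sup>2 / 2" for j
    by (induction j) (simp_all add: h_even h_odd)
  have H_cell: "(v (i div 2))\<^sup>2 / 2 \<le> H x \<and> H x \<le> (v (i div 2))\<^sup>2" if x: "e i \<le> x" "x \<le> e (Suc i)" for i x
  proof -
    define j where "j = i div 2"
    define c where "c = cstep \<beta> ((x - e i) / l i)"
    have c: "0 \<le> c" "c \<le> 1" unfolding c_def using cstep_bounds \<beta>0 by auto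
    have Hx: "H x = (v 0)\<^sup>2 / 2 + (\<Sum>k<i. h k) + h i * c"
      unfolding H_def c_def using superposition_cell[of "cstep \<beta>" 1 i x h] x
      by (simp add: cstep_le_0 cstep_ge_1)
    have vv: "(v j)\<^sup>2 \<le> (v (Suc j))\<^sup>2" using v_step[of j] vpos[of j] by (intro power_mono) auto
    have vv2: "(v (Suc j))\<^sup>2 \<le> 2 * (v j)\<^sup>2"
    proof -
      have "(v (Suc j))\<^sup>2 \<le> (6 / 5 * v j)\<^sup>2"
        using nxt(2)[OF vpos vD, of j] vpos[of "Suc j"] unfolding vS by (intro power_mono) auto
      also have "\<dots> \<le> 2 * (v j)\<^sup>2" by (simp add: power_mult_distrib power_divide)
      finally show ?thesis .
    qed
    show ?thesis
    proof (cases "even i")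
      case True
      hence i: "i = 2 * j" by (simp add: j_def)
      have "H x = (v j)\<^sup>2 / 2 + (v j)\<^sup>2 / 2 * c" unfolding Hx i h_sum h_even by simp
      moreover have "0 \<le> (v j)\<^sup>2 / 2 * c" "(v j)\<^sup>2 / 2 * c \<le> (v j)\<^sup>2 / 2 * 1"
        using c by (intro mult_nonneg_nonneg mult_left_mono; simp)+
      ultimately show ?thesis unfolding j_def[symmetric] by auto
    next
      case False
      hence i: "i = Suc (2 * j)" by (simp add: j_def)
      have "H x = (v j)\<^sup>2 - ((v j)\<^sup>2 - (v (Suc j))\<^sup>2 / 2) * c"
        unfolding Hx i sum.lessThan_Suc h_sum h_even h_odd by (simp add: left_diff_distrib right_diff_distrib)
      moreover have "0 \<le> ((v j)\<^sup>2 - (v (Suc j))\<^sup>2 / 2) * c"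
        "((v j)\<^sup>2 - (v (Suc j))\<^sup>2 / 2) * c \<le> ((v j)\<^sup>2 - (v (Suc j))\<^sup>2 / 2) * 1"
        using c vv2 by (intro mult_nonneg_nonneg mult_left_mono; simp)+
      ultimately show ?thesis unfolding j_def[symmetric] using vv by auto
    qed
  qed
  have H_before: "H x = (v 0)\<^sup>2 / 2" if "x \<le> e 0" for x
    unfolding H_def using superposition_before[of "cstep \<beta>" x h] that by (simp add: cstep_le_0)
  have cell: "\<exists>i. e i \<le> x \<and> x < e (Suc i)" if "\<not> x \<le> e 0" for x
  proof -
    obtain N where "x < e N" using e_unbounded by blast
    thus ?thesis using cell_exists[of x N] that by (metis linear)
  qed
  have Hpos: "0 < H x" for x
  proof (cases "x \<le> e 0")
    case True
    thus ?thesis unfolding H_before[OF True] using vpos[of 0] by simp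
  next
    case False
    then obtain i where "e i \<le> x" "x < e (Suc i)" using cell by blast
    moreover have "0 < (v (i div 2))\<^sup>2 / 2" using vpos[of "i div 2"] by simp
    ultimately show ?thesis using H_cell[of i x] by linarith
  qed
  have H_der: "(H has_real_derivative field x) (at x)" for x
  proof -
    obtain N where N: "x < e N" using e_unbounded by blast
    have "(superposition e l h (cstep \<beta>) has_real_derivative
        superposition e l (\<lambda>i. h i / l i) (\<lambda>u. \<beta> * 2 powr (\<beta> - 1) * hat u powr (\<beta> - 1)) x) (at x)"
      by (rule superposition_has_derivative[OF _ _ cstep_has_derivative[OF \<beta>1] N])
        (auto simp: cstep_le_0 hat_outside)
    moreover have "h i / l i * (\<beta> * 2 powr (\<beta> - 1) * w) = (-1) ^ i * (l i / \<epsilon> i) * (m * 2 powr (\<beta> - 1)) * w" for i w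
      using l_pos[of i] \<beta>0 by (simp add: h_def power2_eq_square)
    ultimately show ?thesis
      unfolding H_def[abs_def] field_def superposition_def by (auto intro!: derivative_eq_intros)
  qed
  define F where "F x = sqrt (2 * H x)" for x
  define F' where "F' x = field x / F x" for x
  have Fpos: "0 < F x" for x using Hpos[of x] by (simp add: F_def)
  have F_der: "(F has_real_derivative F' x) (at x)" for x
  proof -
    have 2: "0 < 2 * H x" using Hpos[of x] by simp
    have D: "((\<lambda>x. sqrt (2 * H x)) has_real_derivative inverse (sqrt (2 * H x)) / 2 * (2 * field x)) (at x)"
      by (rule DERIV_chain2[OF DERIV_real_sqrt[OF 2] DERIV_cmult[OF H_der]])
    have "inverse (sqrt (2 * H x)) / 2 * (2 * field x) = F' x"
      unfolding F'_def F_def by (simp only: divide_inverse) simp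
    moreover have "F = (\<lambda>x. sqrt (2 * H x))" by (rule ext) (rule F_def)
    ultimately show ?thesis using D by (simp only:)
  qed
  have F_ge: "v (i div 2) \<le> F x" and F_le: "F x \<le> 2 * v (i div 2)" if "e i \<le> x" "x \<le> e (Suc i)" for i x
  proof -
    have "(v (i div 2))\<^sup>2 \<le> 2 * H x" "2 * H x \<le> (2 * v (i div 2))\<^sup>2"
      using H_cell[OF that] zero_le_power2[of "v (i div 2)"] four_x_squared[of "v (i div 2)"] by linarith+
    hence "sqrt ((v (i div 2))\<^sup>2) \<le> F x" "F x \<le> sqrt ((2 * v (i div 2))\<^sup>2)"
      unfolding F_def by (simp_all only: real_sqrt_le_mono)
    thus "v (i div 2) \<le> F x" "F x \<le> 2 * v (i div 2)"
      using vpos[of "i div 2"] unfolding real_sqrt_abs by simp_all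
  qed
  have Yx: "1 \<le> Y (i div 2)" "Y (i div 2) \<le> x" if "e i \<le> x" for i x
    using Y_le_e[of i] Y1 that by auto
  have bound: "\<bar>F u\<bar> \<le> D R" if R: "1 \<le> R" "\<bar>u\<bar> \<le> R" for R u
  proof (cases "u \<le> e 0")
    case True
    have "2 * H u = (v 0)\<^sup>2" using H_before[OF True] by simp
    hence "F u = v 0" unfolding F_def using vpos[of 0] by simp
    thus ?thesis using GD(1)[of 1] GD(4)[of 1 R] R by (simp add: v0)
  next
    case False
    then obtain i where i: "e i \<le> u" "u < e (Suc i)" using cell by blast
    have "F u \<le> 2 * v (i div 2)" using F_le i by auto
    also have "\<dots> \<le> D (Y (i div 2))" using vD[of "i div 2"] pos(2)[of "i div 2"] by simp
    also have "\<dots> \<le> D R" using Yx[OF i(1)] R by (intro GD(4)) auto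
    finally show ?thesis using Fpos[of u] by simp
  qed
  have cellH: "\<bar>F' u - F' w\<bar> \<le> A R / 2 * \<bar>u - w\<bar> powr (\<beta> - 1)"
    if R: "1 \<le> R" and uw: "e i \<le> u" "u \<le> w" "w \<le> e (Suc i)" "w \<le> R" for R i u w
  proof -
    define V where "V = v (i div 2)"
    define k where "k = l1 (i div 2)"
    \<comment> \<open>A bound for the field on the cell, and a Lipschitz constant of
      \<open>H\<close> there; combined with \<open>F \<ge> V\<close> it gives the Lipschitz constant
      \<open>\<alpha> / V\<close> for \<open>F\<close>.\<close>
    define \<alpha> where "\<alpha> = V\<^sup>2 / k"
    have V: "0 < V" and k: "0 < k" "l i \<le> k" "0 < l i"
      using vpos l1 l2[of "i div 2"] l_pos by (auto simp: V_def k_def l_def)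
    have \<alpha>: "0 < \<alpha>" using V k by (simp add: \<alpha>_def)
    have \<epsilon>i: "\<epsilon> i = 2 * M / \<beta> * (k / V)\<^sup>2" by (simp add: \<epsilon>_def \<eta>_def k_def V_def)
    have km: "k / \<epsilon> i * m \<le> \<alpha>"
    proof -
      have "k / \<epsilon> i * m = \<beta> / 2 * \<alpha>"
        using M \<beta>0 k V unfolding \<epsilon>i m \<alpha>_def by (simp add: power2_eq_square field_simps)
      also have "\<dots> \<le> 1 * \<alpha>" using b \<alpha> by (intro mult_right_mono) auto
      finally show ?thesis by simp
    qed
    have amp: "l i / \<epsilon> i * m \<le> \<alpha>"
    proof -
      have "l i / \<epsilon> i * m \<le> k / \<epsilon> i * m"
        using k M \<epsilon>_pos[of i] unfolding m by (intro mult_right_mono divide_right_mono) auto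
      thus ?thesis using km by simp
    qed
    have field_le: "\<bar>field x\<bar> \<le> \<alpha>" if "e i \<le> x" "x \<le> e (Suc i)" for x
      using field_cell_bound[OF that] amp by simp
    have "l i powr (1 - (\<beta> - 1)) \<le> k powr (1 - (\<beta> - 1))" using k b by (intro powr_mono2) auto
    hence lk: "l i * l i powr (- (\<beta> - 1)) \<le> k * k powr (- (\<beta> - 1))"
      using k by (simp add: powr_diff powr_minus_divide power2_eq_square)
    have hoel: "\<bar>field u - field w\<bar> \<le> 2 * (\<alpha> * k powr (- (\<beta> - 1))) * \<bar>u - w\<bar> powr (\<beta> - 1)"
    proof -
      have "l i / \<epsilon> i * m * 2 powr (\<beta> - 1) * l i powr (- (\<beta> - 1))
          = 2 powr (\<beta> - 1) * (m / \<epsilon> i) * (l i * l i powr (- (\<beta> - 1)))" by simp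
      also have "\<dots> \<le> 2 powr 1 * (m / \<epsilon> i) * (k * k powr (- (\<beta> - 1)))"
        using b M \<epsilon>_pos[of i] k unfolding m
        by (intro mult_mono[OF mult_right_mono lk] powr_mono mult_nonneg_nonneg divide_nonneg_nonneg) auto
      also have "\<dots> = 2 * ((k / \<epsilon> i * m) * k powr (- (\<beta> - 1)))" by simp
      also have "\<dots> \<le> 2 * (\<alpha> * k powr (- (\<beta> - 1)))" using km by (intro mult_left_mono mult_right_mono) auto
      finally have K: "l i / \<epsilon> i * m * 2 powr (\<beta> - 1) * l i powr (- (\<beta> - 1)) \<le> 2 * (\<alpha> * k powr (- (\<beta> - 1)))" .
      have "\<bar>field u - field w\<bar> \<le> l i / \<epsilon> i * m * 2 powr (\<beta> - 1) * l i powr (- (\<beta> - 1)) * \<bar>u - w\<bar> powr (\<beta> - 1)"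
        using uw by (intro field_cell_hoelder) auto
      also have "\<dots> \<le> 2 * (\<alpha> * k powr (- (\<beta> - 1))) * \<bar>u - w\<bar> powr (\<beta> - 1)" using K by (intro mult_right_mono) auto
      finally show ?thesis .
    qed
    have FV: "V \<le> F u" "V \<le> F w" using F_ge[of i u] F_ge[of i w] uw by (auto simp: V_def)
    have h1: "\<bar>H w - H u\<bar> \<le> \<alpha> * (w - u)"
    proof (rule abs_diff_le_finite_exceptions[of "{}" u w H \<alpha> field])
      show "continuous_on {u..w} H"
        by (intro continuous_at_imp_continuous_on ballI DERIV_isCont[OF H_der])
    qed (use uw \<alpha> H_der field_le in auto)
    have h2: "\<bar>F w - F u\<bar> * (2 * V) \<le> \<bar>F w - F u\<bar> * (F w + F u)" using FV by (intro mult_left_mono) auto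
    have h3: "\<bar>F w - F u\<bar> * (F w + F u) = 2 * \<bar>H w - H u\<bar>"
    proof -
      have "(F w - F u) * (F w + F u) = 2 * (H w - H u)"
        using Hpos[of u] Hpos[of w] by (simp add: F_def algebra_simps)
      moreover have "\<bar>F w - F u\<bar> * (F w + F u) = \<bar>(F w - F u) * (F w + F u)\<bar>"
        using Fpos[of u] Fpos[of w] by (simp add: abs_mult)
      moreover have "\<bar>2 * (H w - H u)\<bar> = 2 * \<bar>H w - H u\<bar>" by (simp only: abs_mult abs_numeral)
      ultimately show ?thesis by (simp only:)
    qed
    have "\<bar>F w - F u\<bar> * (2 * V) \<le> 2 * (\<alpha> * (w - u))"
      using h1 by (intro order_trans[OF h2[unfolded h3]] mult_left_mono) auto
    hence dF: "\<bar>F w - F u\<bar> \<le> \<alpha> * (w - u) / V" using V by (simp add: pos_le_divide_eq)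
    have wu: "w - u \<le> k" using uw e_Suc[of i] k by simp
    \<comment> \<open>Within a cell distances are at most \<open>k\<close>, so a Lipschitz bound
      yields a Hoelder bound with exponent \<open>\<beta> - 1\<close>.\<close>
    have lin: "w - u \<le> \<bar>u - w\<bar> powr (\<beta> - 1) * k powr (1 - (\<beta> - 1))"
    proof (cases "u = w")
      case False
      hence "w - u = (w - u) powr ((\<beta> - 1) + (1 - (\<beta> - 1)))" using uw by simp
      also have "\<dots> = (w - u) powr (\<beta> - 1) * (w - u) powr (1 - (\<beta> - 1))" by (rule powr_add)
      also have "\<dots> \<le> (w - u) powr (\<beta> - 1) * k powr (1 - (\<beta> - 1))"
        using wu uw b by (intro mult_left_mono powr_mono2) auto
      finally show ?thesis using uw by simp
    qed simp
    let ?t = "\<bar>u - w\<bar> powr (\<beta> - 1)"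
    have dF': "\<bar>F w - F u\<bar> \<le> \<alpha> * (?t * k powr (1 - (\<beta> - 1))) / V"
    proof -
      have "\<alpha> * (w - u) / V \<le> \<alpha> * (?t * k powr (1 - (\<beta> - 1))) / V"
        using lin \<alpha> V by (intro divide_right_mono mult_left_mono) auto
      thus ?thesis using dF by simp
    qed
    have "\<bar>F' u - F' w\<bar> \<le> \<bar>field u - field w\<bar> / F u + \<bar>field w\<bar> * (\<bar>F w - F u\<bar> / (F u * F w))"
      unfolding F'_def by (rule abs_diff_quotient_le[OF Fpos Fpos])
    also have "\<dots> \<le> (2 * (\<alpha> * k powr (- (\<beta> - 1))) * ?t) / V
        + \<alpha> * ((\<alpha> * (?t * k powr (1 - (\<beta> - 1))) / V) / (V * V))"
    proof (rule add_mono)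
      show "\<bar>field u - field w\<bar> / F u \<le> (2 * (\<alpha> * k powr (- (\<beta> - 1))) * ?t) / V"
        using hoel FV(1) V \<alpha> by (intro frac_le) auto
      have "V * V \<le> F u * F w" using FV V by (intro mult_mono) auto
      hence "\<bar>F w - F u\<bar> / (F u * F w) \<le> (\<alpha> * (?t * k powr (1 - (\<beta> - 1))) / V) / (V * V)"
        using dF' V \<alpha> by (intro frac_le) auto
      thus "\<bar>field w\<bar> * (\<bar>F w - F u\<bar> / (F u * F w)) \<le> \<alpha> * ((\<alpha> * (?t * k powr (1 - (\<beta> - 1))) / V) / (V * V))"
        using field_le[of w] uw \<alpha> Fpos[of u] Fpos[of w] by (intro mult_mono) auto
    qed
    \<comment> \<open>Two parts come from the oscillation of the field and one from the change of
      the denominator \<open>F\<close>.\<close>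
    also have "\<dots> = 3 * (V / k powr \<beta>) * ?t"
    proof -
      have e1: "k powr (- (\<beta> - 1)) = k / k powr \<beta>" "k powr (1 - (\<beta> - 1)) = k * (k / k powr \<beta>)"
        using k by (simp_all add: powr_diff powr_minus_divide power2_eq_square)
      have alg: "(2 * (V\<^sup>2 / k * (k / K)) * t) / V + V\<^sup>2 / k * ((V\<^sup>2 / k * (t * (k * (k / K))) / V) / (V * V)) = 3 * (V / K) * t"
        if "0 < K" for K t using that V k by (simp add: power2_eq_square)
      show ?thesis unfolding e1 \<alpha>_def using k by (intro alg) simp
    qed
    also have "V / k powr \<beta> = A (Y (i div 2)) / 6"
      unfolding k_def l1_powr using V by (simp add: V_def)
    also have "3 * (A (Y (i div 2)) / 6) * \<bar>u - w\<bar> powr (\<beta> - 1) \<le> A R / 2 * \<bar>u - w\<bar> powr (\<beta> - 1)"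
    proof (rule mult_right_mono)
      have "A (Y (i div 2)) \<le> A R" using Yx[OF uw(1)] uw by (intro GD(5)) auto
      thus "3 * (A (Y (i div 2)) / 6) \<le> A R / 2" by simp
    qed simp
    finally show ?thesis .
  qed
  have F'0: "x \<le> e 0 \<Longrightarrow> F' x = 0" and F'e: "F' (e i) = 0" for x i
    by (simp_all add: F'_def field_before field_grid_point)
  have hoelder: "\<bar>F' u - F' w\<bar> \<le> A R * \<bar>u - w\<bar> powr (\<beta> - 1)" if R: "1 \<le> R" and uw: "u \<le> w" "w \<le> R" for R u w
    using hoelder_glue[OF e_unbounded F'0 F'e cellH[OF R] _ _ uw] GD(2)[OF R] b by simp
  have "cond_G p \<beta> (Suc 0) (Suc 0) D A (\<lambda>y i j. F (y 0))"
  proof (rule cond_G_1_rough[OF p(1) _ F_der])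
    fix R u w :: real assume *: "1 \<le> R" "\<bar>u\<bar> \<le> R" "\<bar>w\<bar> \<le> R"
    show "\<bar>F' w - F' u\<bar> \<le> A R * \<bar>w - u\<bar> powr (\<beta> - 1)"
    proof (cases "u \<le> w")
      case True
      thus ?thesis using hoelder[OF *(1), of u w] * by (simp add: abs_minus_commute)
    next
      case False
      thus ?thesis using hoelder[OF *(1), of w u] * by simp
    qed
  qed (use bound in auto)
  moreover have "driver p (Suc 0) (\<lambda>t i. 0) (\<lambda>r j s t. signal t - signal s)"
    unfolding driver_def
  proof (intro conjI allI impI)
    have "continuous_map (top_of_set {0..}) (Euclidean_space (Suc 0)) (\<lambda>t. line_point 0)"
      by (rule continuous_map_line_point) simp
    moreover have "line_point 0 = (\<lambda>i. 0)" by (auto simp: line_point_def)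
    ultimately show "continuous_map (top_of_set {0..}) (Euclidean_space (Suc 0)) (\<lambda>t i. 0)" by simp
    fix T' :: real
    have c: "control T' (\<lambda>t. t)" by (simp add: control_def monotone_on_def)
    have pv: "pvar_bound p (Suc 0) (\<lambda>t i. 0) T' (\<lambda>t. t)" by (simp add: pvar_bound_def edist_1)
    show "finite_pvar p (Suc 0) (\<lambda>t i. 0) T'" unfolding finite_pvar_def using c pv by blast
    show "area_cond p (Suc 0) (\<lambda>t i. 0) (\<lambda>r j s t. signal t - signal s) T'"
      unfolding area_cond_def
    proof (intro conjI exI[of _ "\<lambda>t. t"] c pv allI impI)
      fix s t :: real assume "0 \<le> s \<and> s \<le> t \<and> t \<le> T'"
      thus "\<bar>signal t - signal s\<bar> powr (p / 2) \<le> t - s" using signal_hoelder[of t s] by simp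
    qed simp
  qed
  moreover have "explodes p (Suc 0) (Suc 0) (\<lambda>y i j. F (y 0)) (\<lambda>t i. 0) (\<lambda>r j s t. signal t - signal s)
      (line_point (e 0)) (\<lambda>t. line_point (path t))"
  proof (rule explodes_1[OF _ explosion_time_pos path_0 path_explodes])
    show "0 < \<beta> - 1" using b by simp
    fix t1 assume "t1 < explosion_time"
    then obtain C where C: "0 \<le> C" "\<And>s t. 0 \<le> s \<Longrightarrow> s \<le> t \<Longrightarrow> t \<le> t1 \<Longrightarrow>
      \<bar>path t - path s - field (path s) * (signal t - signal s)\<bar> \<le> C * (t - s) powr (1 + (\<beta> - 1))"
      using path_increment by blast
    \<comment> \<open>With \<open>x = 0\<close> only the second-order term is left. By this identity
      it is the field times an increment of the signal, so \<open>path_increment\<close>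
      applies.\<close>
    have "F z * deriv F z = field z" for z
      using DERIV_imp_deriv[OF F_der] Fpos[of z] by (simp add: F'_def)
    hence "increment_error p (Suc 0) (Suc 0) (\<lambda>y i j. F (y 0)) (\<lambda>t i. 0) (\<lambda>r j s t. signal t - signal s) (\<lambda>t. line_point (path t)) 0 s t
        = path t - path s - field (path s) * (signal t - signal s)" for s t
      using p by (simp add: increment_error_def partial_deriv_1)
    thus "\<exists>C\<ge>0. \<forall>s t. 0 \<le> s \<and> s \<le> t \<and> t \<le> t1 \<longrightarrow>
      \<bar>increment_error p (Suc 0) (Suc 0) (\<lambda>y i j. F (y 0)) (\<lambda>t i. 0) (\<lambda>r j s t. signal t - signal s) (\<lambda>t. line_point (path t)) 0 s t\<bar>
        \<le> C * (t - s) powr (1 + (\<beta> - 1))"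
      using C by (intro exI[of _ C]) simp
  qed
  moreover have "(1::nat) \<le> Suc 0" by simp
  ultimately show ?thesis by blast
qed

theorem theorem6p1:
  fixes p \<gamma> \<beta> :: real
  assumes "(1 < p \<and> p < \<gamma> \<and> \<gamma> < 2) \<or> (2 \<le> p \<and> p < \<gamma> \<and> \<gamma> < 3)"
    and "\<beta> = \<gamma> - 1"
  shows
    "(\<forall>(n::nat) (d::nat) D A f x area y0.
        n \<ge> 1 \<and> d \<ge> 1 \<and> growth_pair \<beta> D A \<and> cond_G p \<beta> n d D A f \<and> driver p d x area \<and>
        growth_integral p \<beta> D A = \<infinity> \<longrightarrow>
        \<not> (\<exists>y. explodes p n d f x area y0 y)) \<and>
     (\<forall>D A. growth_pair \<beta> D A \<and> growth_integral p \<beta> D A < \<infinity> \<longrightarrow>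
        (\<exists>(n::nat) (d::nat) f x area y0 y.
           n \<ge> 1 \<and> d \<ge> 1 \<and> cond_G p \<beta> n d D A f \<and> driver p d x area \<and>
           explodes p n d f x area y0 y))"
proof (intro conjI allI impI)
  fix n d :: nat and D A :: "real \<Rightarrow> real" and f x area y0
  assume *: "n \<ge> 1 \<and> d \<ge> 1 \<and> growth_pair \<beta> D A \<and> cond_G p \<beta> n d D A f \<and> driver p d x area \<and>
    growth_integral p \<beta> D A = \<infinity>"
  interpret rough_equation p \<gamma> \<beta> n d D A f x area
    by unfold_locales (use assms * in auto)
  show "\<not> (\<exists>y. explodes p n d f x area y0 y)"
    using no_explosion * by blast
next
  fix D A :: "real \<Rightarrow> real"
  assume "growth_pair \<beta> D A \<and> growth_integral p \<beta> D A < \<infinity>"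
  thus "\<exists>(n::nat) (d::nat) f x area y0 y. n \<ge> 1 \<and> d \<ge> 1 \<and> cond_G p \<beta> n d D A f \<and> driver p d x area \<and>
      explodes p n d f x area y0 y"
    using assms explosion_young explosion_rough by blast
qed

end
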